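(* Let $F$ be a finite abelian group, let $\mathbf a=(a_1,\dots,a_s)$ be a composition of $n$, and put $S(\mathbf a)=S_{a_1}\times\cdots\times S_{a_s}\leqslant S_n$. Let $U$ be an irreducible representation of $F\wr S_n$ of the form $$U:=\mathrm{ind}_{F\wr S(\mathbf a)}^{F\wr S_n}(D_1;D_1'')\boxtimes\cdots\boxtimes(D_s;D_s''),$$ where $D_1,\dots,D_s$ are pairwise inequivalent irreducible representations of $F$ and $D_1'',\dots,D_s''$ are irreducible representations of $S_{a_1},\dots,S_{a_s}$, respectively. If $W$ is an irreducible representation of $S_n$, then the multiplicity of $U$ in $\mathrm{ind}^{F\wr S_n}_{S_n}W$ is equal to the multiplicity of $W$ in $\mathrm{ind}^{S_n}_{S(\mathbf a)}D_1''\boxtimes\cdots\boxtimes D_s''$.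
   Context: All groups are finite and all representations are finite-dimensional over $\mathbb{C}$. $F\wr S_n=F^n\rtimes S_n$ with product $(f,\sigma)(f',\sigma')=(f\,(\sigma\cdot f'),\sigma\sigma')$, $(\sigma\cdot f')_i=f'_{\sigma^{-1}(i)}$, and $S_n$ is regarded as the subgroup $\{(\mathrm{id},\sigma):\sigma\in S_n\}$. A composition of $n$ is a finite sequence of nonnegative integers with sum $n$. $F\wr S(\mathbf a)=F^n\rtimes S(\mathbf a)=F\wr S_{a_1}\times\cdots\times F\wr S_{a_s}$. For an irreducible representation $D$ of $F$ and an irreducible representation $D''$ of $S_m$, $(D;D''):=D^{(m)}\otimes D''$ is the representation of $F\wr S_m$ in which $D^{(m)}$ is the vector space $D^{\otimes m}$ with action $((f_1,\dots,f_m),\pi)\cdot(v_1\otimes\cdots\otimes v_m)=f_1v_{\pi^{-1}(1)}\otimes\cdots\otimes f_mv_{\pi^{-1}(m)}$, $D''$ is inflated along the projection $F\wr S_m\to S_m$, and $\otimes$ is the inner tensor product. *)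

theory Defs
  imports
    "Jordan_Normal_Form.VS_Connect"
    "HOL-Algebra.Sym_Groups"
    "HOL-Algebra.Product_Groups"
begin

definition GL :: "nat \<Rightarrow> complex mat monoid" where
  "GL d = units_of (ring_mat TYPE(complex) d ())"

text \<open>A representation on \<open>\<complex>\<^sup>d\<close> is a homomorphism into \<open>GL d\<close>, so up to a choice of basis these
  are all finite-dimensional complex representations. The values outside \<open>carrier G\<close> are
  irrelevant.\<close>

type_synonym 'g rep = "'g \<Rightarrow> complex mat"

definition rep_dim :: "('g, 'b) monoid_scheme \<Rightarrow> 'g rep \<Rightarrow> nat" where
  "rep_dim G \<rho> = dim_row (\<rho> \<one>\<^bsub>G\<^esub>)"

definition representation :: "('g, 'b) monoid_scheme \<Rightarrow> 'g rep \<Rightarrow> bool" where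
  "representation G \<rho> \<longleftrightarrow> \<rho> \<in> hom G (GL (rep_dim G \<rho>))"

definition invariant_subspace :: "('g, 'b) monoid_scheme \<Rightarrow> 'g rep \<Rightarrow> complex vec set \<Rightarrow> bool" where
  "invariant_subspace G \<rho> W \<longleftrightarrow>
     VectorSpace.subspace class_ring W (module_vec TYPE(complex) (rep_dim G \<rho>)) \<and>
     (\<forall>g\<in>carrier G. \<forall>w\<in>W. \<rho> g *\<^sub>v w \<in> W)"

definition irreducible_rep :: "('g, 'b) monoid_scheme \<Rightarrow> 'g rep \<Rightarrow> bool" where
  "irreducible_rep G \<rho> \<longleftrightarrow> representation G \<rho> \<and> rep_dim G \<rho> > 0 \<and>
     (\<forall>W. invariant_subspace G \<rho> W \<longrightarrow>
        W = {0\<^sub>v (rep_dim G \<rho>)} \<or> W = carrier_vec (rep_dim G \<rho>))"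

definition equivalent_reps :: "('g, 'b) monoid_scheme \<Rightarrow> 'g rep \<Rightarrow> 'g rep \<Rightarrow> bool" where
  "equivalent_reps G \<rho> \<sigma> \<longleftrightarrow> rep_dim G \<rho> = rep_dim G \<sigma> \<and>
     (\<exists>P\<in>carrier (GL (rep_dim G \<rho>)). \<forall>g\<in>carrier G. P * \<rho> g = \<sigma> g * P)"

definition direct_sum_rep :: "'g rep list \<Rightarrow> 'g rep" where
  "direct_sum_rep \<rho>s = (\<lambda>g. diag_block_mat (map (\<lambda>\<rho>. \<rho> g) \<rho>s))"

text \<open>The multiplicity of the irreducible representation \<open>\<rho>\<close> in \<open>\<sigma>\<close>: the number of summands
  equivalent to \<open>\<rho>\<close> in a decomposition of \<open>\<sigma>\<close> into irreducible representations. For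
  representations of a finite group such a decomposition exists (Maschke), and the number does
  not depend on it (Krull--Schmidt).\<close>

definition rep_multiplicity :: "('g, 'b) monoid_scheme \<Rightarrow> 'g rep \<Rightarrow> 'g rep \<Rightarrow> nat" where
  "rep_multiplicity G \<rho> \<sigma> =
     (THE m. \<exists>\<tau>s. (\<forall>\<tau>\<in>set \<tau>s. irreducible_rep G \<tau>) \<and>
                  equivalent_reps G \<sigma> (direct_sum_rep \<tau>s) \<and>
                  m = length (filter (equivalent_reps G \<rho>) \<tau>s))"

definition left_transversal :: "('g, 'b) monoid_scheme \<Rightarrow> 'g set \<Rightarrow> 'g list \<Rightarrow> bool" where
  "left_transversal G H ts \<longleftrightarrow> set ts \<subseteq> carrier G \<and>
     (\<forall>g\<in>carrier G. \<exists>!i. i < length ts \<and> g \<in> ts ! i <#\<^bsub>G\<^esub> H)"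

text \<open>The matrix of \<open>ind\<^sub>H\<^sup>G \<rho>\<close> with respect to the basis \<open>t\<^sub>i \<otimes> e\<^sub>j\<close>, where the \<open>t\<^sub>i\<close> run over
  representatives of the left cosets of \<open>H\<close>: its block in position \<open>(i, j)\<close> is
  \<open>\<rho> (t\<^sub>i\<^sup>-\<^sup>1 g t\<^sub>j)\<close> if this argument lies in \<open>H\<close> and \<open>0\<close> otherwise. Another choice of the \<open>t\<^sub>i\<close>
  leads to an equivalent representation.\<close>

definition induced_rep :: "('g, 'b) monoid_scheme \<Rightarrow> 'g set \<Rightarrow> 'g rep \<Rightarrow> 'g rep" where
  "induced_rep G H \<rho> =
     (let ts = (SOME ts. left_transversal G H ts); d = rep_dim G \<rho>; N = length ts * d
      in (\<lambda>g. mat N N (\<lambda>(x, y).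
            let h = inv\<^bsub>G\<^esub> (ts ! (x div d)) \<otimes>\<^bsub>G\<^esub> g \<otimes>\<^bsub>G\<^esub> (ts ! (y div d))
            in if h \<in> H then \<rho> h $$ (x mod d, y mod d) else 0)))"

definition kronecker :: "complex mat \<Rightarrow> complex mat \<Rightarrow> complex mat" where
  "kronecker A B = mat (dim_row A * dim_row B) (dim_col A * dim_col B)
     (\<lambda>(i, j). A $$ (i div dim_row B, j div dim_col B) * B $$ (i mod dim_row B, j mod dim_col B))"

definition kronecker_list :: "complex mat list \<Rightarrow> complex mat" where
  "kronecker_list As = foldr kronecker As (1\<^sub>m 1)"

definition wreath :: "('f, 'b) monoid_scheme \<Rightarrow> nat \<Rightarrow> ((nat \<Rightarrow> 'f) \<times> (nat \<Rightarrow> nat)) monoid" where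
  "wreath F n =
    \<lparr>carrier = carrier (product_group {1..n} (\<lambda>_. F)) \<times> carrier (sym_group n),
     monoid.mult = (\<lambda>(f, \<sigma>) (f', \<sigma>').
       (f \<otimes>\<^bsub>product_group {1..n} (\<lambda>_. F)\<^esub> (\<lambda>i\<in>{1..n}. f' (inv' \<sigma> i)), \<sigma> \<otimes>\<^bsub>sym_group n\<^esub> \<sigma>')),
     one = (\<one>\<^bsub>product_group {1..n} (\<lambda>_. F)\<^esub>, \<one>\<^bsub>sym_group n\<^esub>)\<rparr>"

definition wreath_top :: "('f, 'b) monoid_scheme \<Rightarrow> nat \<Rightarrow> ((nat \<Rightarrow> 'f) \<times> (nat \<Rightarrow> nat)) set" where
  "wreath_top F n = {\<one>\<^bsub>product_group {1..n} (\<lambda>_. F)\<^esub>} \<times> carrier (sym_group n)"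

text \<open>The basis vector \<open>e\<^bsub>i\<^sub>1\<^esub> \<otimes> \<dots> \<otimes> e\<^bsub>i\<^sub>m\<^esub>\<close> of the \<open>m\<close>-th tensor power of \<open>\<complex>\<^sup>d\<close> has the number
  whose \<open>m\<close> base-\<open>d\<close> digits are \<open>i\<^sub>1, \<dots>, i\<^sub>m\<close>, most significant digit first, which is the
  numbering used by \<open>kronecker\<close>.\<close>

definition tensor_digit :: "nat \<Rightarrow> nat \<Rightarrow> nat \<Rightarrow> nat \<Rightarrow> nat" where
  "tensor_digit d m k x = x div d ^ (m - k) mod d"

text \<open>\<open>((f\<^sub>1, \<dots>, f\<^sub>m), \<pi>) \<cdot> (v\<^sub>1 \<otimes> \<dots> \<otimes> v\<^sub>m)\<close> has \<open>k\<close>-th factor \<open>f\<^sub>k v\<^bsub>\<pi>\<^sup>-\<^sup>1(k)\<^esub>\<close>; the entry in row \<open>x\<close> and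
  column \<open>y\<close> is its coefficient at \<open>x\<close> for \<open>v\<^sub>1 \<otimes> \<dots> \<otimes> v\<^sub>m\<close> the basis vector \<open>y\<close>.\<close>

definition tensor_power_rep ::
  "('f, 'b) monoid_scheme \<Rightarrow> nat \<Rightarrow> 'f rep \<Rightarrow> ((nat \<Rightarrow> 'f) \<times> (nat \<Rightarrow> nat)) rep" where
  "tensor_power_rep F m D = (\<lambda>(f, \<pi>).
     let d = rep_dim F D in
     mat (d ^ m) (d ^ m) (\<lambda>(x, y).
       \<Prod>k = 1..m. D (f k) $$ (tensor_digit d m k x, tensor_digit d m (inv' \<pi> k) y)))"

text \<open>\<open>(D; D'') = D\<^sup>(\<^sup>m\<^sup>) \<otimes> D''\<close>, with \<open>D''\<close> inflated along \<open>(f, \<pi>) \<mapsto> \<pi>\<close>.\<close>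

definition wreath_rep ::
  "('f, 'b) monoid_scheme \<Rightarrow> nat \<Rightarrow> 'f rep \<Rightarrow> (nat \<Rightarrow> nat) rep \<Rightarrow>
   ((nat \<Rightarrow> 'f) \<times> (nat \<Rightarrow> nat)) rep" where
  "wreath_rep F m D D'' = (\<lambda>g. kronecker (tensor_power_rep F m D g) (D'' (snd g)))"

text \<open>A composition is a list of natural numbers, with parts indexed from \<open>0\<close>. The \<open>k\<close>-th factor of
  the Young subgroup acts on the \<open>k\<close>-th block of consecutive elements of \<open>{1..n}\<close>.\<close>

definition block_offset :: "nat list \<Rightarrow> nat \<Rightarrow> nat" where
  "block_offset a k = sum_list (take k a)"

definition young_block :: "nat list \<Rightarrow> nat \<Rightarrow> nat set" where
  "young_block a k = {block_offset a k + 1..block_offset a k + a ! k}"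

definition young_subgroup :: "nat list \<Rightarrow> (nat \<Rightarrow> nat) set" where
  "young_subgroup a = {\<sigma> \<in> carrier (sym_group (sum_list a)).
     \<forall>k<length a. \<sigma> ` young_block a k = young_block a k}"

definition wreath_young ::
  "('f, 'b) monoid_scheme \<Rightarrow> nat list \<Rightarrow> ((nat \<Rightarrow> 'f) \<times> (nat \<Rightarrow> nat)) set" where
  "wreath_young F a = carrier (product_group {1..sum_list a} (\<lambda>_. F)) \<times> young_subgroup a"

text \<open>The identifications \<open>S(a) = S\<^bsub>a\<^sub>1\<^esub> \<times> \<dots> \<times> S\<^bsub>a\<^sub>s\<^esub>\<close> and
  \<open>F \<wr> S(a) = F \<wr> S\<^bsub>a\<^sub>1\<^esub> \<times> \<dots> \<times> F \<wr> S\<^bsub>a\<^sub>s\<^esub>\<close> are expressed by the projections to the \<open>k\<close>-th factors.\<close>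

definition young_proj :: "nat list \<Rightarrow> nat \<Rightarrow> (nat \<Rightarrow> nat) \<Rightarrow> (nat \<Rightarrow> nat)" where
  "young_proj a k \<sigma> =
     (\<lambda>i. if i \<in> {1..a ! k} then \<sigma> (block_offset a k + i) - block_offset a k else i)"

definition wreath_young_proj ::
  "nat list \<Rightarrow> nat \<Rightarrow> (nat \<Rightarrow> 'f) \<times> (nat \<Rightarrow> nat) \<Rightarrow> (nat \<Rightarrow> 'f) \<times> (nat \<Rightarrow> nat)" where
  "wreath_young_proj a k =
     (\<lambda>(f, \<sigma>). (\<lambda>i\<in>{1..a ! k}. f (block_offset a k + i), young_proj a k \<sigma>))"

text \<open>The outer tensor products of representations \<open>\<rho> k\<close> of \<open>S\<^bsub>a\<^sub>k\<^esub>\<close>, respectively \<open>F \<wr> S\<^bsub>a\<^sub>k\<^esub>\<close>, as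
  representations of \<open>S(a)\<close>, respectively \<open>F \<wr> S(a)\<close>.\<close>

definition young_box :: "nat list \<Rightarrow> (nat \<Rightarrow> (nat \<Rightarrow> nat) rep) \<Rightarrow> (nat \<Rightarrow> nat) rep" where
  "young_box a \<rho> = (\<lambda>\<sigma>. kronecker_list (map (\<lambda>k. \<rho> k (young_proj a k \<sigma>)) [0..<length a]))"

definition wreath_young_box ::
  "nat list \<Rightarrow> (nat \<Rightarrow> ((nat \<Rightarrow> 'f) \<times> (nat \<Rightarrow> nat)) rep) \<Rightarrow>
   ((nat \<Rightarrow> 'f) \<times> (nat \<Rightarrow> nat)) rep" where
  "wreath_young_box a \<rho> =
     (\<lambda>g. kronecker_list (map (\<lambda>k. \<rho> k (wreath_young_proj a k g)) [0..<length a]))"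

end

theory Submission
  imports Defs "Jordan_Normal_Form.DL_Rank" "Jordan_Normal_Form.Spectral_Radius"
begin

text \<open>By Maschke's theorem and the orthogonality of characters, a multiplicity is the normalised
  pairing of two characters. By Frobenius reciprocity, the pairing of \<open>U\<close> with \<open>ind W\<close> over
  \<open>F \<wr> S\<^sub>n\<close> equals the pairing of the restriction of \<open>U\<close> with \<open>W\<close> over \<open>S\<^sub>n\<close>. Every \<open>D\<^sub>k\<close> is a linear
  character because \<open>F\<close> is abelian, so the character of \<open>U\<close> at \<open>(1, \<sigma>)\<close> is a sum, over the
  coset representatives
  \<open>t = (f, \<tau>)\<close> of \<open>F \<wr> S(a)\<close>, of values of the inducing character at \<open>t\<^sup>-\<^sup>1 (1, \<sigma>) t\<close>. The base
  component of this element is a coboundary, on which the \<open>D\<^sub>k\<close> contribute the factor 1. What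
  remains is the character of the representation of \<open>S\<^sub>n\<close> induced from \<open>S(a)\<close>.\<close>

section \<open>Traces, representations and Schur's lemma\<close>

text \<open>This is the simplest case of Mackey's restriction formula. Since F^n lies in F wr S(a),
  the subgroups F wr S(a) and S_n together give a single double coset, so the restriction of U to
  S_n is induced from their intersection S(a). There the base component is trivial and permuting
  tensor factors of a line does nothing, so each (D_k; D_k'') restricts to D_k''. Working with
  characters avoids an explicit isomorphism between matrices that depend on arbitrarily chosen coset
  representatives. The representatives chosen on the two sides are still unrelated, and they are
  compared through sums over a whole group, which do not depend on any choice. A further obstacle is
  that a multiplicity is given by a definite description: existence and uniqueness of the count have
  to be proved before it denotes anything. The pairing uses inverses in place of complex conjugates,
  so that no unitary structure enters.\<close>

definition mat_trace :: "complex mat \<Rightarrow> complex" where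
  "mat_trace A = (\<Sum>i<dim_row A. A $$ (i, i))"

lemma mult_mat_entry:
  assumes "A \<in> carrier_mat n m" "B \<in> carrier_mat m k" "i < n" "j < k"
  shows "(A * B) $$ (i, j) = (\<Sum>l<m. A $$ (i, l) * B $$ (l, j))"
  using assms by (auto simp: scalar_prod_def lessThan_atLeast0 intro!: sum.cong)

lemma mat_trace_comm:
  assumes "A \<in> carrier_mat n m" "B \<in> carrier_mat m n"
  shows "mat_trace (A * B) = mat_trace (B * A)"
proof -
  have "mat_trace (A * B) = (\<Sum>i<n. \<Sum>l<m. A $$ (i, l) * B $$ (l, i))"
    unfolding mat_trace_def using assms
    by (auto simp del: index_mult_mat(1) intro!: sum.cong mult_mat_entry[of _ n m _ n])
  also have "\<dots> = (\<Sum>l<m. \<Sum>i<n. B $$ (l, i) * A $$ (i, l))"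
    by (subst sum.swap) (simp add: mult.commute)
  also have "\<dots> = mat_trace (B * A)"
    unfolding mat_trace_def using assms
    by (auto simp del: index_mult_mat(1) intro!: sum.cong mult_mat_entry[of _ m n _ m, symmetric])
  finally show ?thesis .
qed

lemma mat_trace_one [simp]: "mat_trace (1\<^sub>m n) = of_nat n"
  by (simp add: mat_trace_def)

lemma mat_trace_four_block:
  assumes "A \<in> carrier_mat n n" "D \<in> carrier_mat m m"
  shows "mat_trace (four_block_mat A B C D) = mat_trace A + mat_trace D"
proof -
  have "mat_trace (four_block_mat A B C D)
      = (\<Sum>i<n+m. if i < n then A $$ (i,i) else D $$ (i - n, i - n))"
    unfolding mat_trace_def using assms by (auto intro!: sum.cong)
  also have "\<dots> = (\<Sum>i<n. A $$ (i,i)) + (\<Sum>i\<in>{n..<n+m}. D $$ (i - n, i - n))"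
    unfolding lessThan_atLeast0
    by (subst sum.atLeastLessThan_concat[of 0 n "n+m", symmetric]) auto
  also have "(\<Sum>i\<in>{n..<n+m}. D $$ (i - n, i - n)) = (\<Sum>i<m. D $$ (i, i))"
    by (rule sum.reindex_bij_witness[of _ "\<lambda>i. i + n" "\<lambda>i. i - n"]) auto
  finally show ?thesis using assms by (simp add: mat_trace_def)
qed

lemma mat_trace_diag_block_mat:
  assumes "\<forall>A\<in>set As. square_mat A"
  shows "mat_trace (diag_block_mat As) = (\<Sum>A\<leftarrow>As. mat_trace A)"
  using assms
proof (induction As)
  case Nil then show ?case by (simp add: mat_trace_def)
next
  case (Cons A As)
  then have "A \<in> carrier_mat (dim_row A) (dim_row A)"
    "diag_block_mat As \<in> carrier_mat (dim_row (diag_block_mat As)) (dim_row (diag_block_mat As))"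
    using diag_block_mat_square[of As] by auto
  from mat_trace_four_block[OF this] Cons show ?case by (simp add: Let_def)
qed

text \<open>The dimensions are parameters because the type of matrices does not record them; in this
  way even an empty sum has a definite size.\<close>

definition mat_sum :: "nat \<Rightarrow> nat \<Rightarrow> ('i \<Rightarrow> complex mat) \<Rightarrow> 'i set \<Rightarrow> complex mat" where
  "mat_sum r c f S = mat r c (\<lambda>(i, j). \<Sum>s\<in>S. f s $$ (i, j))"

lemma mat_sum_carrier [simp]: "mat_sum r c f S \<in> carrier_mat r c"
  by (simp add: mat_sum_def)

lemma mat_sum_cong: "(\<And>s. s \<in> S \<Longrightarrow> f s = g s) \<Longrightarrow> mat_sum r c f S = mat_sum r c g S"
  by (simp add: mat_sum_def)

lemma mat_sum_reindex_bij_betw: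
  "bij_betw h S T \<Longrightarrow> mat_sum r c (\<lambda>s. f (h s)) S = mat_sum r c f T"
  by (auto simp: mat_sum_def intro!: cong_mat sum.reindex_bij_betw)

lemma mult_mat_sum:
  assumes "A \<in> carrier_mat n r" "\<And>s. s \<in> S \<Longrightarrow> f s \<in> carrier_mat r c"
  shows "A * mat_sum r c f S = mat_sum n c (\<lambda>s. A * f s) S"
proof (rule eq_matI)
  fix i j assume "i < dim_row (mat_sum n c (\<lambda>s. A * f s) S)" "j < dim_col (mat_sum n c (\<lambda>s. A * f s) S)"
  then have ij: "i < n" "j < c" by (auto simp: mat_sum_def)
  have "(A * mat_sum r c f S) $$ (i, j) = (\<Sum>l<r. \<Sum>s\<in>S. A $$ (i, l) * f s $$ (l, j))"
    using ij by (subst mult_mat_entry[OF assms(1) mat_sum_carrier]) (auto simp: mat_sum_def sum_distrib_left)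
  also have "\<dots> = (\<Sum>s\<in>S. (A * f s) $$ (i, j))"
    using ij assms by (subst sum.swap) (auto intro!: sum.cong simp: mult_mat_entry[of _ n r _ c])
  finally show "(A * mat_sum r c f S) $$ (i, j) = mat_sum n c (\<lambda>s. A * f s) S $$ (i, j)"
    using ij by (simp add: mat_sum_def)
qed (use assms in \<open>auto simp: mat_sum_def\<close>)

lemma mat_sum_mult:
  assumes "A \<in> carrier_mat c n" "\<And>s. s \<in> S \<Longrightarrow> f s \<in> carrier_mat r c"
  shows "mat_sum r c f S * A = mat_sum r n (\<lambda>s. f s * A) S"
proof (rule eq_matI)
  fix i j assume "i < dim_row (mat_sum r n (\<lambda>s. f s * A) S)" "j < dim_col (mat_sum r n (\<lambda>s. f s * A) S)"
  then have ij: "i < r" "j < n" by (auto simp: mat_sum_def)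
  have "(mat_sum r c f S * A) $$ (i, j) = (\<Sum>l<c. \<Sum>s\<in>S. f s $$ (i, l) * A $$ (l, j))"
    using ij by (subst mult_mat_entry[OF mat_sum_carrier assms(1)]) (auto simp: mat_sum_def sum_distrib_right)
  also have "\<dots> = (\<Sum>s\<in>S. (f s * A) $$ (i, j))"
    using ij assms by (subst sum.swap) (auto intro!: sum.cong simp: mult_mat_entry[of _ r c _ n])
  finally show "(mat_sum r c f S * A) $$ (i, j) = mat_sum r n (\<lambda>s. f s * A) S $$ (i, j)"
    using ij by (simp add: mat_sum_def)
qed (use assms in \<open>auto simp: mat_sum_def\<close>)

lemma mat_sum_add:
  assumes "\<And>s. s \<in> S \<Longrightarrow> f s \<in> carrier_mat r c" "\<And>s. s \<in> S \<Longrightarrow> g s \<in> carrier_mat r c"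
  shows "mat_sum r c (\<lambda>s. f s + g s) S = mat_sum r c f S + mat_sum r c g S"
proof (rule eq_matI)
  fix i j assume "i < dim_row (mat_sum r c f S + mat_sum r c g S)" "j < dim_col (mat_sum r c f S + mat_sum r c g S)"
  then have ij: "i < r" "j < c" by (auto simp: mat_sum_def)
  have "(f s + g s) $$ (i, j) = f s $$ (i, j) + g s $$ (i, j)" if "s \<in> S" for s
    using assms(2)[OF that] ij by auto
  then show "mat_sum r c (\<lambda>s. f s + g s) S $$ (i, j) = (mat_sum r c f S + mat_sum r c g S) $$ (i, j)"
    using ij by (simp add: mat_sum_def sum.distrib)
qed (simp_all add: mat_sum_def)

lemma mat_trace_mat_sum:
  assumes "\<And>s. s \<in> S \<Longrightarrow> f s \<in> carrier_mat n n"
  shows "mat_trace (mat_sum n n f S) = (\<Sum>s\<in>S. mat_trace (f s))"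
proof -
  have "(\<Sum>s\<in>S. mat_trace (f s)) = (\<Sum>s\<in>S. \<Sum>i<n. f s $$ (i, i))"
    using assms by (auto simp: mat_trace_def intro!: sum.cong)
  then show ?thesis by (subst (asm) sum.swap) (simp add: mat_trace_def mat_sum_def)
qed

section \<open>Invertible matrices and representations\<close>

lemma GL_carrier_iff:
  "A \<in> carrier (GL d) \<longleftrightarrow>
   A \<in> carrier_mat d d \<and> (\<exists>B\<in>carrier_mat d d. A * B = 1\<^sub>m d \<and> B * A = 1\<^sub>m d)"
  by (auto simp: GL_def units_of_def ring_mat_def Units_def)

lemma GL_mult [simp]: "A \<otimes>\<^bsub>GL d\<^esub> B = A * B"
  by (simp add: GL_def units_of_def ring_mat_def)

lemma GL_one [simp]: "\<one>\<^bsub>GL d\<^esub> = 1\<^sub>m d"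
  by (simp add: GL_def units_of_def ring_mat_def)

lemma representationD:
  assumes "group G" "representation G \<rho>" "g \<in> carrier G"
  shows representation_carrier: "\<rho> g \<in> carrier_mat (rep_dim G \<rho>) (rep_dim G \<rho>)"
    and representation_mult: "h \<in> carrier G \<Longrightarrow> \<rho> (g \<otimes>\<^bsub>G\<^esub> h) = \<rho> g * \<rho> h"
    and representation_inv1: "\<rho> (inv\<^bsub>G\<^esub> g) * \<rho> g = 1\<^sub>m (rep_dim G \<rho>)"
    and representation_inv2: "\<rho> g * \<rho> (inv\<^bsub>G\<^esub> g) = 1\<^sub>m (rep_dim G \<rho>)"
proof -
  let ?d = "rep_dim G \<rho>"
  have hom: "\<rho> \<in> hom G (GL ?d)" using assms(2) by (simp add: representation_def)
  show car: "\<rho> g \<in> carrier_mat ?d ?d"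
    using hom_in_carrier[OF hom assms(3)] by (simp add: GL_carrier_iff)
  show mlt: "\<rho> (g \<otimes>\<^bsub>G\<^esub> h) = \<rho> g * \<rho> h" if "h \<in> carrier G" for h
    using hom_mult[OF hom assms(3) that] by simp
  interpret group G by fact
  have 1: "\<rho> \<one>\<^bsub>G\<^esub> \<in> carrier (GL ?d)" using hom_in_carrier[OF hom] by simp
  then obtain B where B: "B \<in> carrier_mat ?d ?d" "B * \<rho> \<one>\<^bsub>G\<^esub> = 1\<^sub>m ?d" "\<rho> \<one>\<^bsub>G\<^esub> \<in> carrier_mat ?d ?d"
    by (auto simp: GL_carrier_iff)
  \<comment> \<open>A homomorphism into \<open>GL\<close> has an idempotent invertible value at the
    identity, and such a matrix is the identity matrix.\<close>
  have "\<rho> \<one>\<^bsub>G\<^esub> * \<rho> \<one>\<^bsub>G\<^esub> = \<rho> \<one>\<^bsub>G\<^esub>" using hom_mult[OF hom, of "\<one>\<^bsub>G\<^esub>" "\<one>\<^bsub>G\<^esub>"] by simp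
  then have "B * \<rho> \<one>\<^bsub>G\<^esub> * \<rho> \<one>\<^bsub>G\<^esub> = B * \<rho> \<one>\<^bsub>G\<^esub>"
    using assoc_mult_mat[OF B(1) B(3) B(3)] by simp
  then have one: "\<rho> \<one>\<^bsub>G\<^esub> = 1\<^sub>m ?d" unfolding B(2) left_mult_one_mat[OF B(3)] .
  show "\<rho> (inv\<^bsub>G\<^esub> g) * \<rho> g = 1\<^sub>m ?d"
    using hom_mult[OF hom, of "inv\<^bsub>G\<^esub> g" g] assms(3) one by simp
  show "\<rho> g * \<rho> (inv\<^bsub>G\<^esub> g) = 1\<^sub>m ?d"
    using hom_mult[OF hom, of g "inv\<^bsub>G\<^esub> g"] assms(3) one by simp
qed

lemma representation_one:
  assumes "group G" "representation G \<rho>"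
  shows "\<rho> \<one>\<^bsub>G\<^esub> = 1\<^sub>m (rep_dim G \<rho>)"
proof -
  interpret group G by fact
  have "\<rho> \<one>\<^bsub>G\<^esub> * \<rho> \<one>\<^bsub>G\<^esub> = 1\<^sub>m (rep_dim G \<rho>)"
    using representation_inv1[OF assms, of "\<one>\<^bsub>G\<^esub>"] by simp
  then show ?thesis using representation_mult[OF assms, of "\<one>\<^bsub>G\<^esub>" "\<one>\<^bsub>G\<^esub>"] by simp
qed

text \<open>The values are automatically invertible: \<open>\<rho>\<close> at the inverse of
  \<open>g\<close> is a two-sided inverse, by multiplicativity and the value at the
  identity.\<close>

lemma representationI:
  assumes "group G" and car: "\<And>g. g \<in> carrier G \<Longrightarrow> \<rho> g \<in> carrier_mat d d"
    and one: "\<rho> \<one>\<^bsub>G\<^esub> = 1\<^sub>m d"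
    and mult: "\<And>g h. g \<in> carrier G \<Longrightarrow> h \<in> carrier G \<Longrightarrow> \<rho> (g \<otimes>\<^bsub>G\<^esub> h) = \<rho> g * \<rho> h"
  shows "representation G \<rho>" and "rep_dim G \<rho> = d"
proof -
  interpret group G by fact
  show d: "rep_dim G \<rho> = d" using one by (simp add: rep_dim_def)
  have "\<rho> g \<in> carrier (GL d)" if g: "g \<in> carrier G" for g
    unfolding GL_carrier_iff
    using car[of g] car[of "inv\<^bsub>G\<^esub> g"] mult[of g "inv\<^bsub>G\<^esub> g"] mult[of "inv\<^bsub>G\<^esub> g" g] g one by auto
  then show "representation G \<rho>" unfolding representation_def d hom_def using mult by auto
qed

section \<open>Invariant subspaces and Schur's lemma\<close>

lemma subspace_vec_iff:
  "VectorSpace.subspace class_ring W (module_vec TYPE(complex) n) \<longleftrightarrow>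
   W \<subseteq> carrier_vec n \<and> 0\<^sub>v n \<in> W \<and> (\<forall>v\<in>W. \<forall>w\<in>W. v + w \<in> W) \<and> (\<forall>c. \<forall>v\<in>W. c \<cdot>\<^sub>v v \<in> W)"
  unfolding VectorSpace.subspace_def submodule_def
  using vec_vs[of n] vec_module[of n]
  by (auto simp: module_vec_simps class_ring_simps)

lemma irreducible_rep_vec:
  assumes "irreducible_rep G \<rho>" "d = rep_dim G \<rho>" "W \<subseteq> carrier_vec d" "0\<^sub>v d \<in> W"
    and "\<And>v w. v \<in> W \<Longrightarrow> w \<in> W \<Longrightarrow> v + w \<in> W" "\<And>c v. v \<in> W \<Longrightarrow> c \<cdot>\<^sub>v v \<in> W"
    and "\<And>g w. g \<in> carrier G \<Longrightarrow> w \<in> W \<Longrightarrow> \<rho> g *\<^sub>v w \<in> W"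
  shows "W = {0\<^sub>v d} \<or> W = carrier_vec d"
proof -
  have "invariant_subspace G \<rho> W"
    unfolding invariant_subspace_def subspace_vec_iff assms(2)[symmetric] using assms(3-7) by simp
  then show ?thesis using assms(1,2) by (simp add: irreducible_rep_def)
qed

lemma mat_eq_zeroI:
  fixes T :: "complex mat"
  assumes "T \<in> carrier_mat e d" "\<And>v. v \<in> carrier_vec d \<Longrightarrow> T *\<^sub>v v = 0\<^sub>v e"
  shows "T = 0\<^sub>m e d"
proof (rule mat_col_eqI)
  fix j assume "j < dim_col (0\<^sub>m e d :: complex mat)"
  then have j: "j < d" by simp
  have "col T j = T *\<^sub>v unit_vec d j" using assms(1) j by (intro eq_vecI) auto
  then show "col T j = col (0\<^sub>m e d) j" using assms(2)[of "unit_vec d j"] j by simp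
qed (use assms in auto)

text \<open>Kernel and image of an intertwiner are invariant. If \<open>T\<close> is nonzero,
  irreducibility of \<open>\<rho>\<close> makes it injective and irreducibility of
  \<open>\<sigma>\<close> makes it surjective.\<close>

lemma schur_lemma:
  assumes G: "group G" and \<rho>: "irreducible_rep G \<rho>" and \<sigma>: "irreducible_rep G \<sigma>"
    and d: "rep_dim G \<rho> = d" and e: "rep_dim G \<sigma> = e"
    and T: "T \<in> carrier_mat e d" and comm: "\<And>g. g \<in> carrier G \<Longrightarrow> T * \<rho> g = \<sigma> g * T"
  shows "T = 0\<^sub>m e d \<or> equivalent_reps G \<rho> \<sigma>"
proof (cases "T = 0\<^sub>m e d")
  case False
  have rep: "representation G \<rho>" "representation G \<sigma>" using \<rho> \<sigma> by (auto simp: irreducible_rep_def)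
  note cr = representation_carrier[OF G rep(1), unfolded d]
  note cs = representation_carrier[OF G rep(2), unfolded e]
  have comm': "T *\<^sub>v (\<rho> g *\<^sub>v v) = \<sigma> g *\<^sub>v (T *\<^sub>v v)" if "g \<in> carrier G" "v \<in> carrier_vec d" for g v
    using assoc_mult_mat_vec[OF T cr[OF that(1)] that(2)] assoc_mult_mat_vec[OF cs[OF that(1)] T that(2)]
      comm[OF that(1)] by simp
  let ?K = "{v \<in> carrier_vec d. T *\<^sub>v v = 0\<^sub>v e}"
  have "?K = {0\<^sub>v d} \<or> ?K = carrier_vec d"
  proof (rule irreducible_rep_vec[OF \<rho> d[symmetric]])
    fix g w assume g: "g \<in> carrier G" and w: "w \<in> ?K"
    then show "\<rho> g *\<^sub>v w \<in> ?K"
      using comm'[OF g, of w] cs[OF g] cr[OF g] by auto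
  qed (use T in \<open>auto simp: mult_add_distrib_mat_vec mult_mat_vec\<close>)
  moreover have "?K \<noteq> carrier_vec d" using mat_eq_zeroI[OF T] False by blast
  ultimately have ker: "?K = {0\<^sub>v d}" by blast
  let ?I = "(\<lambda>v. T *\<^sub>v v) ` carrier_vec d"
  have "?I = {0\<^sub>v e} \<or> ?I = carrier_vec e"
  proof (rule irreducible_rep_vec[OF \<sigma> e[symmetric]])
    show "0\<^sub>v e \<in> ?I" using T by (intro image_eqI[of _ _ "0\<^sub>v d"]) auto
    fix v w assume "v \<in> ?I" "w \<in> ?I"
    then obtain v' w' where "v = T *\<^sub>v v'" "w = T *\<^sub>v w'" "v' \<in> carrier_vec d" "w' \<in> carrier_vec d" by auto
    then show "v + w \<in> ?I" using T
      by (intro image_eqI[of _ _ "v' + w'"]) (auto simp: mult_add_distrib_mat_vec)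
  next
    fix c v assume "v \<in> ?I"
    then obtain v' where "v = T *\<^sub>v v'" "v' \<in> carrier_vec d" by auto
    then show "c \<cdot>\<^sub>v v \<in> ?I" using T
      by (intro image_eqI[of _ _ "c \<cdot>\<^sub>v v'"]) (auto simp: mult_mat_vec)
  next
    fix g v assume g: "g \<in> carrier G" and "v \<in> ?I"
    then obtain v' where "v = T *\<^sub>v v'" "v' \<in> carrier_vec d" by auto
    then show "\<sigma> g *\<^sub>v v \<in> ?I" using cr[OF g]
      by (intro image_eqI[of _ _ "\<rho> g *\<^sub>v v'"]) (auto simp: comm'[OF g])
  qed (use T in auto)
  moreover have "?I \<noteq> {0\<^sub>v e}" using mat_eq_zeroI[OF T] False by blast
  ultimately have img: "?I = carrier_vec e" by blast
  have "\<forall>i\<in>{..<e}. \<exists>w. w \<in> carrier_vec d \<and> T *\<^sub>v w = unit_vec e i"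
  proof
    fix i
    have "unit_vec e i \<in> ?I" unfolding img by simp
    then show "\<exists>w. w \<in> carrier_vec d \<and> T *\<^sub>v w = unit_vec e i" by (metis imageE)
  qed
  from bchoice[OF this] obtain w
    where w: "\<And>i. i < e \<Longrightarrow> w i \<in> carrier_vec d \<and> T *\<^sub>v w i = unit_vec e i" by blast
  \<comment> \<open>A right inverse of \<open>T\<close> has preimages of the unit vectors as its
    columns.\<close>
  define B where "B = mat_of_cols d (map w [0..<e])"
  have B: "B \<in> carrier_mat d e" using mat_of_cols_carrier(1)[of d "map w [0..<e]"] by (simp add: B_def)
  have TB: "T * B = 1\<^sub>m e"
  proof (rule mat_col_eqI)
    fix j assume j: "j < dim_col (1\<^sub>m e :: complex mat)"
    have "col (T * B) j = T *\<^sub>v col B j" using T B j by (intro col_mult2) auto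
    also have "col B j = w j" unfolding B_def using j w by (subst col_mat_of_cols) auto
    finally show "col (T * B) j = col (1\<^sub>m e) j" using j w by simp
  qed (use T B in auto)
  \<comment> \<open>\<open>T\<close> sends \<open>(B * T) *\<^sub>v v - v\<close> to zero and has
    trivial kernel, so \<open>B\<close> is a left inverse too.\<close>
  have BT: "B * T = 1\<^sub>m d"
  proof -
    have "B * T - 1\<^sub>m d = 0\<^sub>m d d"
    proof (rule mat_eq_zeroI)
      fix v :: "complex vec" assume v: "v \<in> carrier_vec d"
      have "T *\<^sub>v ((B * T) *\<^sub>v v) = (T * B) *\<^sub>v (T *\<^sub>v v)" using T B v by (simp add: assoc_mult_mat_vec[of _ d e _ d] assoc_mult_mat_vec[of _ e d _ e])
      also have "\<dots> = T *\<^sub>v v" unfolding TB using T v by simp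
      finally have "T *\<^sub>v ((B * T) *\<^sub>v v - v) = 0\<^sub>v e" using T B v by (subst mult_minus_distrib_mat_vec) auto
      then have "(B * T) *\<^sub>v v - v \<in> ?K" using T B v by auto
      then have "(B * T) *\<^sub>v v - v = 0\<^sub>v d" using ker by blast
      then show "(B * T - 1\<^sub>m d) *\<^sub>v v = 0\<^sub>v d"
        using T B v by (subst minus_mult_distrib_mat_vec[of _ d d]) auto
    qed (use T B in auto)
    then have "(B * T - 1\<^sub>m d) + 1\<^sub>m d = 1\<^sub>m d" by simp
    moreover have "(B * T - 1\<^sub>m d) + 1\<^sub>m d = B * T" using T B by (intro eq_matI) auto
    ultimately show ?thesis by simp
  qed
  \<comment> \<open>The two sizes agree because \<open>T * B\<close> and \<open>B * T\<close> have
    the same trace.\<close>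
  have "(of_nat d :: complex) = of_nat e"
    using mat_trace_comm[OF T B] TB BT by simp
  then have "d = e" by simp
  then have "T \<in> carrier (GL d)" using T B TB BT by (auto simp: GL_carrier_iff)
  then show ?thesis using comm d e \<open>d = e\<close> unfolding equivalent_reps_def by auto
qed simp

text \<open>\<open>T\<close> has an eigenvalue \<open>c\<close> because the field is algebraically
  closed and \<open>d\<close> is positive. The eigenspace of \<open>c\<close> is invariant and
  nonzero, hence everything.\<close>

lemma schur_scalar:
  assumes G: "group G" and \<rho>: "irreducible_rep G \<rho>" and d: "rep_dim G \<rho> = d"
    and T: "T \<in> carrier_mat d d" and comm: "\<And>g. g \<in> carrier G \<Longrightarrow> T * \<rho> g = \<rho> g * T"
  shows "\<exists>c. T = c \<cdot>\<^sub>m 1\<^sub>m d"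
proof -
  have rep: "representation G \<rho>" and d0: "d > 0" using \<rho> d by (auto simp: irreducible_rep_def)
  note cr = representation_carrier[OF G rep, unfolded d]
  obtain c where "eigenvalue T c" using spectrum_non_empty[OF T d0] by (auto simp: spectrum_def)
  then obtain v where v: "v \<in> carrier_vec d" "v \<noteq> 0\<^sub>v d" "T *\<^sub>v v = c \<cdot>\<^sub>v v"
    using T by (auto simp: eigenvalue_def eigenvector_def)
  let ?K = "{v \<in> carrier_vec d. T *\<^sub>v v = c \<cdot>\<^sub>v v}"
  have "?K = {0\<^sub>v d} \<or> ?K = carrier_vec d"
  proof (rule irreducible_rep_vec[OF \<rho> d[symmetric]])
    fix g w assume g: "g \<in> carrier G" and w: "w \<in> ?K"
    have "T *\<^sub>v (\<rho> g *\<^sub>v w) = \<rho> g *\<^sub>v (T *\<^sub>v w)"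
      using assoc_mult_mat_vec[OF T cr[OF g], of w] assoc_mult_mat_vec[OF cr[OF g] T, of w]
        comm[OF g] w by simp
    then show "\<rho> g *\<^sub>v w \<in> ?K" using w cr[OF g] by (auto simp: mult_mat_vec)
  qed (use T in \<open>auto simp: mult_add_distrib_mat_vec mult_mat_vec smult_add_distrib_vec smult_smult_assoc mult.commute\<close>)
  then have K: "?K = carrier_vec d" using v by auto
  have "T - c \<cdot>\<^sub>m 1\<^sub>m d = 0\<^sub>m d d"
  proof (rule mat_eq_zeroI)
    fix v :: "complex vec" assume v: "v \<in> carrier_vec d"
    then have "T *\<^sub>v v = c \<cdot>\<^sub>v v" using K by blast
    moreover have "(c \<cdot>\<^sub>m 1\<^sub>m d) *\<^sub>v v = c \<cdot>\<^sub>v v" using v by (intro eq_vecI) auto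
    ultimately show "(T - c \<cdot>\<^sub>m 1\<^sub>m d) *\<^sub>v v = 0\<^sub>v d"
      using T v by (subst minus_mult_distrib_mat_vec[of _ d d]) auto
  qed (use T in auto)
  then have "(T - c \<cdot>\<^sub>m 1\<^sub>m d) + c \<cdot>\<^sub>m 1\<^sub>m d = c \<cdot>\<^sub>m 1\<^sub>m d" by simp
  moreover have "(T - c \<cdot>\<^sub>m 1\<^sub>m d) + c \<cdot>\<^sub>m 1\<^sub>m d = T" using T by (intro eq_matI) auto
  ultimately show ?thesis by auto
qed

section \<open>Orthogonality of characters\<close>

text \<open>The inverse takes the place of the complex conjugate in the usual inner product of
  characters. The normalising factor, one over the group order, is left out.\<close>

definition char_pairing :: "('g, 'b) monoid_scheme \<Rightarrow> 'g rep \<Rightarrow> 'g rep \<Rightarrow> complex" where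
  "char_pairing G \<rho> \<sigma> = (\<Sum>g\<in>carrier G. mat_trace (\<rho> (inv\<^bsub>G\<^esub> g)) * mat_trace (\<sigma> g))"

text \<open>Averaging turns any matrix \<open>X\<close> into an intertwiner: translating the
  summation variable by \<open>h\<close> cancels the factor \<open>\<sigma> h\<close> on the left
  and produces \<open>\<rho> h\<close> on the right.\<close>

lemma averaged_intertwiner:
  fixes G (structure)
  assumes G: "group G" and \<rho>: "representation G \<rho>" and \<sigma>: "representation G \<sigma>"
    and d: "rep_dim G \<rho> = d" and e: "rep_dim G \<sigma> = e"
    and X: "X \<in> carrier_mat e d" and h: "h \<in> carrier G"
  shows "mat_sum e d (\<lambda>g. \<sigma> (inv g) * X * \<rho> g) (carrier G) * \<rho> h
       = \<sigma> h * mat_sum e d (\<lambda>g. \<sigma> (inv g) * X * \<rho> g) (carrier G)"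
proof -
  interpret group G by fact
  note cr = representation_carrier[OF G \<rho>, unfolded d]
  note cs = representation_carrier[OF G \<sigma>, unfolded e]
  let ?f = "\<lambda>g. \<sigma> (inv g) * X * \<rho> g"
  have f: "?f g \<in> carrier_mat e d" if "g \<in> carrier G" for g
    using mult_carrier_mat[OF mult_carrier_mat[OF cs[of "inv g"] X] cr[OF that]] that by simp
  have "\<sigma> h * mat_sum e d ?f (carrier G) = mat_sum e d (\<lambda>g. \<sigma> h * ?f g) (carrier G)"
    by (rule mult_mat_sum[OF cs[OF h] f])
  also have "\<dots> = mat_sum e d (\<lambda>g. \<sigma> h * ?f (g \<otimes> h)) (carrier G)"
  proof (rule mat_sum_reindex_bij_betw[symmetric])
    show "bij_betw (\<lambda>g. g \<otimes> h) (carrier G) (carrier G)"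
      by (rule bij_betwI[where g = "\<lambda>g. g \<otimes> inv h"]) (use h in \<open>auto simp: m_assoc\<close>)
  qed
  also have "\<dots> = mat_sum e d (\<lambda>g. ?f g * \<rho> h) (carrier G)"
  proof (rule mat_sum_cong)
    fix g assume g: "g \<in> carrier G"
    have c: "\<sigma> (inv g) \<in> carrier_mat e e" "\<rho> g \<in> carrier_mat d d" "\<rho> h \<in> carrier_mat d d"
      "\<sigma> h \<in> carrier_mat e e" "\<sigma> (inv h) \<in> carrier_mat e e"
      using g h cs cr by auto
    have "\<sigma> (inv (g \<otimes> h)) = \<sigma> (inv h) * \<sigma> (inv g)"
      using g h by (simp add: inv_mult_group representation_mult[OF G \<sigma>])
    moreover have "\<rho> (g \<otimes> h) = \<rho> g * \<rho> h" using g h by (simp add: representation_mult[OF G \<rho>])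
    ultimately have "\<sigma> h * ?f (g \<otimes> h) = \<sigma> h * (\<sigma> (inv h) * \<sigma> (inv g) * X * (\<rho> g * \<rho> h))" by simp
    also have "\<dots> = \<sigma> h * \<sigma> (inv h) * (\<sigma> (inv g) * X * \<rho> g * \<rho> h)"
      using c X by (simp add: assoc_mult_mat[of _ e e _ e _ e] assoc_mult_mat[of _ e e _ e _ d]
          assoc_mult_mat[of _ e e _ d _ d] assoc_mult_mat[of _ e d _ d _ d] mult_carrier_mat[of _ _ d] mult_carrier_mat[of _ _ e])
    also have "\<dots> = ?f g * \<rho> h"
      using representation_inv2[OF G \<sigma> h, unfolded e] f[OF g] c by simp
    finally show "\<sigma> h * ?f (g \<otimes> h) = ?f g * \<rho> h" .
  qed
  also have "\<dots> = mat_sum e d ?f (carrier G) * \<rho> h"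
    by (rule mat_sum_mult[OF cr[OF h] f, symmetric])
  finally show ?thesis by simp
qed

definition unit_mat :: "nat \<Rightarrow> nat \<Rightarrow> nat \<Rightarrow> nat \<Rightarrow> complex mat" where
  "unit_mat r c i k = mat r c (\<lambda>(a, b). if a = i \<and> b = k then 1 else 0)"

text \<open>A matrix unit in the middle isolates a product of two single entries; this is how
  products of character values become entries of averaged intertwiners.\<close>

lemma mult_unit_mat_mult:
  assumes A: "A \<in> carrier_mat n r" and B: "B \<in> carrier_mat c m"
    and "a < n" "b < m" "i < r" "k < c"
  shows "(A * unit_mat r c i k * B) $$ (a, b) = A $$ (a, i) * B $$ (k, b)"
proof -
  have E: "unit_mat r c i k \<in> carrier_mat r c" by (simp add: unit_mat_def)
  have "(A * unit_mat r c i k) $$ (a, l) = (if l = k then A $$ (a, i) else 0)" if "l < c" for l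
  proof -
    have "(A * unit_mat r c i k) $$ (a, l) = (\<Sum>j<r. A $$ (a, j) * (if j = i \<and> l = k then 1 else 0))"
      using that assms by (subst mult_mat_entry[OF A E]) (auto simp: unit_mat_def intro!: sum.cong)
    also have "\<dots> = (\<Sum>j<r. if j = i then (if l = k then A $$ (a, i) else 0) else 0)"
      by (intro sum.cong) auto
    finally show ?thesis using assms by simp
  qed
  then have "(A * unit_mat r c i k * B) $$ (a, b) = (\<Sum>l<c. (if l = k then A $$ (a, i) else 0) * B $$ (l, b))"
    using assms by (subst mult_mat_entry[OF mult_carrier_mat[OF A E] B]) (auto simp del: index_mult_mat(1))
  also have "\<dots> = (\<Sum>l<c. if l = k then A $$ (a, i) * B $$ (k, b) else 0)"
    by (intro sum.cong) auto
  finally show ?thesis using assms by simp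
qed

lemma mat_trace_equivalent_reps:
  assumes "equivalent_reps G \<rho> \<sigma>" "g \<in> carrier G"
    and "\<rho> g \<in> carrier_mat (rep_dim G \<rho>) (rep_dim G \<rho>)" "\<sigma> g \<in> carrier_mat (rep_dim G \<rho>) (rep_dim G \<rho>)"
  shows "mat_trace (\<rho> g) = mat_trace (\<sigma> g)"
proof -
  let ?d = "rep_dim G \<rho>"
  obtain P Q where P: "P \<in> carrier_mat ?d ?d" "Q \<in> carrier_mat ?d ?d" "P * Q = 1\<^sub>m ?d" "Q * P = 1\<^sub>m ?d"
    and c: "P * \<rho> g = \<sigma> g * P"
    using assms(1,2) by (auto simp: equivalent_reps_def GL_carrier_iff)
  have "mat_trace (\<rho> g) = mat_trace (Q * P * \<rho> g)" using P assms(3) by simp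
  also have "\<dots> = mat_trace (Q * (\<sigma> g * P))" using assoc_mult_mat[OF P(2,1) assms(3)] c by simp
  also have "\<dots> = mat_trace (\<sigma> g * P * Q)" using P assms by (intro mat_trace_comm) auto
  also have "\<dots> = mat_trace (\<sigma> g)" using P assms by (simp add: assoc_mult_mat[of _ ?d ?d _ ?d _ ?d])
  finally show ?thesis .
qed

lemma char_pairing_cong:
  assumes "\<And>g. g \<in> carrier G \<Longrightarrow> mat_trace (\<sigma> g) = mat_trace (\<tau> g)"
  shows "char_pairing G \<rho> \<sigma> = char_pairing G \<rho> \<tau>"
  using assms by (simp add: char_pairing_def)

text \<open>Expanding both traces gives products
  \<open>\<rho> (inv g) $$ (i, i) * \<sigma> g $$ (k, k)\<close>, and each of them is the entry at
  \<open>(i, k)\<close> of \<open>\<rho> (inv g) * unit_mat d e i k * \<sigma> g\<close>.\<close>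

lemma char_pairing_eq_sum_averages:
  fixes G (structure)
  assumes G: "group G" and \<rho>: "representation G \<rho>" and \<sigma>: "representation G \<sigma>"
    and d: "rep_dim G \<rho> = d" and e: "rep_dim G \<sigma> = e"
  shows "char_pairing G \<rho> \<sigma> = (\<Sum>i<d. \<Sum>k<e.
    mat_sum d e (\<lambda>g. \<rho> (inv g) * unit_mat d e i k * \<sigma> g) (carrier G) $$ (i, k))"
proof -
  interpret group G by fact
  note cr = representation_carrier[OF G \<rho>, unfolded d]
  note cs = representation_carrier[OF G \<sigma>, unfolded e]
  have "char_pairing G \<rho> \<sigma> = (\<Sum>g\<in>carrier G. \<Sum>i<d. \<Sum>k<e. \<rho> (inv g) $$ (i, i) * \<sigma> g $$ (k, k))"
    unfolding char_pairing_def mat_trace_def sum_product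
    using cr cs by (intro sum.cong) auto
  also have "\<dots> = (\<Sum>i<d. \<Sum>k<e. \<Sum>g\<in>carrier G. \<rho> (inv g) $$ (i, i) * \<sigma> g $$ (k, k))"
    by (subst sum.swap, rule sum.cong[OF refl], rule sum.swap)
  also have "\<dots> = (\<Sum>i<d. \<Sum>k<e. mat_sum d e (\<lambda>g. \<rho> (inv g) * unit_mat d e i k * \<sigma> g) (carrier G) $$ (i, k))"
    using cr cs by (auto simp: mat_sum_def mult_unit_mat_mult[of _ d d _ e e] simp del: index_mult_mat(1) intro!: sum.cong)
  finally show ?thesis .
qed

text \<open>By Schur's lemma, every averaged matrix unit vanishes if the representations are
  inequivalent. Otherwise \<open>\<sigma>\<close> may be replaced by \<open>\<rho>\<close>; the
  average is then a scalar matrix, and its trace determines the scalar.\<close>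

theorem char_orthogonality:
  fixes G (structure)
  assumes G: "group G" and fin: "finite (carrier G)"
    and \<rho>: "irreducible_rep G \<rho>" and \<sigma>: "irreducible_rep G \<sigma>"
  shows "char_pairing G \<rho> \<sigma> = (if equivalent_reps G \<rho> \<sigma> then of_nat (card (carrier G)) else 0)"
proof -
  interpret group G by fact
  define d where "d = rep_dim G \<rho>"
  define e where "e = rep_dim G \<sigma>"
  have rep: "representation G \<rho>" "representation G \<sigma>" and d0: "d > 0"
    using \<rho> \<sigma> by (auto simp: irreducible_rep_def d_def)
  note cr = representation_carrier[OF G rep(1), folded d_def]
  note cs = representation_carrier[OF G rep(2), folded e_def]
  show ?thesis
  proof (cases "equivalent_reps G \<rho> \<sigma>")
    case True
    then have de: "e = d" by (simp add: equivalent_reps_def d_def e_def)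
    have "char_pairing G \<rho> \<sigma> = char_pairing G \<rho> \<rho>"
      using mat_trace_equivalent_reps[OF True] cr cs de
      by (intro char_pairing_cong) (auto simp: d_def)
    also have "\<dots> = (\<Sum>i<d. \<Sum>k<d. if i = k then of_nat (card (carrier G)) / of_nat d else 0)"
      unfolding char_pairing_eq_sum_averages[OF G rep(1) rep(1) d_def[symmetric] d_def[symmetric]]
    proof (intro sum.cong refl)
      fix i k assume "i \<in> {..<d}" "k \<in> {..<d}"
      then have ik: "i < d" "k < d" by auto
      let ?f = "\<lambda>g. \<rho> (inv g) * unit_mat d d i k * \<rho> g"
      let ?T = "mat_sum d d ?f (carrier G)"
      have X: "unit_mat d d i k \<in> carrier_mat d d" by (simp add: unit_mat_def)
      obtain c where c: "?T = c \<cdot>\<^sub>m 1\<^sub>m d"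
        using schur_scalar[OF G \<rho> d_def[symmetric] mat_sum_carrier
            averaged_intertwiner[OF G rep(1) rep(1) d_def[symmetric] d_def[symmetric] X]] by blast
      \<comment> \<open>Conjugation preserves traces, so the average has the group order times the
        trace of the matrix unit as its trace, which is zero off the diagonal. Dividing by
        \<open>d\<close> gives \<open>c\<close>.\<close>
      have "mat_trace ?T = (\<Sum>g\<in>carrier G. mat_trace (?f g))"
        using cr X by (intro mat_trace_mat_sum) (auto intro!: mult_carrier_mat[of _ d d])
      also have "\<dots> = (\<Sum>g\<in>carrier G. mat_trace (unit_mat d d i k))"
      proof (rule sum.cong[OF refl])
        fix g assume g: "g \<in> carrier G"
        have cg: "\<rho> g \<in> carrier_mat d d" "\<rho> (inv g) \<in> carrier_mat d d" using cr g by auto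
        have "mat_trace (?f g) = mat_trace (\<rho> (inv g) * (unit_mat d d i k * \<rho> g))"
          using cg X by (simp add: assoc_mult_mat[of _ d d _ d _ d])
        also have "\<dots> = mat_trace (unit_mat d d i k * \<rho> g * \<rho> (inv g))"
          using cg X by (intro mat_trace_comm) auto
        also have "\<dots> = mat_trace (unit_mat d d i k * (\<rho> g * \<rho> (inv g)))"
          using cg X by (simp add: assoc_mult_mat[of _ d d _ d _ d])
        finally show "mat_trace (?f g) = mat_trace (unit_mat d d i k)"
          using X representation_inv2[OF G rep(1) g] by (simp add: d_def)
      qed
      also have "mat_trace (unit_mat d d i k) = (\<Sum>j<d. if j = i then if i = k then 1 else 0 else 0)"
        unfolding mat_trace_def unit_mat_def by (auto intro!: sum.cong)
      finally have "mat_trace ?T = (if i = k then of_nat (card (carrier G)) else 0)"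
        using ik by simp
      moreover have "mat_trace ?T = c * of_nat d" unfolding c by (simp add: mat_trace_def)
      moreover have "?T $$ (i, k) = (if i = k then c else 0)" unfolding c using ik by simp
      ultimately show "?T $$ (i, k) = (if i = k then of_nat (card (carrier G)) / of_nat d else 0)"
        using d0 by (auto simp: field_simps)
    qed
    also have "\<dots> = of_nat (card (carrier G))" using d0 by simp
    finally show ?thesis using True by simp
  next
    case False
    \<comment> \<open>The averages below map from \<open>\<sigma>\<close> to \<open>\<rho>\<close>,
      so Schur's lemma yields an equivalence in this direction. Inverting its matrix gives one in
      the other direction.\<close>
    have neq: "\<not> equivalent_reps G \<sigma> \<rho>"
    proof
      assume eq: "equivalent_reps G \<sigma> \<rho>"
      then have de: "e = d" by (simp add: equivalent_reps_def d_def e_def)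
      obtain P Q where P: "P \<in> carrier_mat d d" "Q \<in> carrier_mat d d" "P * Q = 1\<^sub>m d" "Q * P = 1\<^sub>m d"
        and c: "\<And>g. g \<in> carrier G \<Longrightarrow> P * \<sigma> g = \<rho> g * P"
        using eq de by (auto simp: equivalent_reps_def GL_carrier_iff d_def e_def)
      have "Q * \<rho> g = \<sigma> g * Q" if g: "g \<in> carrier G" for g
      proof -
        have cg: "\<rho> g \<in> carrier_mat d d" "\<sigma> g \<in> carrier_mat d d" using cr[OF g] cs[OF g] de by auto
        have "Q * \<rho> g = Q * (\<rho> g * P * Q)" using P cg by (simp add: assoc_mult_mat[of _ d d _ d _ d])
        also have "\<dots> = Q * P * \<sigma> g * Q" unfolding c[OF g, symmetric]
          using P(1,2) cg by (simp add: assoc_mult_mat[of _ d d _ d _ d])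
        finally show ?thesis using P cg by simp
      qed
      moreover have "Q \<in> carrier (GL d)" using P by (auto simp: GL_carrier_iff)
      ultimately show False using False de by (auto simp: equivalent_reps_def d_def e_def)
    qed
    have "mat_sum d e (\<lambda>g. \<rho> (inv g) * unit_mat d e i k * \<sigma> g) (carrier G) = 0\<^sub>m d e" for i k
      using schur_lemma[OF G \<sigma> \<rho> e_def[symmetric] d_def[symmetric] mat_sum_carrier
          averaged_intertwiner[OF G rep(2) rep(1) e_def[symmetric] d_def[symmetric]], of "unit_mat d e i k"]
        neq by (auto simp: unit_mat_def)
    then show ?thesis using False
      unfolding char_pairing_eq_sum_averages[OF G rep(1) rep(2) d_def[symmetric] e_def[symmetric]] by simp
  qed
qed

section \<open>Direct sums and the count of irreducible summands\<close>

lemma representation_direct_sum: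
  assumes G: "group G" and "\<forall>\<tau>\<in>set \<tau>s. representation G \<tau>" and g: "g \<in> carrier G"
  shows "direct_sum_rep \<tau>s g \<in> carrier_mat (rep_dim G (direct_sum_rep \<tau>s)) (rep_dim G (direct_sum_rep \<tau>s))"
    and "mat_trace (direct_sum_rep \<tau>s g) = (\<Sum>\<tau>\<leftarrow>\<tau>s. mat_trace (\<tau> g))"
proof -
  interpret group G by fact
  have car: "\<tau> g \<in> carrier_mat (dim_row (\<tau> \<one>\<^bsub>G\<^esub>)) (dim_row (\<tau> \<one>\<^bsub>G\<^esub>))" if "\<tau> \<in> set \<tau>s" for \<tau>
    using representation_carrier[OF G _ g, of \<tau>] that assms(2) by (simp add: rep_dim_def)
  \<comment> \<open>The blocks at \<open>g\<close> have the same sizes as those at the identity,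
    from which \<open>rep_dim\<close> is read off.\<close>
  then have row: "map dim_row (map (\<lambda>\<rho>. \<rho> g) \<tau>s) = map dim_row (map (\<lambda>\<rho>. \<rho> \<one>\<^bsub>G\<^esub>) \<tau>s)"
    and col: "map dim_col (map (\<lambda>\<rho>. \<rho> g) \<tau>s) = map dim_row (map (\<lambda>\<rho>. \<rho> \<one>\<^bsub>G\<^esub>) \<tau>s)"
    unfolding map_map o_def by (intro map_cong refl; blast)+
  show "direct_sum_rep \<tau>s g \<in> carrier_mat (rep_dim G (direct_sum_rep \<tau>s)) (rep_dim G (direct_sum_rep \<tau>s))"
    unfolding direct_sum_rep_def rep_dim_def carrier_mat_def dim_diag_block_mat mem_Collect_eq row col by (intro conjI refl)
  show "mat_trace (direct_sum_rep \<tau>s g) = (\<Sum>\<tau>\<leftarrow>\<tau>s. mat_trace (\<tau> g))"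
  proof -
    have "square_mat (\<tau> g)" if "\<tau> \<in> set \<tau>s" for \<tau>
      using carrier_matD[OF car[OF that]] by simp
    then show ?thesis unfolding direct_sum_rep_def
      by (subst mat_trace_diag_block_mat) (auto simp: o_def simp del: square_mat.simps)
  qed
qed

text \<open>The left side does not mention the decomposition, so the number of summands equivalent
  to \<open>\<rho>\<close> is the same for all decompositions. This is the uniqueness behind
  \<open>rep_multiplicity\<close>.\<close>

lemma char_pairing_decomposition:
  assumes G: "group G" and fin: "finite (carrier G)"
    and \<rho>: "irreducible_rep G \<rho>" and \<sigma>: "representation G \<sigma>"
    and \<tau>s: "\<forall>\<tau>\<in>set \<tau>s. irreducible_rep G \<tau>" and eq: "equivalent_reps G \<sigma> (direct_sum_rep \<tau>s)"
  shows "char_pairing G \<rho> \<sigma> = of_nat (card (carrier G)) * of_nat (length (filter (equivalent_reps G \<rho>) \<tau>s))"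
proof -
  interpret group G by fact
  have rep: "\<forall>\<tau>\<in>set \<tau>s. representation G \<tau>" using \<tau>s by (auto simp: irreducible_rep_def)
  have dim: "rep_dim G (direct_sum_rep \<tau>s) = rep_dim G \<sigma>" using eq by (simp add: equivalent_reps_def)
  have "char_pairing G \<rho> \<sigma> = char_pairing G \<rho> (direct_sum_rep \<tau>s)"
    using mat_trace_equivalent_reps[OF eq] representation_carrier[OF G \<sigma>] representation_direct_sum(1)[OF G rep]
    by (intro char_pairing_cong) (auto simp: dim)
  also have "\<dots> = (\<Sum>\<tau>\<leftarrow>\<tau>s. char_pairing G \<rho> \<tau>)"
    unfolding char_pairing_def
    by (simp add: representation_direct_sum(2)[OF G rep] sum_list_const_mult[symmetric] cong: sum.cong)
       (induction \<tau>s, auto simp: sum.distrib ring_distribs)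
  also have "\<dots> = (\<Sum>\<tau>\<leftarrow>\<tau>s. if equivalent_reps G \<rho> \<tau> then of_nat (card (carrier G)) else 0)"
    using \<tau>s char_orthogonality[OF G fin \<rho>] by (intro arg_cong[of _ _ sum_list] map_cong) auto
  also have "\<dots> = of_nat (card (carrier G)) * of_nat (length (filter (equivalent_reps G \<rho>) \<tau>s))"
    by (induction \<tau>s) (auto simp: algebra_simps)
  finally show ?thesis .
qed

text \<open>The first \<open>k\<close> columns of \<open>P\<close> form a basis of \<open>W\<close>,
  and the remaining ones extend it to a basis of the whole space. Both bases are found as maximal
  linearly independent sets.\<close>

lemma subspace_adapted_basis:
  assumes W: "W \<subseteq> carrier_vec n" "0\<^sub>v n \<in> W"
    "\<And>v w. v \<in> W \<Longrightarrow> w \<in> W \<Longrightarrow> v + w \<in> W" "\<And>c v. v \<in> W \<Longrightarrow> (c::complex) \<cdot>\<^sub>v v \<in> W"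
  obtains k P where "k \<le> n" "P \<in> carrier (GL n)" "\<And>j. j < k \<Longrightarrow> col P j \<in> W"
    "\<And>w. w \<in> W \<Longrightarrow> \<exists>u\<in>carrier_vec n. w = P *\<^sub>v u \<and> (\<forall>i<n. i \<ge> k \<longrightarrow> u $ i = 0)"
    "k = n \<Longrightarrow> W = carrier_vec n"
proof -
  interpret vec_space "TYPE(complex)" n .
  have V: "carrier V = carrier_vec n" by (simp add: module_vec_simps)
  obtain S where S: "finite S" "maximal S (\<lambda>A. A \<subseteq> W \<and> lin_indpt A)"
  proof -
    have "\<exists>A. finite A \<and> maximal A (\<lambda>A. A \<subseteq> W \<and> lin_indpt A)"
    proof (rule maximal_exists[where B = "{}"])
      fix A assume "A \<subseteq> W \<and> lin_indpt A"
      then show "finite A \<and> card A \<le> n"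
        using li_le_dim[of A] W(1) V by (auto simp: dim_is_n)
    qed (auto simp: lin_dep_def)
    then show thesis using that by blast
  qed
  then have SW: "S \<subseteq> W" "lin_indpt S" by (auto simp: maximal_def)
  have Wspan: "w \<in> span S" if w: "w \<in> W" for w
  proof (cases "w \<in> S")
    case True
    then show ?thesis using in_own_span[of S] SW(1) W(1) V by auto
  next
    case False
    then have "\<not> (insert w S \<subseteq> W \<and> lin_indpt (insert w S))" using S(2) by (auto simp: maximal_def)
    then have "lin_dep (S \<union> {w})" using w SW by simp
    then show ?thesis using lin_dep_iff_in_span[of S w] False w SW W(1) V by auto
  qed
  obtain T where T: "finite T" "maximal T (\<lambda>A. A \<subseteq> carrier_vec n \<and> lin_indpt A)" "S \<subseteq> T"
  proof -
    have "\<exists>A. finite A \<and> maximal A (\<lambda>A. S \<subseteq> A \<and> A \<subseteq> carrier_vec n \<and> lin_indpt A)"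
    proof (rule maximal_exists[where B = S])
      fix A assume "S \<subseteq> A \<and> A \<subseteq> carrier_vec n \<and> lin_indpt A"
      then show "finite A \<and> card A \<le> n"
        using li_le_dim[of A] by (auto simp: dim_is_n)
    qed (use SW W V in auto)
    then obtain A where A: "finite A" "maximal A (\<lambda>A. S \<subseteq> A \<and> A \<subseteq> carrier_vec n \<and> lin_indpt A)" by blast
    \<comment> \<open>A superset of \<open>A\<close> contains \<open>S\<close> as well, so
      maximality among the sets containing \<open>S\<close> is maximality outright.\<close>
    then have "maximal A (\<lambda>A. A \<subseteq> carrier_vec n \<and> lin_indpt A)" "S \<subseteq> A" unfolding maximal_def by (meson order_trans)+
    then show thesis using that A by blast
  qed
  have basisT: "basis T" using max_li_is_basis[OF T(2)] .
  then have cardT: "card T = n" and liT: "lin_indpt T" and TV: "T \<subseteq> carrier_vec n"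
    using dim_basis[OF T(1) basisT] dim_is_n V by (auto simp: basis_def)
  obtain xs where xs: "set xs = S" "distinct xs" using finite_distinct_list[OF S(1)] by blast
  obtain ys where ys: "set ys = T - S" "distinct ys" using finite_distinct_list[of "T - S"] T(1) by blast
  let ?zs = "xs @ ys"
  have zs: "set ?zs = T" "distinct ?zs" using xs ys T(3) by auto
  then have lenz: "length ?zs = n" using cardT distinct_card by metis
  define P where "P = mat_of_cols n ?zs"
  have P: "P \<in> carrier_mat n n" using mat_of_cols_carrier(1)[of n ?zs] lenz by (simp add: P_def)
  have cols: "cols P = ?zs" unfolding P_def using zs(1) TV by (intro cols_mat_of_cols) auto
  have "rank P = n" by (rule lin_indpt_full_rank[OF P]) (simp_all only: cols zs liT not_False_eq_True)
  then have "det P \<noteq> 0" using det_rank_iff[OF P] by simp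
  then have PGL: "P \<in> carrier (GL n)"
    using det_non_zero_imp_unit[OF P, of "()"] by (simp add: GL_def units_of_def)
  show thesis
  proof (rule that[of "length xs" P])
    show "length xs \<le> n" using lenz by simp
    show "P \<in> carrier (GL n)" by fact
    show "col P j \<in> W" if "j < length xs" for j
    proof -
      have "col P j = ?zs ! j" using that lenz cols P by (metis carrier_matD(2) cols_nth length_append trans_less_add1)
      then show ?thesis using that xs(1) SW(1) by (auto simp: nth_append)
    qed
    show "W = carrier_vec n" if "length xs = n"
    proof -
      have "S = T" using that lenz ys(1) xs(1) zs(1) by auto
      have "carrier_vec n = span T" using basisT V by (auto simp: basis_def)
      also have "\<dots> \<subseteq> W" unfolding \<open>S = T\<close>[symmetric]
      proof (rule span_is_subset)
        show "submodule class_ring W V"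
          using subspace_vec_iff[of W n] W unfolding VectorSpace.subspace_def by blast
      qed (use SW in auto)
      finally show ?thesis using W(1) by blast
    qed
    fix w assume "w \<in> W"
    then obtain a A where a: "finite A" "A \<subseteq> S" "w = lincomb a A" using Wspan[OF \<open>w \<in> W\<close>] unfolding span_def by blast
    \<comment> \<open>The coefficients are extended by zero to the whole basis \<open>T\<close>,
      which makes the coordinates belonging to \<open>ys\<close> vanish.\<close>
    define b where "b = (\<lambda>v. if v \<in> A then a v else 0)"
    have "lincomb a A = lincomb b A" unfolding b_def
      using a(2) SW(1) W(1) V by (intro lincomb_cong) (auto simp: class_ring_simps)
    also have "\<dots> = lincomb b (A \<union> (T - A))"
      using a(1,2) T(1,3) TV V
      by (intro lincomb_clean[symmetric]) (auto simp: b_def class_ring_simps)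
    also have "A \<union> (T - A) = set (cols P)" using a(2) T(3) zs cols by auto
    finally have "w = P *\<^sub>v vec n (\<lambda>i. b (col P i))"
      using mat_mult_eq_lincomb[OF P, of b] zs cols a(3) by simp
    moreover have "vec n (\<lambda>i. b (col P i)) $ i = 0" if "i < n" "i \<ge> length xs" for i
    proof -
      have "col P i = ?zs ! i" using that cols P by (metis carrier_matD(2) cols_nth)
      then have "col P i \<in> set ys" using that lenz by (auto simp: nth_append)
      then show ?thesis using that a(2) ys(1) by (auto simp: b_def)
    qed
    ultimately show "\<exists>u\<in>carrier_vec n. w = P *\<^sub>v u \<and> (\<forall>i<n. i \<ge> length xs \<longrightarrow> u $ i = 0)"
      by (intro bexI[of _ "vec n (\<lambda>i. b (col P i))"]) auto
  qed
qed

section \<open>Maschke's theorem\<close>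

lemma four_block_mat_inject:
  assumes "A \<in> carrier_mat n m" "B \<in> carrier_mat n l" "C \<in> carrier_mat k m" "D \<in> carrier_mat k l"
    and "A' \<in> carrier_mat n m" "B' \<in> carrier_mat n l" "C' \<in> carrier_mat k m" "D' \<in> carrier_mat k l"
    and eq: "four_block_mat A B C D = four_block_mat A' B' C' D'"
  shows "A = A' \<and> B = B' \<and> C = C' \<and> D = D'"
proof -
  have e: "four_block_mat A B C D $$ (i, j) = four_block_mat A' B' C' D' $$ (i, j)" for i j using eq by simp
  have "A = A'"
  proof (rule eq_matI)
    fix i j assume "i < dim_row A'" "j < dim_col A'"
    then show "A $$ (i, j) = A' $$ (i, j)" using e[of i j] assms(1-8) by auto
  qed (use assms in auto)
  moreover have "B = B'"
  proof (rule eq_matI)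
    fix i j assume "i < dim_row B'" "j < dim_col B'"
    then show "B $$ (i, j) = B' $$ (i, j)" using e[of i "j + m"] assms(1-8) by auto
  qed (use assms in auto)
  moreover have "C = C'"
  proof (rule eq_matI)
    fix i j assume "i < dim_row C'" "j < dim_col C'"
    then show "C $$ (i, j) = C' $$ (i, j)" using e[of "i + n" j] assms(1-8) by auto
  qed (use assms in auto)
  moreover have "D = D'"
  proof (rule eq_matI)
    fix i j assume "i < dim_row D'" "j < dim_col D'"
    then show "D $$ (i, j) = D' $$ (i, j)" using e[of "i + n" "j + m"] assms(1-8) by auto
  qed (use assms in auto)
  ultimately show ?thesis by simp
qed

lemma GL_mult_closed: "A \<in> carrier (GL d) \<Longrightarrow> B \<in> carrier (GL d) \<Longrightarrow> A * B \<in> carrier (GL d)"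
proof -
  have "group (GL d)" unfolding GL_def
    by (intro monoid.units_group ring.is_monoid ring_mat)
  from group.is_monoid[OF this] show "A \<in> carrier (GL d) \<Longrightarrow> B \<in> carrier (GL d) \<Longrightarrow> A * B \<in> carrier (GL d)"
    using monoid.m_closed[of "GL d" A B] by simp
qed

lemma four_block_diag_mult:
  fixes A B A' B' :: "complex mat"
  assumes "A \<in> carrier_mat n n" "B \<in> carrier_mat m m" "A' \<in> carrier_mat n n" "B' \<in> carrier_mat m m"
  shows "four_block_mat A (0\<^sub>m n m) (0\<^sub>m m n) B * four_block_mat A' (0\<^sub>m n m) (0\<^sub>m m n) B'
       = four_block_mat (A * A') (0\<^sub>m n m) (0\<^sub>m m n) (B * B')"
  using assms by (subst mult_four_block_mat[of _ n n _ m _ m]) auto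

text \<open>Conjugating the block triangular matrices \<open>M g\<close> by \<open>R\<close>, whose upper right block is obtained
  by averaging \<open>B h * C (inv h)\<close> over the group, removes their upper right blocks \<open>B g\<close>.\<close>

lemma block_triangular_splits:
  fixes G (structure)
  assumes G: "group G" and fin: "finite (carrier G)"
    and A: "\<And>g. g \<in> carrier G \<Longrightarrow> A g \<in> carrier_mat k k"
    and B: "\<And>g. g \<in> carrier G \<Longrightarrow> B g \<in> carrier_mat k m"
    and C: "\<And>g. g \<in> carrier G \<Longrightarrow> C g \<in> carrier_mat m m"
    and M_def: "\<And>g. M g = four_block_mat (A g) (B g) (0\<^sub>m m k) (C g)"
    and mult: "\<And>g h. g \<in> carrier G \<Longrightarrow> h \<in> carrier G \<Longrightarrow> M (g \<otimes> h) = M g * M h"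
    and one: "M \<one> = 1\<^sub>m (k + m)"
  obtains R where "representation G A" "rep_dim G A = k" "representation G C" "rep_dim G C = m"
    "R \<in> carrier (GL (k + m))"
    "\<And>g. g \<in> carrier G \<Longrightarrow> R * M g = four_block_mat (A g) (0\<^sub>m k m) (0\<^sub>m m k) (C g) * R"
proof -
  interpret group G by fact
  have prod: "A (g \<otimes> h) = A g * A h" "B (g \<otimes> h) = A g * B h + B g * C h" "C (g \<otimes> h) = C g * C h"
    if g: "g \<in> carrier G" and h: "h \<in> carrier G" for g h
  proof -
    have "four_block_mat (A (g \<otimes> h)) (B (g \<otimes> h)) (0\<^sub>m m k) (C (g \<otimes> h))
        = four_block_mat (A g * A h) (A g * B h + B g * C h) (0\<^sub>m m k) (C g * C h)"
      using mult[OF g h] A[OF g] A[OF h] B[OF g] B[OF h] C[OF g] C[OF h] unfolding M_def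
      by (simp add: mult_four_block_mat[of _ k k _ m _ m])
    from four_block_mat_inject[OF _ _ _ _ _ _ _ _ this, of k k m m]
    show "A (g \<otimes> h) = A g * A h" "B (g \<otimes> h) = A g * B h + B g * C h" "C (g \<otimes> h) = C g * C h"
      using A[OF g] A[OF h] B[OF g] B[OF h] C[OF g] C[OF h] A[OF m_closed[OF g h]] B[OF m_closed[OF g h]]
        C[OF m_closed[OF g h]] by auto
  qed
  have "four_block_mat (A \<one>) (B \<one>) (0\<^sub>m m k) (C \<one>) = four_block_mat (1\<^sub>m k) (0\<^sub>m k m) (0\<^sub>m m k) (1\<^sub>m m)"
    using one unfolding M_def by simp
  from four_block_mat_inject[OF _ _ _ _ _ _ _ _ this, of k k m m]
  have ones: "A \<one> = 1\<^sub>m k" "C \<one> = 1\<^sub>m m" using A B C by auto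
  note repA = representationI[where \<rho> = A, OF G A ones(1) prod(1)]
  note repC = representationI[where \<rho> = C, OF G C ones(2) prod(3)]
  define N :: complex where "N = of_nat (card (carrier G))"
  have N: "N \<noteq> 0" unfolding N_def using fin by auto
  define S where "S = mat_sum k m (\<lambda>h. B h * C (inv h)) (carrier G)"
  have S: "S \<in> carrier_mat k m" by (simp add: S_def)
  \<comment> \<open>The scalar is chosen so that \<open>A g * X = B g + X * C g\<close>, which
    equates the upper right blocks of \<open>R * M g\<close> and of the block diagonal matrix times
    \<open>R\<close>.\<close>
  define X where "X = (- (1 / N)) \<cdot>\<^sub>m S"
  have X: "X \<in> carrier_mat k m" by (simp add: X_def S)
  \<comment> \<open>Multiplicativity of \<open>M\<close> makes \<open>B\<close> a cocycle. Its
    identity for \<open>g \<otimes> h\<close>, multiplied by \<open>C (inv h)\<close>, says that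
    \<open>A g * (B h * C (inv h)) + B g\<close> is
    \<open>B (g \<otimes> h) * C (inv (g \<otimes> h)) * C g\<close>. Summing over \<open>h\<close>
    and translating the variable by \<open>g\<close> gives the claim.\<close>
  have AS: "A g * S + N \<cdot>\<^sub>m B g = S * C g" if g: "g \<in> carrier G" for g
  proof -
    let ?f = "\<lambda>h. B h * C (inv h)"
    have f: "?f h \<in> carrier_mat k m" if "h \<in> carrier G" for h
      using B[OF that] C[of "inv h"] that by (auto intro!: mult_carrier_mat[of _ k m])
    have "N \<cdot>\<^sub>m B g = mat_sum k m (\<lambda>h. B g) (carrier G)"
      unfolding mat_sum_def N_def using B[OF g] by (intro eq_matI) auto
    then have "A g * S + N \<cdot>\<^sub>m B g = mat_sum k m (\<lambda>h. A g * ?f h) (carrier G) + mat_sum k m (\<lambda>h. B g) (carrier G)"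
      unfolding S_def using mult_mat_sum[where S = "carrier G" and f = ?f, OF A[OF g] f] by simp
    also have "\<dots> = mat_sum k m (\<lambda>h. A g * ?f h + B g) (carrier G)"
      using f A[OF g] B[OF g] by (intro mat_sum_add[symmetric]) (auto intro!: mult_carrier_mat[of _ k k])
    also have "\<dots> = mat_sum k m (\<lambda>h. ?f (g \<otimes> h) * C g) (carrier G)"
    proof (rule mat_sum_cong)
      fix h assume h: "h \<in> carrier G"
      have ih: "inv h \<in> carrier G" using h by simp
      note cs = A[OF g] B[OF g] B[OF h] C[OF g] C[OF h] C[OF ih]
      have "?f (g \<otimes> h) * C g = (A g * B h + B g * C h) * C (inv (g \<otimes> h)) * C g"
        using prod(2)[OF g h] by simp
      also have "\<dots> = (A g * B h + B g * C h) * (C (inv (g \<otimes> h)) * C g)"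
        using cs C[of "inv (g \<otimes> h)"] g h by (intro assoc_mult_mat[of _ k m _ m _ m]) auto
      also have "C (inv (g \<otimes> h)) * C g = C (inv h)"
        using prod(3)[of "inv (g \<otimes> h)" g] g h by (simp add: inv_mult_group m_assoc)
      also have "(A g * B h + B g * C h) * C (inv h) = A g * B h * C (inv h) + B g * C h * C (inv h)"
        using cs by (intro add_mult_distrib_mat[of _ k m _ _ m]) auto
      also have "B g * C h * C (inv h) = B g * (C h * C (inv h))"
        using cs by (intro assoc_mult_mat[of _ k m _ m _ m]) auto
      also have "C h * C (inv h) = 1\<^sub>m m" using prod(3)[OF h ih, symmetric] h ones by simp
      also have "B g * 1\<^sub>m m = B g" using cs by simp
      also have "A g * B h * C (inv h) = A g * ?f h"
        using cs by (intro assoc_mult_mat[of _ k k _ m _ m]) auto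
      finally show "A g * ?f h + B g = ?f (g \<otimes> h) * C g" by simp
    qed
    also have "\<dots> = mat_sum k m (\<lambda>h. ?f h * C g) (carrier G)"
    proof (rule mat_sum_reindex_bij_betw)
      show "bij_betw (\<lambda>h. g \<otimes> h) (carrier G) (carrier G)"
        by (rule bij_betwI[where g = "\<lambda>h. inv g \<otimes> h"]) (use g in \<open>auto simp: m_assoc[symmetric]\<close>)
    qed
    also have "\<dots> = S * C g"
      unfolding S_def by (rule mat_sum_mult[OF C[OF g] f, symmetric])
    finally show ?thesis .
  qed
  have AX: "A g * X = B g + X * C g" if g: "g \<in> carrier G" for g
  proof -
    have "A g * X = - (1 / N) \<cdot>\<^sub>m (A g * S)" unfolding X_def using A[OF g] S by (simp add: mult_smult_distrib)
    also have "\<dots> = B g + - (1 / N) \<cdot>\<^sub>m (A g * S + N \<cdot>\<^sub>m B g)"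
      using A[OF g] B[OF g] S N by (intro eq_matI) (auto simp: field_simps simp del: index_mult_mat(1))
    also have "\<dots> = B g + X * C g"
      unfolding AS[OF g] X_def mult_smult_assoc_mat[OF S C[OF g]] ..
    finally show ?thesis .
  qed
  define R where "R = four_block_mat (1\<^sub>m k) X (0\<^sub>m m k) (1\<^sub>m m)"
  define R' where "R' = four_block_mat (1\<^sub>m k) (- X) (0\<^sub>m m k) (1\<^sub>m m)"
  have R: "R \<in> carrier_mat (k + m) (k + m)" "R' \<in> carrier_mat (k + m) (k + m)"
    by (auto simp: R_def R'_def)
  have XX: "X + - X = 0\<^sub>m k m" "- X + X = 0\<^sub>m k m" using X by (auto intro!: eq_matI)
  have zz: "- 0\<^sub>m m m = (0\<^sub>m m m :: complex mat)" by (intro eq_matI) auto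
  have "R * R' = 1\<^sub>m (k + m)" "R' * R = 1\<^sub>m (k + m)"
    unfolding R_def R'_def using X XX
    by (subst mult_four_block_mat[of _ k k _ m _ m _ _ k _ m]; simp add: zz)+
  then have "R \<in> carrier (GL (k + m))" using R by (auto simp: GL_carrier_iff)
  moreover have "R * M g = four_block_mat (A g) (0\<^sub>m k m) (0\<^sub>m m k) (C g) * R" if g: "g \<in> carrier G" for g
    unfolding R_def M_def using A[OF g] B[OF g] C[OF g] X AX[OF g]
    by (subst mult_four_block_mat[of _ k k _ m _ m _ _ k _ m]; simp)+
  ultimately show thesis using that repA repC by blast
qed

lemma equivalent_reps_trans:
  assumes "equivalent_reps G \<rho> \<sigma>" "equivalent_reps G \<sigma> \<tau>"
    and \<rho>: "\<And>g. g \<in> carrier G \<Longrightarrow> \<rho> g \<in> carrier_mat (rep_dim G \<rho>) (rep_dim G \<rho>)"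
    and \<sigma>: "\<And>g. g \<in> carrier G \<Longrightarrow> \<sigma> g \<in> carrier_mat (rep_dim G \<rho>) (rep_dim G \<rho>)"
    and \<tau>: "\<And>g. g \<in> carrier G \<Longrightarrow> \<tau> g \<in> carrier_mat (rep_dim G \<rho>) (rep_dim G \<rho>)"
  shows "equivalent_reps G \<rho> \<tau>"
proof -
  let ?d = "rep_dim G \<rho>"
  have dims: "rep_dim G \<sigma> = ?d" "rep_dim G \<tau> = ?d"
    using assms(1,2) unfolding equivalent_reps_def by (elim conjE; simp)+
  obtain P where P: "P \<in> carrier (GL ?d)" "\<And>g. g \<in> carrier G \<Longrightarrow> P * \<rho> g = \<sigma> g * P"
    using assms(1) unfolding equivalent_reps_def by blast
  obtain Q where Q: "Q \<in> carrier (GL ?d)" "\<And>g. g \<in> carrier G \<Longrightarrow> Q * \<sigma> g = \<tau> g * Q"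
    using assms(2) unfolding equivalent_reps_def dims by blast
  have c: "P \<in> carrier_mat ?d ?d" "Q \<in> carrier_mat ?d ?d" using P Q by (auto simp: GL_carrier_iff)
  have "Q * P * \<rho> g = \<tau> g * (Q * P)" if g: "g \<in> carrier G" for g
  proof -
    have "Q * P * \<rho> g = Q * (\<sigma> g * P)" using assoc_mult_mat[OF c(2,1) \<rho>[OF g]] P(2)[OF g] by simp
    also have "\<dots> = \<tau> g * Q * P" using assoc_mult_mat[OF c(2) \<sigma>[OF g] c(1)] Q(2)[OF g] by simp
    also have "\<dots> = \<tau> g * (Q * P)" using assoc_mult_mat[OF \<tau>[OF g] c(2,1)] .
    finally show ?thesis .
  qed
  then show ?thesis using GL_mult_closed[OF Q(1) P(1)] unfolding equivalent_reps_def dims by blast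
qed

text \<open>In a basis adapted to \<open>W\<close> the matrices are block upper triangular. The
  diagonal blocks \<open>A\<close> and \<open>C\<close> describe the action on \<open>W\<close> and
  on the quotient by \<open>W\<close>; both are smaller than \<open>\<sigma>\<close> because
  \<open>W\<close> is neither zero nor everything. \<open>block_triangular_splits\<close> then
  removes the remaining block.\<close>

lemma reducible_rep_splits:
  fixes G (structure)
  assumes G: "group G" and fin: "finite (carrier G)" and \<sigma>: "representation G \<sigma>"
    and W: "invariant_subspace G \<sigma> W" "W \<noteq> {0\<^sub>v (rep_dim G \<sigma>)}" "W \<noteq> carrier_vec (rep_dim G \<sigma>)"
  obtains A C where "representation G A" "representation G C"
    "rep_dim G A < rep_dim G \<sigma>" "rep_dim G C < rep_dim G \<sigma>"
    "equivalent_reps G \<sigma> (\<lambda>g. diag_block_mat [A g, C g])"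
proof -
  interpret group G by fact
  define d where "d = rep_dim G \<sigma>"
  note cs = representation_carrier[OF G \<sigma>, folded d_def]
  have sub: "W \<subseteq> carrier_vec d" "0\<^sub>v d \<in> W" "\<And>v w. v \<in> W \<Longrightarrow> w \<in> W \<Longrightarrow> v + w \<in> W"
    "\<And>c v. v \<in> W \<Longrightarrow> c \<cdot>\<^sub>v v \<in> W" "\<And>g w. g \<in> carrier G \<Longrightarrow> w \<in> W \<Longrightarrow> \<sigma> g *\<^sub>v w \<in> W"
    using W(1) by (auto simp: invariant_subspace_def subspace_vec_iff d_def)
  obtain k P where kP: "k \<le> d" "P \<in> carrier (GL d)" "\<And>j. j < k \<Longrightarrow> col P j \<in> W"
    "\<And>w. w \<in> W \<Longrightarrow> \<exists>u\<in>carrier_vec d. w = P *\<^sub>v u \<and> (\<forall>i<d. i \<ge> k \<longrightarrow> u $ i = 0)"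
    "k = d \<Longrightarrow> W = carrier_vec d"
    using subspace_adapted_basis[OF sub(1-4)] by metis
  obtain Q where PQ: "P \<in> carrier_mat d d" "Q \<in> carrier_mat d d" "P * Q = 1\<^sub>m d" "Q * P = 1\<^sub>m d"
    using kP(2) by (auto simp: GL_carrier_iff)
  have kd: "k < d" using kP(1,5) W(3) by (auto simp: d_def)
  have k0: "k > 0"
  proof (rule ccontr)
    assume "\<not> k > 0"
    then have "w = 0\<^sub>v d" if w: "w \<in> W" for w
    proof -
      obtain u where u: "u \<in> carrier_vec d" "w = P *\<^sub>v u" "\<forall>i<d. u $ i = 0"
        using kP(4)[OF w] \<open>\<not> k > 0\<close> by auto
      have "u = 0\<^sub>v d" using u(1,3) by (intro eq_vecI) auto
      then show ?thesis using u(2) PQ(1) by (auto intro!: eq_vecI)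
    qed
    then have "W = {0\<^sub>v d}" using sub(2) by blast
    then show False using W(2) by (simp add: d_def)
  qed
  define m where "m = d - k"
  have dkm: "d = k + m" using kd by (simp add: m_def)
  define M0 where "M0 = (\<lambda>g. Q * \<sigma> g * P)"
  have M0: "M0 g \<in> carrier_mat d d" if "g \<in> carrier G" for g
    unfolding M0_def using PQ cs[OF that] by (auto intro!: mult_carrier_mat[of _ d d])
  \<comment> \<open>Column \<open>j\<close> holds the coordinates of the image of the basis vector
    \<open>col P j\<close> of \<open>W\<close> under \<open>\<sigma> g\<close>. The image stays in
    \<open>W\<close>, so its coordinates from position \<open>k\<close> on vanish.\<close>
  have zero: "M0 g $$ (i, j) = 0" if g: "g \<in> carrier G" and ij: "i < d" "i \<ge> k" "j < k" for g i j
  proof -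
    have j: "j < d" using ij kd by simp
    obtain u where u: "u \<in> carrier_vec d" "\<sigma> g *\<^sub>v col P j = P *\<^sub>v u" "\<forall>i<d. i \<ge> k \<longrightarrow> u $ i = 0"
      using kP(4)[OF sub(5)[OF g kP(3)[OF ij(3)]]] by auto
    have "col (M0 g) j = (Q * \<sigma> g) *\<^sub>v col P j"
      unfolding M0_def using PQ cs[OF g] j by (intro col_mult2[of _ d d _ d]) auto
    also have "\<dots> = Q *\<^sub>v (P *\<^sub>v u)"
      using assoc_mult_mat_vec[OF PQ(2) cs[OF g] col_carrier_vec[OF j PQ(1)]] u(2) by simp
    also have "\<dots> = u" using assoc_mult_mat_vec[OF PQ(2,1) u(1)] PQ(4) u(1) by simp
    finally have "col (M0 g) j $ i = 0" using u(3) ij by simp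
    then show ?thesis using M0[OF g] ij j by simp
  qed
  define A where "A = (\<lambda>g. mat k k (\<lambda>(i, j). M0 g $$ (i, j)))"
  define B where "B = (\<lambda>g. mat k m (\<lambda>(i, j). M0 g $$ (i, j + k)))"
  define C where "C = (\<lambda>g. mat m m (\<lambda>(i, j). M0 g $$ (i + k, j + k)))"
  define M where "M = (\<lambda>g. four_block_mat (A g) (B g) (0\<^sub>m m k) (C g))"
  have MM: "M g = M0 g" if g: "g \<in> carrier G" for g
  proof (rule eq_matI)
    fix i j assume "i < dim_row (M0 g)" "j < dim_col (M0 g)"
    then show "M g $$ (i, j) = M0 g $$ (i, j)"
      using M0[OF g] zero[OF g, of i j] dkm by (auto simp: M_def A_def B_def C_def)
  qed (use M0[OF g] dkm in \<open>auto simp: M_def A_def C_def\<close>)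
  have one: "M \<one> = 1\<^sub>m (k + m)"
    using MM[of "\<one>"] PQ representation_one[OF G \<sigma>, folded d_def] dkm by (simp add: M0_def)
  have mult: "M (g \<otimes> h) = M g * M h" if g: "g \<in> carrier G" and h: "h \<in> carrier G" for g h
  proof -
    note c = PQ(1,2) cs[OF g] cs[OF h]
    have "M0 g * M0 h = Q * \<sigma> g * (P * Q) * \<sigma> h * P"
      unfolding M0_def using c by (simp add: assoc_mult_mat[of _ d d _ d _ d] del: PQ)
    also have "\<dots> = M0 (g \<otimes> h)"
      unfolding PQ(3) M0_def representation_mult[OF G \<sigma> g h]
      using c by (simp add: assoc_mult_mat[of _ d d _ d _ d])
    finally show ?thesis using MM g h by simp
  qed
  obtain R where R: "representation G A" "rep_dim G A = k" "representation G C" "rep_dim G C = m"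
    "R \<in> carrier (GL (k + m))"
    "\<And>g. g \<in> carrier G \<Longrightarrow> R * M g = four_block_mat (A g) (0\<^sub>m k m) (0\<^sub>m m k) (C g) * R"
    by (rule block_triangular_splits[OF G fin, of A k B m C M]) (use mult one in \<open>auto simp: A_def B_def C_def M_def\<close>)
  have Ac: "A g \<in> carrier_mat k k" and Cc: "C g \<in> carrier_mat m m" for g by (auto simp: A_def C_def)
  have diag: "diag_block_mat [A g, C g] = four_block_mat (A g) (0\<^sub>m k m) (0\<^sub>m m k) (C g)" for g
    using carrier_matD[OF Ac[of g]] carrier_matD[OF Cc[of g]] diag_block_mat_singleton[of "C g"]
    by (simp add: Let_def del: diag_block_mat_singleton)
  have dimD: "rep_dim G (\<lambda>g. diag_block_mat [A g, C g]) = d"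
    unfolding rep_dim_def diag using carrier_matD(1)[OF Ac] carrier_matD(1)[OF Cc] dkm by simp
  have "R * Q * \<sigma> g = diag_block_mat [A g, C g] * (R * Q)" if g: "g \<in> carrier G" for g
  proof -
    note c = PQ(1,2) cs[OF g] M0[OF g]
    have Rc: "R \<in> carrier_mat d d" using R(5) dkm by (simp add: GL_carrier_iff)
    have Dc: "diag_block_mat [A g, C g] \<in> carrier_mat d d" unfolding diag dkm using Ac Cc by simp
    have "Q * \<sigma> g = Q * \<sigma> g * (P * Q)" using c PQ(3) by simp
    also have "\<dots> = M0 g * Q" unfolding M0_def using c by (simp add: assoc_mult_mat[of _ d d _ d _ d] del: PQ)
    finally have "R * Q * \<sigma> g = R * M0 g * Q"
      using assoc_mult_mat[OF Rc c(2,3)] assoc_mult_mat[OF Rc c(4) c(2)] by simp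
    also have "\<dots> = diag_block_mat [A g, C g] * R * Q" using R(6)[OF g] MM[OF g] by (simp only: diag)
    also have "\<dots> = diag_block_mat [A g, C g] * (R * Q)" using assoc_mult_mat[OF Dc Rc c(2)] .
    finally show ?thesis .
  qed
  moreover have "Q \<in> carrier (GL d)" using PQ by (auto simp: GL_carrier_iff)
  then have "R * Q \<in> carrier (GL d)" using GL_mult_closed R(5) dkm by simp
  ultimately have "equivalent_reps G \<sigma> (\<lambda>g. diag_block_mat [A g, C g])"
    unfolding equivalent_reps_def dimD d_def[symmetric] by auto
  then show thesis using that R kd k0 dkm by (simp add: d_def[symmetric])
qed

text \<open>Induction on the dimension: a representation of positive dimension that is not
  irreducible has a proper nonzero invariant subspace and splits into two smaller
  representations.\<close>

theorem maschke:
  fixes G (structure)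
  assumes G: "group G" and fin: "finite (carrier G)" and \<sigma>: "representation G \<sigma>"
  shows "\<exists>\<tau>s. (\<forall>\<tau>\<in>set \<tau>s. irreducible_rep G \<tau>) \<and> equivalent_reps G \<sigma> (direct_sum_rep \<tau>s)"
  using \<sigma>
proof (induction "rep_dim G \<sigma>" arbitrary: \<sigma> rule: less_induct)
  case less
  interpret group G by fact
  define d where "d = rep_dim G \<sigma>"
  note cs = representation_carrier[OF G less.prems, folded d_def]
  \<comment> \<open>Values outside the carrier are arbitrary, so a decomposition can be expected to
    match \<open>\<sigma>\<close> on the carrier only.\<close>
  have refl: "equivalent_reps G \<sigma> \<tau>" if "\<And>g. g \<in> carrier G \<Longrightarrow> \<tau> g = \<sigma> g" for \<tau>
    unfolding equivalent_reps_def d_def[symmetric]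
  proof (intro conjI bexI[of _ "1\<^sub>m d"] ballI)
    show "d = rep_dim G \<tau>" using that by (simp add: rep_dim_def d_def)
    show "1\<^sub>m d \<in> carrier (GL d)" by (auto simp: GL_carrier_iff)
    show "1\<^sub>m d * \<sigma> g = \<tau> g * 1\<^sub>m d" if "g \<in> carrier G" for g
      using cs[OF that] \<open>\<And>g. g \<in> carrier G \<Longrightarrow> \<tau> g = \<sigma> g\<close>[OF that] by simp
  qed
  consider "d = 0" | "irreducible_rep G \<sigma>" | W where "invariant_subspace G \<sigma> W" "W \<noteq> {0\<^sub>v d}" "W \<noteq> carrier_vec d"
    using less.prems by (auto simp: irreducible_rep_def d_def)
  then show ?case
  proof cases
    \<comment> \<open>Irreducible representations have positive dimension, so dimension zero is
      matched by the empty list of summands.\<close>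
    case 1
    have "direct_sum_rep [] g = \<sigma> g" if "g \<in> carrier G" for g
      using cs[OF that] 1 by (intro eq_matI) (auto simp: direct_sum_rep_def)
    then show ?thesis using refl by (intro exI[of _ "[]"]) auto
  next
    case 2
    have "direct_sum_rep [\<sigma>] g = \<sigma> g" for g
      unfolding direct_sum_rep_def list.map by (rule diag_block_mat_singleton)
    then show ?thesis using refl 2 by (intro exI[of _ "[\<sigma>]"]) auto
  next
    case 3
    obtain A C where AC: "representation G A" "representation G C"
      "rep_dim G A < d" "rep_dim G C < d" "equivalent_reps G \<sigma> (\<lambda>g. diag_block_mat [A g, C g])"
      using reducible_rep_splits[OF G fin less.prems 3[unfolded d_def]] by (metis d_def)
    obtain \<alpha> where \<alpha>: "\<forall>\<tau>\<in>set \<alpha>. irreducible_rep G \<tau>" "equivalent_reps G A (direct_sum_rep \<alpha>)"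
      using less.hyps[OF _ AC(1)] AC(3) by (auto simp: d_def)
    obtain \<gamma> where \<gamma>: "\<forall>\<tau>\<in>set \<gamma>. irreducible_rep G \<tau>" "equivalent_reps G C (direct_sum_rep \<gamma>)"
      using less.hyps[OF _ AC(2)] AC(4) by (auto simp: d_def)
    define k where "k = rep_dim G A"
    define m where "m = rep_dim G C"
    note Ac = representation_carrier[OF G AC(1), folded k_def]
    note Cc = representation_carrier[OF G AC(2), folded m_def]
    have dims: "rep_dim G (direct_sum_rep \<alpha>) = k" "rep_dim G (direct_sum_rep \<gamma>) = m"
      using \<alpha>(2) \<gamma>(2) by (auto simp: equivalent_reps_def k_def m_def)
    have \<alpha>c: "direct_sum_rep \<alpha> g \<in> carrier_mat k k" and \<gamma>c: "direct_sum_rep \<gamma> g \<in> carrier_mat m m"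
      if "g \<in> carrier G" for g
      using representation_direct_sum(1)[OF G _ that, of \<alpha>] representation_direct_sum(1)[OF G _ that, of \<gamma>] \<alpha>(1) \<gamma>(1)
      by (auto simp: dims irreducible_rep_def)
    obtain P1 Q1 where P1: "P1 \<in> carrier_mat k k" "Q1 \<in> carrier_mat k k" "P1 * Q1 = 1\<^sub>m k" "Q1 * P1 = 1\<^sub>m k"
      "\<And>g. g \<in> carrier G \<Longrightarrow> P1 * A g = direct_sum_rep \<alpha> g * P1"
      using \<alpha>(2) by (auto simp: equivalent_reps_def GL_carrier_iff k_def)
    obtain P2 Q2 where P2: "P2 \<in> carrier_mat m m" "Q2 \<in> carrier_mat m m" "P2 * Q2 = 1\<^sub>m m" "Q2 * P2 = 1\<^sub>m m"
      "\<And>g. g \<in> carrier G \<Longrightarrow> P2 * C g = direct_sum_rep \<gamma> g * P2"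
      using \<gamma>(2) by (auto simp: equivalent_reps_def GL_carrier_iff m_def)
    let ?D = "\<lambda>X Y. four_block_mat X (0\<^sub>m k m) (0\<^sub>m m k) Y"
    have diag: "diag_block_mat [A g, C g] = ?D (A g) (C g)" if "g \<in> carrier G" for g
      using carrier_matD[OF Ac[OF that]] carrier_matD[OF Cc[OF that]] diag_block_mat_singleton[of "C g"]
      by (simp add: Let_def del: diag_block_mat_singleton)
    have sum: "direct_sum_rep (\<alpha> @ \<gamma>) g = ?D (direct_sum_rep \<alpha> g) (direct_sum_rep \<gamma> g)" if "g \<in> carrier G" for g
      using carrier_matD[OF \<alpha>c[OF that]] carrier_matD[OF \<gamma>c[OF that]]
      by (simp add: direct_sum_rep_def diag_block_mat_append Let_def)
    have dimD: "rep_dim G (\<lambda>g. diag_block_mat [A g, C g]) = k + m"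
      unfolding rep_dim_def diag[OF one_closed] using Ac[OF one_closed] Cc[OF one_closed] by simp
    have dimS: "rep_dim G (direct_sum_rep (\<alpha> @ \<gamma>)) = k + m"
      unfolding rep_dim_def sum[OF one_closed] using \<alpha>c[OF one_closed] \<gamma>c[OF one_closed] by simp
    have d: "d = k + m" using AC(5) dimD by (simp add: equivalent_reps_def d_def)
    have "?D P1 P2 \<in> carrier (GL (k + m))"
      unfolding GL_carrier_iff using P1 P2
      by (intro conjI bexI[of _ "?D Q1 Q2"]) (simp_all add: four_block_diag_mult)
    moreover have "?D P1 P2 * ?D (A g) (C g) = ?D (direct_sum_rep \<alpha> g) (direct_sum_rep \<gamma> g) * ?D P1 P2"
      if "g \<in> carrier G" for g
      using P1 P2 Ac Cc \<alpha>c \<gamma>c that by (simp add: four_block_diag_mult)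
    ultimately have "equivalent_reps G (\<lambda>g. diag_block_mat [A g, C g]) (direct_sum_rep (\<alpha> @ \<gamma>))"
      unfolding equivalent_reps_def dimD dimS by (auto simp: diag sum simp del: diag_block_mat.simps)
    then have "equivalent_reps G \<sigma> (direct_sum_rep (\<alpha> @ \<gamma>))"
      using cs Ac Cc \<alpha>c \<gamma>c d
      by (intro equivalent_reps_trans[OF AC(5)]) (auto simp: diag sum d_def[symmetric] simp del: diag_block_mat.simps)
    then show ?thesis using \<alpha>(1) \<gamma>(1) by (intro exI[of _ "\<alpha> @ \<gamma>"]) auto
  qed
qed

text \<open>Maschke's theorem provides a decomposition and the character pairing fixes its count, so
  the definite description in \<open>rep_multiplicity\<close> has exactly one solution.\<close>

theorem rep_multiplicity_eq_char_pairing: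
  assumes G: "group G" and fin: "finite (carrier G)"
    and \<rho>: "irreducible_rep G \<rho>" and \<sigma>: "representation G \<sigma>"
  shows "of_nat (rep_multiplicity G \<rho> \<sigma>) = char_pairing G \<rho> \<sigma> / of_nat (card (carrier G))"
proof -
  interpret group G by fact
  have N: "card (carrier G) \<noteq> 0" using fin by auto
  obtain \<tau>s where \<tau>s: "\<forall>\<tau>\<in>set \<tau>s. irreducible_rep G \<tau>" "equivalent_reps G \<sigma> (direct_sum_rep \<tau>s)"
    using maschke[OF G fin \<sigma>] by blast
  note main = char_pairing_decomposition[OF G fin \<rho> \<sigma>]
  have "rep_multiplicity G \<rho> \<sigma> = length (filter (equivalent_reps G \<rho>) \<tau>s)"
    unfolding rep_multiplicity_def
  proof (rule the_equality)
    fix m assume "\<exists>\<tau>s. (\<forall>\<tau>\<in>set \<tau>s. irreducible_rep G \<tau>) \<and>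
      equivalent_reps G \<sigma> (direct_sum_rep \<tau>s) \<and> m = length (filter (equivalent_reps G \<rho>) \<tau>s)"
    then obtain \<tau>s' where "\<forall>\<tau>\<in>set \<tau>s'. irreducible_rep G \<tau>" "equivalent_reps G \<sigma> (direct_sum_rep \<tau>s')"
      "m = length (filter (equivalent_reps G \<rho>) \<tau>s')" by blast
    then have "of_nat (card (carrier G)) * of_nat m = (of_nat (card (carrier G)) *
        of_nat (length (filter (equivalent_reps G \<rho>) \<tau>s)) :: complex)"
      using main[of \<tau>s'] main[OF \<tau>s] by metis
    then show "m = length (filter (equivalent_reps G \<rho>) \<tau>s)" using N by (metis mult_cancel_left of_nat_eq_0_iff of_nat_eq_iff)
  qed (use \<tau>s in blast)
  then show ?thesis using main[OF \<tau>s] N by simp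
qed

section \<open>Kronecker products and induced representations\<close>

text \<open>Both \<open>kronecker\<close> and \<open>induced_rep\<close> number the pair
  \<open>(i, j)\<close> as \<open>i * d + j\<close>, so their traces and products reduce to this
  rearrangement.\<close>

lemma sum_div_mod:
  fixes f :: "nat \<Rightarrow> nat \<Rightarrow> 'a::comm_monoid_add"
  shows "(\<Sum>x<N*d. f (x div d) (x mod d)) = (\<Sum>i<N. \<Sum>j<d. f i j)"
proof -
  have "(\<Sum>x<N*d. f (x div d) (x mod d)) = (\<Sum>i<N. \<Sum>x\<in>{i*d..<i*d+d}. f (x div d) (x mod d))"
    by (rule sum.nat_group[symmetric])
  also have "\<dots> = (\<Sum>i<N. \<Sum>j<d. f i j)"
  proof (rule sum.cong[OF refl])
    fix i
    show "(\<Sum>x\<in>{i*d..<i*d+d}. f (x div d) (x mod d)) = (\<Sum>j<d. f i j)"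
    proof (rule sum.reindex_bij_witness[of _ "\<lambda>j. i*d + j" "\<lambda>x. x - i*d"])
      fix x assume x: "x \<in> {i*d..<i*d+d}"
      then obtain j where j: "x = i*d + j" "j < d" by (metis atLeastLessThan_iff le_iff_add nat_add_left_cancel_less)
      then show "f i (x - i*d) = f (x div d) (x mod d)" by simp
    qed auto
  qed
  finally show ?thesis .
qed

lemma kronecker_carrier [simp]:
  "A \<in> carrier_mat n m \<Longrightarrow> B \<in> carrier_mat k l \<Longrightarrow> kronecker A B \<in> carrier_mat (n * k) (m * l)"
  by (auto simp: kronecker_def)

lemma mod_less_of_less_mult: "x < n * k \<Longrightarrow> x mod k < (k::nat)"
  by (cases k) auto

lemma div_less_of_less_mult: "x < n * k \<Longrightarrow> x div k < (n::nat)"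
  by (simp add: less_mult_imp_div_less)

text \<open>The middle index of the matrix product runs over pairs, and the sum over pairs factors
  into two sums.\<close>

lemma kronecker_mult:
  assumes A: "A \<in> carrier_mat n n" and B: "B \<in> carrier_mat m m"
    and C: "C \<in> carrier_mat n n" and D: "D \<in> carrier_mat m m"
  shows "kronecker A B * kronecker C D = kronecker (A * C) (B * D)"
proof (rule eq_matI)
  fix x y assume "x < dim_row (kronecker (A * C) (B * D))" "y < dim_col (kronecker (A * C) (B * D))"
  then have xy: "x < n * m" "y < n * m" using assms by (auto simp: kronecker_def)
  note b = div_less_of_less_mult[OF xy(1)] div_less_of_less_mult[OF xy(2)]
    mod_less_of_less_mult[OF xy(1)] mod_less_of_less_mult[OF xy(2)]
  have "(kronecker A B * kronecker C D) $$ (x, y)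
      = (\<Sum>z<n*m. A $$ (x div m, z div m) * B $$ (x mod m, z mod m) * (C $$ (z div m, y div m) * D $$ (z mod m, y mod m)))"
    using xy by (subst mult_mat_entry[OF kronecker_carrier[OF A B] kronecker_carrier[OF C D]])
      (use assms in \<open>auto simp: kronecker_def intro!: sum.cong\<close>)
  also have "\<dots> = (\<Sum>i<n. \<Sum>j<m. A $$ (x div m, i) * B $$ (x mod m, j) * (C $$ (i, y div m) * D $$ (j, y mod m)))"
    by (rule sum_div_mod)
  also have "\<dots> = (\<Sum>i<n. A $$ (x div m, i) * C $$ (i, y div m)) * (\<Sum>j<m. B $$ (x mod m, j) * D $$ (j, y mod m))"
    unfolding sum_product by (intro sum.cong) (auto simp: ac_simps)
  also have "\<dots> = (A * C) $$ (x div m, y div m) * (B * D) $$ (x mod m, y mod m)"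
    using b by (simp only: mult_mat_entry[OF A C] mult_mat_entry[OF B D])
  also have "\<dots> = kronecker (A * C) (B * D) $$ (x, y)"
    using xy assms by (simp add: kronecker_def del: index_mult_mat(1))
  finally show "(kronecker A B * kronecker C D) $$ (x, y) = kronecker (A * C) (B * D) $$ (x, y)" .
qed (use assms in \<open>auto simp: kronecker_def\<close>)

lemma kronecker_one: "kronecker (1\<^sub>m n) (1\<^sub>m m) = 1\<^sub>m (n * m)"
proof (rule eq_matI)
  fix x y assume "x < dim_row (1\<^sub>m (n * m) :: complex mat)" "y < dim_col (1\<^sub>m (n * m) :: complex mat)"
  then have xy: "x < n * m" "y < n * m" by auto
  have iff: "x = y \<longleftrightarrow> x div m = y div m \<and> x mod m = y mod m"
    by (metis div_mult_mod_eq)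
  have "kronecker (1\<^sub>m n) (1\<^sub>m m) $$ (x, y) = 1\<^sub>m n $$ (x div m, y div m) * 1\<^sub>m m $$ (x mod m, y mod m)"
    using xy by (simp add: kronecker_def)
  also have "\<dots> = (if x div m = y div m \<and> x mod m = y mod m then 1 else 0)"
    using div_less_of_less_mult[OF xy(1)] div_less_of_less_mult[OF xy(2)]
      mod_less_of_less_mult[OF xy(1)] mod_less_of_less_mult[OF xy(2)] by simp
  also have "\<dots> = 1\<^sub>m (n * m) $$ (x, y)" unfolding iff[symmetric] using xy by simp
  finally show "kronecker (1\<^sub>m n) (1\<^sub>m m) $$ (x, y) = 1\<^sub>m (n * m) $$ (x, y)" .
qed (auto simp: kronecker_def)

lemma mat_trace_kronecker:
  assumes A: "A \<in> carrier_mat n n" and B: "B \<in> carrier_mat m m"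
  shows "mat_trace (kronecker A B) = mat_trace A * mat_trace B"
proof -
  have "mat_trace (kronecker A B) = (\<Sum>x<n*m. A $$ (x div m, x div m) * B $$ (x mod m, x mod m))"
    using assms by (auto simp: mat_trace_def kronecker_def)
  also have "\<dots> = (\<Sum>i<n. \<Sum>j<m. A $$ (i, i) * B $$ (j, j))" by (rule sum_div_mod)
  finally show ?thesis using assms by (auto simp: mat_trace_def sum_product)
qed

lemma kronecker_list_Cons: "kronecker_list (A # As) = kronecker A (kronecker_list As)"
  by (simp add: kronecker_list_def)

lemma kronecker_list_family:
  assumes "\<And>k. k \<in> set ks \<Longrightarrow> A k \<in> carrier_mat (d k) (d k)"
  shows kronecker_list_carrier: "kronecker_list (map A ks)
      \<in> carrier_mat (prod_list (map d ks)) (prod_list (map d ks))"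
    and mat_trace_kronecker_list: "mat_trace (kronecker_list (map A ks)) = (\<Prod>k\<leftarrow>ks. mat_trace (A k))"
proof -
  have "kronecker_list (map A ks) \<in> carrier_mat (prod_list (map d ks)) (prod_list (map d ks))
      \<and> mat_trace (kronecker_list (map A ks)) = (\<Prod>k\<leftarrow>ks. mat_trace (A k))"
    using assms
  proof (induction ks)
    case Nil
    then show ?case by (simp add: kronecker_list_def)
  next
    case (Cons k ks)
    then have IH: "kronecker_list (map A ks) \<in> carrier_mat (prod_list (map d ks)) (prod_list (map d ks))"
      "mat_trace (kronecker_list (map A ks)) = (\<Prod>k\<leftarrow>ks. mat_trace (A k))" and Ak: "A k \<in> carrier_mat (d k) (d k)"
      by auto
    show ?case using mat_trace_kronecker[OF Ak IH(1)] kronecker_carrier[OF Ak IH(1)] IH(2)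
      by (simp add: kronecker_list_Cons)
  qed
  then show "kronecker_list (map A ks) \<in> carrier_mat (prod_list (map d ks)) (prod_list (map d ks))"
    "mat_trace (kronecker_list (map A ks)) = (\<Prod>k\<leftarrow>ks. mat_trace (A k))" by auto
qed

lemma kronecker_list_mult:
  assumes "\<And>k. k \<in> set ks \<Longrightarrow> A k \<in> carrier_mat (d k) (d k)"
    and "\<And>k. k \<in> set ks \<Longrightarrow> B k \<in> carrier_mat (d k) (d k)"
  shows "kronecker_list (map (\<lambda>k. A k * B k) ks) = kronecker_list (map A ks) * kronecker_list (map B ks)"
  using assms
proof (induction ks)
  case Nil
  then show ?case by (simp add: kronecker_list_def)
next
  case (Cons k ks)
  have "kronecker_list (map (\<lambda>k. A k * B k) (k # ks))
      = kronecker (A k * B k) (kronecker_list (map A ks) * kronecker_list (map B ks))"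
    using Cons by (simp add: kronecker_list_Cons)
  also have "\<dots> = kronecker_list (map A (k # ks)) * kronecker_list (map B (k # ks))"
    unfolding list.map kronecker_list_Cons
    by (rule kronecker_mult[symmetric]) (use Cons.prems in \<open>auto intro!: kronecker_list_carrier\<close>)
  finally show ?case .
qed

lemma kronecker_list_one: "kronecker_list (map (\<lambda>k. 1\<^sub>m (d k)) ks) = 1\<^sub>m (prod_list (map d ks))"
proof (induction ks)
  case Nil
  then show ?case by (simp add: kronecker_list_def)
next
  case (Cons k ks)
  then show ?case by (simp add: kronecker_list_Cons kronecker_one)
qed

section \<open>Left transversals and induced representations\<close>

lemma (in group) inv_mult_cancel:
  assumes "x \<in> carrier G" "y \<in> carrier G"
  shows "x \<otimes> (inv x \<otimes> y) = y" "inv x \<otimes> (x \<otimes> y) = y"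
  using assms by (simp_all add: m_assoc[symmetric])

lemma l_coset_iff:
  fixes G (structure)
  assumes "group G" "subgroup H G" "t \<in> carrier G" "g \<in> carrier G"
  shows "g \<in> t <# H \<longleftrightarrow> inv t \<otimes> g \<in> H"
proof -
  interpret group G by fact
  note sub = subgroup.mem_carrier[OF assms(2)]
  show ?thesis
  proof
    assume "g \<in> t <# H"
    then obtain h where "h \<in> H" "g = t \<otimes> h" by (auto simp: l_coset_def)
    then show "inv t \<otimes> g \<in> H" using assms(3,4) sub by (simp add: m_assoc[symmetric])
  next
    assume "inv t \<otimes> g \<in> H"
    moreover have "g = t \<otimes> (inv t \<otimes> g)" using assms(3,4) by (simp add: m_assoc[symmetric])
    ultimately show "g \<in> t <# H" by (auto simp: l_coset_def)
  qed
qed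

text \<open>Coset membership takes the form tested in \<open>induced_rep\<close>, where the element
  in question is itself a product with a representative.\<close>

lemma left_transversal_iff:
  fixes G (structure)
  assumes "group G" "subgroup H G"
  shows "left_transversal G H ts \<longleftrightarrow> set ts \<subseteq> carrier G \<and>
     (\<forall>g\<in>carrier G. \<exists>!i. i < length ts \<and> inv (ts ! i) \<otimes> g \<in> H)"
proof -
  have "(i < length ts \<and> g \<in> ts ! i <# H) \<longleftrightarrow> (i < length ts \<and> inv (ts ! i) \<otimes> g \<in> H)"
    if "set ts \<subseteq> carrier G" "g \<in> carrier G" for i g
    using l_coset_iff[OF assms, of "ts ! i" g] that nth_mem[of i ts] by blast
  then show ?thesis unfolding left_transversal_def by (metis (no_types, lifting))
qed

lemma left_transversal_exists:
  fixes G (structure)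
  assumes G: "group G" and fin: "finite (carrier G)" and H: "subgroup H G"
  shows "\<exists>ts. left_transversal G H ts"
proof -
  interpret group G by fact
  interpret H: subgroup H G by fact
  \<comment> \<open>\<open>S g\<close> is the left coset of \<open>g\<close>. The representative is
    chosen from this set alone, so that all elements of a coset share it.\<close>
  define S where "S = (\<lambda>g. {x \<in> carrier G. inv g \<otimes> x \<in> H})"
  define r where "r = (\<lambda>g. SOME x. x \<in> S g)"
  have r: "r g \<in> S g" if "g \<in> carrier G" for g
  proof -
    have "g \<in> S g" using that by (simp add: S_def)
    then show ?thesis unfolding r_def by (rule someI)
  qed
  have flip: "inv y \<otimes> x \<in> H" if "inv x \<otimes> y \<in> H" "x \<in> carrier G" "y \<in> carrier G" for x y
    using H.m_inv_closed[OF that(1)] that by (simp add: inv_mult_group)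
  have trans: "inv x \<otimes> z \<in> H" if "inv x \<otimes> y \<in> H" "inv y \<otimes> z \<in> H"
    "x \<in> carrier G" "y \<in> carrier G" "z \<in> carrier G" for x y z
  proof -
    have "inv x \<otimes> y \<otimes> (inv y \<otimes> z) = inv x \<otimes> z"
      using that(3-5) by (simp add: m_assoc inv_mult_cancel)
    then show ?thesis using H.m_closed[OF that(1,2)] by simp
  qed
  have S_eq: "S g = S g'" if "inv g \<otimes> g' \<in> H" "g \<in> carrier G" "g' \<in> carrier G" for g g'
    unfolding S_def using trans[of g g'] trans[of g' g] flip[of g g'] that by blast
  obtain ts where ts: "set ts = r ` carrier G" "distinct ts"
    using finite_distinct_list[of "r ` carrier G"] fin by auto
  have rS: "r g \<in> carrier G" "inv g \<otimes> r g \<in> H" if "g \<in> carrier G" for g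
    using r[OF that] by (auto simp: S_def)
  have "\<exists>!i. i < length ts \<and> inv (ts ! i) \<otimes> g \<in> H" if g: "g \<in> carrier G" for g
  proof -
    obtain i where i: "i < length ts" "ts ! i = r g" using ts(1) g by (metis image_eqI in_set_conv_nth)
    show ?thesis
    proof (rule ex1I[of _ i])
      show "i < length ts \<and> inv (ts ! i) \<otimes> g \<in> H" using i rS[OF g] flip g by simp
      fix j assume j: "j < length ts \<and> inv (ts ! j) \<otimes> g \<in> H"
      then obtain g' where g': "g' \<in> carrier G" "ts ! j = r g'" using ts(1) nth_mem[of j ts] by auto
      have "inv g' \<otimes> g \<in> H" using trans[of g' "r g'" g] rS[OF g'(1)] j g' g by simp
      then have "r g' = r g" using S_eq[of g' g] g g' by (simp add: r_def)
      then have "ts ! j = ts ! i" using i(2) g'(2) by simp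
      then show "j = i" using ts(2) i(1) j by (simp add: nth_eq_iff_index_eq)
    qed
  qed
  moreover have "set ts \<subseteq> carrier G" using rS(1) ts(1) by auto
  ultimately have "left_transversal G H ts" unfolding left_transversal_iff[OF G H] by simp
  then show ?thesis ..
qed

text \<open>Every group element is uniquely of the form \<open>ts ! i \<otimes> h\<close>, and the
  factor \<open>h\<close> is absorbed by the invariance of \<open>\<phi>\<close>. The left side does
  not involve \<open>ts\<close>, so the sum over a transversal is the same for all
  transversals.\<close>

lemma sum_left_transversal:
  fixes G (structure) and \<phi> :: "'g \<Rightarrow> complex"
  assumes G: "group G" and fin: "finite (carrier G)" and H: "subgroup H G"
    and ts: "left_transversal G H ts" and g: "g \<in> carrier G"
    and inv: "\<And>h y. h \<in> H \<Longrightarrow> y \<in> carrier G \<Longrightarrow> \<phi> (inv h \<otimes> y \<otimes> h) = \<phi> y"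
  shows "(\<Sum>x\<in>carrier G. \<phi> (inv x \<otimes> g \<otimes> x))
    = of_nat (card H) * (\<Sum>i<length ts. \<phi> (inv (ts ! i) \<otimes> g \<otimes> ts ! i))"
proof -
  interpret group G by fact
  interpret H: subgroup H G by fact
  have tc: "ts ! i \<in> carrier G" if "i < length ts" for i
    using ts that by (auto simp: left_transversal_def)
  have uniq: "\<exists>!i. i < length ts \<and> inv (ts ! i) \<otimes> x \<in> H" if "x \<in> carrier G" for x
    using ts that unfolding left_transversal_iff[OF G H] by blast
  have hc: "h \<in> carrier G" if "h \<in> H" for h using that by auto
  let ?m = "\<lambda>(i, h). ts ! i \<otimes> h"
  have bij: "bij_betw ?m ({..<length ts} \<times> H) (carrier G)"
  proof (rule bij_betw_imageI)
    show "inj_on ?m ({..<length ts} \<times> H)"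
    proof (rule inj_onI, clarsimp)
      fix i h j k
      assume *: "i < length ts" "h \<in> H" "j < length ts" "k \<in> H" "ts ! i \<otimes> h = ts ! j \<otimes> k"
      have "inv (ts ! i) \<otimes> (ts ! i \<otimes> h) \<in> H"
        using *(1,2) tc hc by (simp add: inv_mult_cancel)
      moreover have "inv (ts ! j) \<otimes> (ts ! i \<otimes> h) \<in> H"
        unfolding *(5) using *(3,4) tc hc by (simp add: inv_mult_cancel)
      ultimately have "i = j" using uniq[of "ts ! i \<otimes> h"] * tc hc by blast
      then show "i = j \<and> h = k" using * tc hc by simp
    qed
    show "?m ` ({..<length ts} \<times> H) = carrier G"
    proof
      show "?m ` ({..<length ts} \<times> H) \<subseteq> carrier G" using tc hc by auto
      show "carrier G \<subseteq> ?m ` ({..<length ts} \<times> H)"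
      proof
        fix x assume x: "x \<in> carrier G"
        then obtain i where i: "i < length ts" "inv (ts ! i) \<otimes> x \<in> H" using uniq by blast
        then show "x \<in> ?m ` ({..<length ts} \<times> H)"
          using x tc by (intro image_eqI[of _ _ "(i, inv (ts ! i) \<otimes> x)"]) (auto simp: m_assoc[symmetric])
      qed
    qed
  qed
  have "(\<Sum>x\<in>carrier G. \<phi> (inv x \<otimes> g \<otimes> x))
      = (\<Sum>p\<in>{..<length ts} \<times> H. \<phi> (inv (?m p) \<otimes> g \<otimes> ?m p))"
    by (rule sum.reindex_bij_betw[OF bij, symmetric])
  also have "\<dots> = (\<Sum>i<length ts. \<Sum>h\<in>H. \<phi> (inv (ts ! i \<otimes> h) \<otimes> g \<otimes> (ts ! i \<otimes> h)))"
    by (simp add: sum.cartesian_product case_prod_unfold)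
  also have "\<dots> = (\<Sum>i<length ts. \<Sum>h\<in>H. \<phi> (inv (ts ! i) \<otimes> g \<otimes> ts ! i))"
  proof (intro sum.cong refl)
    fix i h assume "i \<in> {..<length ts}" "h \<in> H"
    then have c: "ts ! i \<in> carrier G" "h \<in> carrier G" "h \<in> H" using tc hc by auto
    have "inv (ts ! i \<otimes> h) \<otimes> g \<otimes> (ts ! i \<otimes> h) = inv h \<otimes> (inv (ts ! i) \<otimes> g \<otimes> ts ! i) \<otimes> h"
      using c g by (simp add: inv_mult_group m_assoc)
    then show "\<phi> (inv (ts ! i \<otimes> h) \<otimes> g \<otimes> (ts ! i \<otimes> h)) = \<phi> (inv (ts ! i) \<otimes> g \<otimes> ts ! i)"
      using inv[OF c(3), of "inv (ts ! i) \<otimes> g \<otimes> ts ! i"] c g by simp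
  qed
  finally show ?thesis by (simp add: sum_distrib_left)
qed

text \<open>This is the very \<open>SOME\<close> term inside \<open>induced_rep\<close>, so both
  refer to the same representatives.\<close>

definition transversal :: "('g, 'b) monoid_scheme \<Rightarrow> 'g set \<Rightarrow> 'g list" where
  "transversal G H = (SOME ts. left_transversal G H ts)"

lemma left_transversal_transversal:
  "group G \<Longrightarrow> finite (carrier G) \<Longrightarrow> subgroup H G \<Longrightarrow> left_transversal G H (transversal G H)"
  unfolding transversal_def by (rule someI_ex) (rule left_transversal_exists)

definition zero_ext_char :: "'g set \<Rightarrow> 'g rep \<Rightarrow> 'g \<Rightarrow> complex" where
  "zero_ext_char H \<rho> y = (if y \<in> H then mat_trace (\<rho> y) else 0)"

text \<open>Only the diagonal blocks contribute to the trace. This is Frobenius's formula for the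
  induced character.\<close>

lemma mat_trace_induced_rep:
  fixes G (structure)
  assumes G: "group G" and fin: "finite (carrier G)" and H: "subgroup H G"
    and car: "\<And>h. h \<in> H \<Longrightarrow> \<rho> h \<in> carrier_mat d d"
  shows "mat_trace (induced_rep G H \<rho> g) = (\<Sum>i<length (transversal G H).
    zero_ext_char H \<rho> (inv (transversal G H ! i) \<otimes> g \<otimes> transversal G H ! i))"
proof -
  let ?ts = "transversal G H"
  have d: "rep_dim G \<rho> = d" using car[OF subgroup.one_closed[OF H]] by (simp add: rep_dim_def)
  let ?f = "\<lambda>i a. let y = inv (?ts ! i) \<otimes> g \<otimes> ?ts ! i in if y \<in> H then \<rho> y $$ (a, a) else 0"
  have "mat_trace (induced_rep G H \<rho> g) = (\<Sum>x<length ?ts * d. ?f (x div d) (x mod d))"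
    by (simp add: mat_trace_def induced_rep_def d transversal_def[symmetric] Let_def)
  also have "\<dots> = (\<Sum>i<length ?ts. \<Sum>a<d. ?f i a)" by (rule sum_div_mod)
  also have "\<dots> = (\<Sum>i<length ?ts. zero_ext_char H \<rho> (inv (?ts ! i) \<otimes> g \<otimes> ?ts ! i))"
    using car by (intro sum.cong) (auto simp: Let_def mat_trace_def zero_ext_char_def)
  finally show ?thesis .
qed

text \<open>The conditions on \<open>\<rho>\<close> are stated on \<open>H\<close> directly, without
  making \<open>H\<close> a group of its own. The matrices are block monomial:
  \<open>g \<otimes> ts ! j\<close> lies in exactly one coset, so each block column has at most one
  nonzero block.\<close>

lemma representation_induced_rep:
  fixes G (structure)
  assumes G: "group G" and fin: "finite (carrier G)" and H: "subgroup H G"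
    and car: "\<And>h. h \<in> H \<Longrightarrow> \<rho> h \<in> carrier_mat d d"
    and one: "\<rho> \<one> = 1\<^sub>m d"
    and mult: "\<And>h k. h \<in> H \<Longrightarrow> k \<in> H \<Longrightarrow> \<rho> (h \<otimes> k) = \<rho> h * \<rho> k"
  shows "representation G (induced_rep G H \<rho>)"
proof -
  interpret group G by fact
  interpret H: subgroup H G by fact
  define ts where "ts = transversal G H"
  define N where "N = length ts"
  have ts: "left_transversal G H ts" unfolding ts_def by (rule left_transversal_transversal[OF G fin H])
  have tc: "ts ! i \<in> carrier G" if "i < N" for i
    using ts that by (auto simp: left_transversal_def N_def)
  have uniq: "\<exists>!i. i < N \<and> inv (ts ! i) \<otimes> x \<in> H" if "x \<in> carrier G" for x
    using ts that unfolding left_transversal_iff[OF G H] N_def by blast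
  have d: "rep_dim G \<rho> = d" using one by (simp add: rep_dim_def)
  define y where "y = (\<lambda>g i j. inv (ts ! i) \<otimes> g \<otimes> ts ! j)"
  have entry: "induced_rep G H \<rho> g $$ (x, z) =
      (if y g (x div d) (z div d) \<in> H then \<rho> (y g (x div d) (z div d)) $$ (x mod d, z mod d) else 0)"
    if "x < N * d" "z < N * d" for g x z
    using that by (simp add: induced_rep_def d transversal_def[symmetric] ts_def[symmetric] N_def Let_def y_def)
  have ic: "induced_rep G H \<rho> g \<in> carrier_mat (N * d) (N * d)" for g
    by (simp add: induced_rep_def d transversal_def[symmetric] ts_def[symmetric] N_def Let_def)
  show ?thesis
  proof (rule representationI(1)[OF G ic])
    show "induced_rep G H \<rho> \<one> = 1\<^sub>m (N * d)"
    proof (rule eq_matI)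
      fix x z assume "x < dim_row (1\<^sub>m (N * d) :: complex mat)" "z < dim_col (1\<^sub>m (N * d) :: complex mat)"
      then have xz: "x < N * d" "z < N * d" by auto
      let ?i = "x div d" and ?j = "z div d"
      have ij: "?i < N" "?j < N" and ab: "x mod d < d" "z mod d < d"
        using xz div_less_of_less_mult mod_less_of_less_mult by blast+
      have y: "y \<one> ?i ?j = inv (ts ! ?i) \<otimes> ts ! ?j" using ij tc by (simp add: y_def)
      have jj: "inv (ts ! ?j) \<otimes> ts ! ?j \<in> H" using ij tc by simp
      \<comment> \<open>A representative lies in its own coset only, so the off-diagonal blocks at
        the identity vanish.\<close>
      have "?i = ?j" if "inv (ts ! ?i) \<otimes> ts ! ?j \<in> H"
        using uniq[OF tc[OF ij(2)]] ij jj that by (elim ex1E) metis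
      then have iff: "y \<one> ?i ?j \<in> H \<longleftrightarrow> ?i = ?j" unfolding y using jj by auto
      have eq: "x = z" if "?i = ?j" "x mod d = z mod d" using that by (metis div_mult_mod_eq)
      have yj: "y \<one> ?j ?j = \<one>" using ij tc by (simp add: y_def)
      show "induced_rep G H \<rho> \<one> $$ (x, z) = 1\<^sub>m (N * d) $$ (x, z)"
      proof (cases "?i = ?j")
        case True
        have "induced_rep G H \<rho> \<one> $$ (x, z) = 1\<^sub>m d $$ (x mod d, z mod d)"
          unfolding entry[OF xz] using iff True yj one by simp
        also have "\<dots> = 1\<^sub>m (N * d) $$ (x, z)"
          using eq[OF True] xz ab by (cases "x = z") auto
        finally show ?thesis .
      next
        case False
        then have "x \<noteq> z" by auto
        then show ?thesis unfolding entry[OF xz] using iff False xz by simp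
      qed
    qed (use ic in auto)
    fix g h assume g: "g \<in> carrier G" and h: "h \<in> carrier G"
    show "induced_rep G H \<rho> (g \<otimes> h) = induced_rep G H \<rho> g * induced_rep G H \<rho> h"
    proof (rule eq_matI)
      fix x z assume "x < dim_row (induced_rep G H \<rho> g * induced_rep G H \<rho> h)"
        "z < dim_col (induced_rep G H \<rho> g * induced_rep G H \<rho> h)"
      then have xz: "x < N * d" "z < N * d" using ic[of g] ic[of h] by auto
      let ?i = "x div d" and ?j = "z div d" and ?a = "x mod d" and ?b = "z mod d"
      have ij: "?i < N" "?j < N" and ab: "?a < d" "?b < d"
        using xz div_less_of_less_mult mod_less_of_less_mult by blast+
      obtain k where k: "k < N" "y h k ?j \<in> H" and ku: "\<And>l. l < N \<Longrightarrow> y h l ?j \<in> H \<Longrightarrow> l = k"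
      proof -
        have "inv (ts ! l) \<otimes> (h \<otimes> ts ! ?j) = y h l ?j" if "l < N" for l
          using that tc ij h by (simp add: y_def m_assoc)
        then show thesis using uniq[of "h \<otimes> ts ! ?j"] that h tc[OF ij(2)] by (metis m_closed)
      qed
      let ?E = "\<lambda>g i j a b. if y g i j \<in> H then \<rho> (y g i j) $$ (a, b) else 0"
      have "(induced_rep G H \<rho> g * induced_rep G H \<rho> h) $$ (x, z)
          = (\<Sum>w<N*d. ?E g ?i (w div d) ?a (w mod d) * ?E h (w div d) ?j (w mod d) ?b)"
        unfolding mult_mat_entry[OF ic ic xz]
        by (intro sum.cong refl) (simp only: lessThan_iff entry[OF xz(1)] entry[OF _ xz(2)])
      also have "\<dots> = (\<Sum>l<N. \<Sum>c<d. ?E g ?i l ?a c * ?E h l ?j c ?b)" by (rule sum_div_mod)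
      \<comment> \<open>In block column \<open>?j\<close> of the second factor, only the block row
        of the coset of \<open>h \<otimes> ts ! ?j\<close> survives.\<close>
      also have "\<dots> = (\<Sum>l<N. if l = k then \<Sum>c<d. ?E g ?i k ?a c * ?E h k ?j c ?b else 0)"
      proof (rule sum.cong[OF refl])
        fix l assume "l \<in> {..<N}"
        then have l: "y h l ?j \<notin> H" if "l \<noteq> k" using ku[of l] that by auto
        show "(\<Sum>c<d. ?E g ?i l ?a c * ?E h l ?j c ?b)
            = (if l = k then \<Sum>c<d. ?E g ?i k ?a c * ?E h k ?j c ?b else 0)"
        proof (cases "l = k")
          case True
          then show ?thesis unfolding True by (simp only: if_True simp_thms)
        next
          case False
          then show ?thesis using l by simp
        qed
      qed
      also have "\<dots> = (\<Sum>c<d. ?E g ?i k ?a c * ?E h k ?j c ?b)" using k by simp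
      also have "\<dots> = ?E (g \<otimes> h) ?i ?j ?a ?b"
      proof -
        have yy: "y (g \<otimes> h) ?i ?j = y g ?i k \<otimes> y h k ?j"
        proof -
          show ?thesis unfolding y_def using tc[OF ij(1)] tc[OF ij(2)] tc[OF k(1)] g h
            by (simp add: m_assoc inv_mult_cancel)
        qed
        have yc: "y g ?i k \<in> carrier G" "y h k ?j \<in> carrier G"
          unfolding y_def using tc[OF ij(1)] tc[OF ij(2)] tc[OF k(1)] g h by auto
        show ?thesis
        proof (cases "y g ?i k \<in> H")
          case True
          then have "\<rho> (y (g \<otimes> h) ?i ?j) $$ (?a, ?b) = (\<Sum>c<d. \<rho> (y g ?i k) $$ (?a, c) * \<rho> (y h k ?j) $$ (c, ?b))"
            unfolding yy mult[OF True k(2)] using ab by (intro mult_mat_entry[OF car car]) (use k(2) in auto)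
          then show ?thesis using True k(2) yy by simp
        next
          case False
          \<comment> \<open>Both sides vanish here: \<open>y h k ?j\<close> is in \<open>H\<close>,
            so the product \<open>yy\<close> can lie in \<open>H\<close> only if its first factor
            does.\<close>
          have "y (g \<otimes> h) ?i ?j \<notin> H"
          proof
            assume "y (g \<otimes> h) ?i ?j \<in> H"
            then have "y g ?i k \<otimes> y h k ?j \<otimes> inv (y h k ?j) \<in> H" using k(2) yy by simp
            then show False using False yc by (simp add: m_assoc)
          qed
          then show ?thesis using False by simp
        qed
      qed
      finally show "induced_rep G H \<rho> (g \<otimes> h) $$ (x, z) = (induced_rep G H \<rho> g * induced_rep G H \<rho> h) $$ (x, z)"
        using entry[OF xz] by simp
    qed (use carrier_matD[OF ic] in simp_all)
  qed
qed

text \<open>This supplies the invariance demanded by \<open>sum_left_transversal\<close>.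
  Conjugation by \<open>H\<close> preserves both \<open>H\<close> and its complement, so the
  extension by zero inherits the invariance of the trace.\<close>

lemma zero_ext_char_conj:
  fixes G (structure)
  assumes G: "group G" and H: "subgroup H G"
    and car: "\<And>h. h \<in> H \<Longrightarrow> \<rho> h \<in> carrier_mat d d"
    and mult: "\<And>h k. h \<in> H \<Longrightarrow> k \<in> H \<Longrightarrow> \<rho> (h \<otimes> k) = \<rho> h * \<rho> k"
    and h: "h \<in> H" and y: "y \<in> carrier G"
  shows "zero_ext_char H \<rho> (inv h \<otimes> y \<otimes> h) = zero_ext_char H \<rho> y"
proof -
  interpret group G by fact
  interpret H: subgroup H G by fact
  have hc: "h \<in> carrier G" using h by auto
  have conj_back: "y = h \<otimes> (inv h \<otimes> y \<otimes> h) \<otimes> inv h"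
    using hc y by (simp add: m_assoc inv_mult_cancel)
  show ?thesis
  proof (cases "y \<in> H")
    case True
    have yh: "y \<otimes> h \<in> H" and ih: "inv h \<in> H" using True h by auto
    have "mat_trace (\<rho> (inv h \<otimes> (y \<otimes> h))) = mat_trace (\<rho> (y \<otimes> h) * \<rho> (inv h))"
      unfolding mult[OF ih yh] by (rule mat_trace_comm[OF car[OF ih] car[OF yh]])
    also have "\<rho> (y \<otimes> h) * \<rho> (inv h) = \<rho> y"
      using mult[OF yh ih] hc y by (simp add: m_assoc)
    finally show ?thesis using True h hc y by (simp add: zero_ext_char_def m_assoc)
  next
    case False
    have "inv h \<otimes> y \<otimes> h \<notin> H"
    proof
      assume "inv h \<otimes> y \<otimes> h \<in> H"
      then have "h \<otimes> (inv h \<otimes> y \<otimes> h) \<otimes> inv h \<in> H" using h by auto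
      then show False using False conj_back by simp
    qed
    then show ?thesis using False by (simp add: zero_ext_char_def)
  qed
qed

text \<open>Frobenius reciprocity for characters. The induced character is rewritten as a sum over
  all conjugating elements \<open>x\<close> and the sums are exchanged; since the character of
  \<open>U\<close> is a class function, every \<open>x\<close> contributes the same amount.\<close>

lemma char_pairing_induced_rep:
  fixes G (structure)
  assumes G: "group G" and fin: "finite (carrier G)" and H: "subgroup H G"
    and U: "representation G U"
    and car: "\<And>h. h \<in> H \<Longrightarrow> \<rho> h \<in> carrier_mat d d"
    and mult: "\<And>h k. h \<in> H \<Longrightarrow> k \<in> H \<Longrightarrow> \<rho> (h \<otimes> k) = \<rho> h * \<rho> k"
  shows "char_pairing G U (induced_rep G H \<rho>) / of_nat (card (carrier G))
    = (\<Sum>h\<in>H. mat_trace (U (inv h)) * mat_trace (\<rho> h)) / of_nat (card H)"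
proof -
  interpret group G by fact
  interpret H: subgroup H G by fact
  have finH: "finite H" using fin H.subset finite_subset by blast
  have cH: "card H \<noteq> 0" using finH H.one_closed card_gt_0_iff[of H] by blast
  have cG: "card (carrier G) \<noteq> 0" using fin by auto
  let ?e = "zero_ext_char H \<rho>"
  note conj = zero_ext_char_conj[where \<rho> = \<rho>, OF G H car mult]
  have ind: "of_nat (card H) * mat_trace (induced_rep G H \<rho> g) = (\<Sum>x\<in>carrier G. ?e (inv x \<otimes> g \<otimes> x))"
    if "g \<in> carrier G" for g
  proof -
    have "mat_trace (induced_rep G H \<rho> g) = (\<Sum>i<length (transversal G H).
        ?e (inv (transversal G H ! i) \<otimes> g \<otimes> transversal G H ! i))"
      by (rule mat_trace_induced_rep[OF G fin H car])
    moreover have "(\<Sum>x\<in>carrier G. ?e (inv x \<otimes> g \<otimes> x)) = of_nat (card H) *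
        (\<Sum>i<length (transversal G H). ?e (inv (transversal G H ! i) \<otimes> g \<otimes> transversal G H ! i))"
      by (rule sum_left_transversal[OF G fin H left_transversal_transversal[OF G fin H] that conj])
    ultimately show ?thesis by simp
  qed
  have U_conj: "mat_trace (U (inv (x \<otimes> y \<otimes> inv x))) = mat_trace (U (inv y))"
    if x: "x \<in> carrier G" and y: "y \<in> carrier G" for x y
  proof -
    let ?d = "rep_dim G U"
    have c: "x \<otimes> inv y \<in> carrier G" "inv x \<in> carrier G" using x y by auto
    have "mat_trace (U (inv (x \<otimes> y \<otimes> inv x))) = mat_trace (U (x \<otimes> inv y) * U (inv x))"
      using x y representation_mult[OF G U c] by (simp add: inv_mult_group m_assoc)
    also have "\<dots> = mat_trace (U (inv x) * U (x \<otimes> inv y))"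
      using representation_carrier[OF G U c(1)] representation_carrier[OF G U c(2)] by (rule mat_trace_comm)
    also have "U (inv x) * U (x \<otimes> inv y) = U (inv y)"
      using x y representation_mult[OF G U c(2,1)] by (simp add: inv_mult_cancel)
    finally show ?thesis .
  qed
  have "of_nat (card H) * char_pairing G U (induced_rep G H \<rho>)
      = (\<Sum>g\<in>carrier G. mat_trace (U (inv g)) * (of_nat (card H) * mat_trace (induced_rep G H \<rho> g)))"
    by (simp add: char_pairing_def sum_distrib_left ac_simps)
  also have "\<dots> = (\<Sum>g\<in>carrier G. \<Sum>x\<in>carrier G. mat_trace (U (inv g)) * ?e (inv x \<otimes> g \<otimes> x))"
    by (intro sum.cong refl) (simp add: ind sum_distrib_left)
  also have "\<dots> = (\<Sum>x\<in>carrier G. \<Sum>g\<in>carrier G. mat_trace (U (inv g)) * ?e (inv x \<otimes> g \<otimes> x))"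
    by (rule sum.swap)
  also have "\<dots> = (\<Sum>x\<in>carrier G. \<Sum>y\<in>carrier G. mat_trace (U (inv y)) * ?e y)"
  proof (rule sum.cong[OF refl])
    fix x assume x: "x \<in> carrier G"
    show "(\<Sum>g\<in>carrier G. mat_trace (U (inv g)) * ?e (inv x \<otimes> g \<otimes> x))
        = (\<Sum>y\<in>carrier G. mat_trace (U (inv y)) * ?e y)"
    proof (rule sum.reindex_bij_witness[of _ "\<lambda>y. x \<otimes> y \<otimes> inv x" "\<lambda>g. inv x \<otimes> g \<otimes> x"])
      fix g assume g: "g \<in> carrier G"
      show "x \<otimes> (inv x \<otimes> g \<otimes> x) \<otimes> inv x = g"
        using x g by (simp add: m_assoc inv_mult_cancel)
      then show "mat_trace (U (inv (inv x \<otimes> g \<otimes> x))) * ?e (inv x \<otimes> g \<otimes> x)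
          = mat_trace (U (inv g)) * ?e (inv x \<otimes> g \<otimes> x)"
        using U_conj[OF x, of "inv x \<otimes> g \<otimes> x"] x g by simp
    qed (use x in \<open>auto simp: m_assoc inv_mult_cancel\<close>)
  qed
  also have "\<dots> = of_nat (card (carrier G)) * (\<Sum>y\<in>carrier G. if y \<in> H then mat_trace (U (inv y)) * mat_trace (\<rho> y) else 0)"
    by (simp add: zero_ext_char_def if_distrib cong: if_cong)
  also have "(\<Sum>y\<in>carrier G. if y \<in> H then mat_trace (U (inv y)) * mat_trace (\<rho> y) else 0)
      = (\<Sum>h\<in>H. mat_trace (U (inv h)) * mat_trace (\<rho> h))"
    unfolding sum.inter_restrict[OF fin, symmetric] using H.subset by (simp add: Int_absorb1)
  finally show ?thesis using cH cG by (simp add: field_simps)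
qed

text \<open>Each value of \<open>\<rho>\<close> commutes with all the others, so it is scalar by
  Schur's lemma. Hence the line through the first unit vector is invariant and must be the whole
  space.\<close>

lemma rep_dim_abelian:
  assumes F: "comm_group F" and \<rho>: "irreducible_rep F \<rho>"
  shows "rep_dim F \<rho> = 1"
proof -
  interpret comm_group F by fact
  define d where "d = rep_dim F \<rho>"
  have rep: "representation F \<rho>" and d0: "d > 0" using \<rho> by (auto simp: irreducible_rep_def d_def)
  note car = representation_carrier[OF is_group rep, folded d_def]
  have scalar: "\<exists>c. \<rho> f = c \<cdot>\<^sub>m 1\<^sub>m d" if f: "f \<in> carrier F" for f
  proof (rule schur_scalar[OF is_group \<rho> d_def[symmetric] car[OF f]])
    fix g assume g: "g \<in> carrier F"
    show "\<rho> f * \<rho> g = \<rho> g * \<rho> f"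
      using representation_mult[OF is_group rep f g] representation_mult[OF is_group rep g f] m_comm[OF f g] by simp
  qed
  let ?W = "range (\<lambda>c::complex. c \<cdot>\<^sub>v unit_vec d 0)"
  have "?W = {0\<^sub>v d} \<or> ?W = carrier_vec d"
  proof (rule irreducible_rep_vec[OF \<rho> d_def])
    show "0\<^sub>v d \<in> ?W" by (intro image_eqI[of _ _ 0]) auto
    fix v w assume "v \<in> ?W" "w \<in> ?W"
    then obtain b c where "v = b \<cdot>\<^sub>v unit_vec d 0" "w = c \<cdot>\<^sub>v unit_vec d 0" by auto
    then show "v + w \<in> ?W" by (intro image_eqI[of _ _ "b + c"]) (auto simp: add_smult_distrib_vec)
  next
    fix b v assume "v \<in> ?W"
    then obtain c where "v = c \<cdot>\<^sub>v unit_vec d 0" by auto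
    then show "b \<cdot>\<^sub>v v \<in> ?W" by (intro image_eqI[of _ _ "b * c"]) (auto simp: smult_smult_assoc)
  next
    fix g w assume g: "g \<in> carrier F" and "w \<in> ?W"
    then obtain c where w: "w = c \<cdot>\<^sub>v unit_vec d 0" by auto
    obtain b where b: "\<rho> g = b \<cdot>\<^sub>m 1\<^sub>m d" using scalar[OF g] by blast
    have "\<rho> g *\<^sub>v w = (b * c) \<cdot>\<^sub>v unit_vec d 0" unfolding b w by (intro eq_vecI) auto
    then show "\<rho> g *\<^sub>v w \<in> ?W" by blast
  qed auto
  moreover have "?W \<noteq> {0\<^sub>v d}"
  proof
    assume "?W = {0\<^sub>v d}"
    then have "1 \<cdot>\<^sub>v unit_vec d 0 = (0\<^sub>v d :: complex vec)" by blast
    from arg_cong[OF this, of "\<lambda>v. v $ 0"] show False using d0 by simp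
  qed
  ultimately have W: "?W = carrier_vec d" by blast
  have "\<not> d > 1"
  proof
    assume d: "d > 1"
    have "unit_vec d 1 \<in> ?W" unfolding W by simp
    then obtain c :: complex where "unit_vec d 1 = c \<cdot>\<^sub>v unit_vec d 0" by auto
    from arg_cong[OF this, of "\<lambda>v. v $ 1"] show False using d by simp
  qed
  then show ?thesis using d0 by (simp add: d_def)
qed

section \<open>Wreath products and Young subgroups\<close>

lemma wreath_carrier_iff:
  "(f, \<sigma>) \<in> carrier (wreath F n) \<longleftrightarrow> f \<in> {1..n} \<rightarrow>\<^sub>E carrier F \<and> \<sigma> permutes {1..n}"
  by (simp add: wreath_def product_group_def sym_group_carrier)

lemma wreath_mult:
  assumes "\<sigma> permutes {1..n}"
  shows "(f, \<sigma>) \<otimes>\<^bsub>wreath F n\<^esub> (f', \<sigma>') = (\<lambda>i\<in>{1..n}. f i \<otimes>\<^bsub>F\<^esub> f' (inv' \<sigma> i), \<sigma> \<circ> \<sigma>')"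
  by (auto simp: wreath_def product_group_def sym_group_mult)

lemma wreath_one: "\<one>\<^bsub>wreath F n\<^esub> = (\<lambda>i\<in>{1..n}. \<one>\<^bsub>F\<^esub>, id)"
  by (simp add: wreath_def product_group_def sym_group_one)

text \<open>The base component of the inverse is the inverse permutation acting on the pointwise
  inverse of \<open>f\<close>. The action of a permutation evaluates at its inverse, which is why
  \<open>f\<close> is taken at \<open>\<sigma> i\<close>.\<close>

lemma wreath_group_inv:
  assumes F: "group F"
  shows wreath_group: "group (wreath F n)"
    and wreath_inv: "(f, \<sigma>) \<in> carrier (wreath F n) \<Longrightarrow>
      inv\<^bsub>wreath F n\<^esub> (f, \<sigma>) = (\<lambda>i\<in>{1..n}. inv\<^bsub>F\<^esub> f (\<sigma> i), inv' \<sigma>)"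
proof -
  interpret F: group F by fact
  have inner: "inv' \<sigma> i \<in> {1..n}" if "\<sigma> permutes {1..n}" "i \<in> {1..n}" for \<sigma> :: "nat \<Rightarrow> nat" and i
    using permutes_in_image[OF permutes_inv[OF that(1)]] that(2) by blast
  have val: "f i \<in> carrier F" if "f \<in> {1..n} \<rightarrow>\<^sub>E carrier F" "i \<in> {1..n}" for f :: "nat \<Rightarrow> 'a" and i
    using that by (rule PiE_mem)
  \<comment> \<open>The left inverse serves twice: it completes the group axioms, and afterwards it
    identifies the inverse.\<close>
  have linv: "(\<lambda>i\<in>{1..n}. inv\<^bsub>F\<^esub> f (\<sigma> i), inv' \<sigma>) \<otimes>\<^bsub>wreath F n\<^esub> (f, \<sigma>) = \<one>\<^bsub>wreath F n\<^esub>"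
    and icl: "(\<lambda>i\<in>{1..n}. inv\<^bsub>F\<^esub> f (\<sigma> i), inv' \<sigma>) \<in> carrier (wreath F n)"
    if c: "(f, \<sigma>) \<in> carrier (wreath F n)" for f \<sigma>
  proof -
    have f: "f \<in> {1..n} \<rightarrow>\<^sub>E carrier F" and \<sigma>: "\<sigma> permutes {1..n}" using c by (auto simp: wreath_carrier_iff)
    have \<sigma>i: "f (\<sigma> i) \<in> carrier F" if "i \<in> {1..n}" for i
      using val[OF f] permutes_in_image[OF \<sigma>] that by blast
    show "(\<lambda>i\<in>{1..n}. inv\<^bsub>F\<^esub> f (\<sigma> i), inv' \<sigma>) \<in> carrier (wreath F n)"
      unfolding wreath_carrier_iff using permutes_inv[OF \<sigma>] \<sigma>i by auto
    show "(\<lambda>i\<in>{1..n}. inv\<^bsub>F\<^esub> f (\<sigma> i), inv' \<sigma>) \<otimes>\<^bsub>wreath F n\<^esub> (f, \<sigma>) = \<one>\<^bsub>wreath F n\<^esub>"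
      unfolding wreath_mult[OF permutes_inv[OF \<sigma>]] wreath_one permutes_inv_inv[OF \<sigma>] permutes_inv_o(2)[OF \<sigma>]
      using \<sigma>i by (intro arg_cong2[of _ _ _ _ Pair] restrict_ext refl) simp
  qed
  show grp: "group (wreath F n)"
  proof (rule groupI)
    fix x y assume "x \<in> carrier (wreath F n)" "y \<in> carrier (wreath F n)"
    then obtain f \<sigma> g \<tau> where xy: "x = (f, \<sigma>)" "y = (g, \<tau>)" "f \<in> {1..n} \<rightarrow>\<^sub>E carrier F" "\<sigma> permutes {1..n}"
      "g \<in> {1..n} \<rightarrow>\<^sub>E carrier F" "\<tau> permutes {1..n}" by (metis surj_pair wreath_carrier_iff)
    show "x \<otimes>\<^bsub>wreath F n\<^esub> y \<in> carrier (wreath F n)"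
      unfolding xy(1,2) wreath_mult[OF xy(4)] wreath_carrier_iff
      using permutes_compose[OF xy(6,4)] val[OF xy(3)] val[OF xy(5) inner[OF xy(4)]] by auto
  next
    show "\<one>\<^bsub>wreath F n\<^esub> \<in> carrier (wreath F n)"
      unfolding wreath_one wreath_carrier_iff by (auto simp: permutes_id)
  next
    fix x y z assume "x \<in> carrier (wreath F n)" "y \<in> carrier (wreath F n)" "z \<in> carrier (wreath F n)"
    then obtain f \<sigma> g \<tau> h \<upsilon> where xyz: "x = (f, \<sigma>)" "y = (g, \<tau>)" "z = (h, \<upsilon>)"
      and c: "f \<in> {1..n} \<rightarrow>\<^sub>E carrier F" "\<sigma> permutes {1..n}"
      "g \<in> {1..n} \<rightarrow>\<^sub>E carrier F" "\<tau> permutes {1..n}" "h \<in> {1..n} \<rightarrow>\<^sub>E carrier F" "\<upsilon> permutes {1..n}"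
      by (metis surj_pair wreath_carrier_iff)
    have "inv' (\<sigma> \<circ> \<tau>) = inv' \<tau> \<circ> inv' \<sigma>" using permutes_bij[OF c(2)] permutes_bij[OF c(4)] by (rule o_inv_distrib)
    then show "x \<otimes>\<^bsub>wreath F n\<^esub> y \<otimes>\<^bsub>wreath F n\<^esub> z = x \<otimes>\<^bsub>wreath F n\<^esub> (y \<otimes>\<^bsub>wreath F n\<^esub> z)"
      unfolding xyz wreath_mult[OF c(2)] wreath_mult[OF c(4)] wreath_mult[OF permutes_compose[OF c(4,2)]]
      using val[OF c(1)] val[OF c(3) inner[OF c(2)]] val[OF c(5) inner[OF c(4) inner[OF c(2)]]] inner[OF c(2)]
      by (intro arg_cong2[of _ _ _ _ Pair] restrict_ext) (simp_all add: F.m_assoc comp_assoc)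
  next
    fix x assume "x \<in> carrier (wreath F n)"
    then obtain f \<sigma> where x: "x = (f, \<sigma>)" and c: "f \<in> {1..n} \<rightarrow>\<^sub>E carrier F" "\<sigma> permutes {1..n}"
      by (metis surj_pair wreath_carrier_iff)
    have "(\<lambda>i\<in>{1..n}. \<one>\<^bsub>F\<^esub> \<otimes>\<^bsub>F\<^esub> f i) = f"
      using val[OF c(1)] PiE_restrict[OF c(1)] by (metis (no_types, lifting) F.l_one restrict_ext)
    moreover have "(\<lambda>i\<in>{1..n}. (\<lambda>i\<in>{1..n}. \<one>\<^bsub>F\<^esub>) i \<otimes>\<^bsub>F\<^esub> f i) = (\<lambda>i\<in>{1..n}. \<one>\<^bsub>F\<^esub> \<otimes>\<^bsub>F\<^esub> f i)"
      by (rule restrict_ext) simp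
    ultimately show "\<one>\<^bsub>wreath F n\<^esub> \<otimes>\<^bsub>wreath F n\<^esub> x = x"
      unfolding x wreath_one wreath_mult[OF permutes_id] by simp
    show "\<exists>y\<in>carrier (wreath F n). y \<otimes>\<^bsub>wreath F n\<^esub> x = \<one>\<^bsub>wreath F n\<^esub>"
      using linv icl \<open>x \<in> carrier (wreath F n)\<close> unfolding x by blast
  qed
  show "inv\<^bsub>wreath F n\<^esub> (f, \<sigma>) = (\<lambda>i\<in>{1..n}. inv\<^bsub>F\<^esub> f (\<sigma> i), inv' \<sigma>)"
    if "(f, \<sigma>) \<in> carrier (wreath F n)"
    by (rule group.inv_equality[OF grp linv[OF that] that icl[OF that]])
qed

lemma finite_wreath: "finite (carrier F) \<Longrightarrow> finite (carrier (wreath F n))"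
  by (simp add: wreath_def product_group_def sym_group_def finite_PiE finite_permutations)

lemma snd_wreath_hom: "group F \<Longrightarrow> group_hom (wreath F n) (sym_group n) snd"
  unfolding group_hom_def group_hom_axioms_def
  using wreath_group sym_group_is_group
  by (auto simp: hom_def wreath_carrier_iff wreath_mult sym_group_carrier sym_group_mult)

text \<open>As the preimage of \<open>K\<close> under the projection \<open>snd\<close>, this is a
  subgroup; the Young subgroup in place of \<open>K\<close> gives
  \<open>wreath_young\<close>.\<close>

lemma subgroup_wreath_preimage:
  assumes F: "group F" and K: "subgroup K (sym_group n)"
  shows "subgroup (carrier (product_group {1..n} (\<lambda>_. F)) \<times> K) (wreath F n)"
proof -
  interpret K: subgroup K "sym_group n" by fact
  interpret W: group "wreath F n" by (rule wreath_group[OF F])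
  note hom = group_hom.axioms(3)[OF snd_wreath_hom[OF F, of n], unfolded group_hom_axioms_def]
  have "carrier (product_group {1..n} (\<lambda>_. F)) \<times> K = {x \<in> carrier (wreath F n). snd x \<in> K}"
    using subgroup.subset[OF K] by (auto simp: wreath_def)
  moreover have "subgroup {x \<in> carrier (wreath F n). snd x \<in> K} (wreath F n)"
  proof (rule W.subgroupI)
    have "\<one>\<^bsub>wreath F n\<^esub> \<in> {x \<in> carrier (wreath F n). snd x \<in> K}"
      using group_hom.hom_one[OF snd_wreath_hom[OF F, of n]] K.one_closed by simp
    then show "{x \<in> carrier (wreath F n). snd x \<in> K} \<noteq> {}" by blast
  next
    fix x assume "x \<in> {x \<in> carrier (wreath F n). snd x \<in> K}"
    then show "inv\<^bsub>wreath F n\<^esub> x \<in> {x \<in> carrier (wreath F n). snd x \<in> K}"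
      using group_hom.hom_inv[OF snd_wreath_hom[OF F, of n]] K.m_inv_closed by simp
  next
    fix x y assume "x \<in> {x \<in> carrier (wreath F n). snd x \<in> K}" "y \<in> {x \<in> carrier (wreath F n). snd x \<in> K}"
    then show "x \<otimes>\<^bsub>wreath F n\<^esub> y \<in> {x \<in> carrier (wreath F n). snd x \<in> K}"
      using hom_mult[OF hom] K.m_closed by simp
  qed auto
  ultimately show ?thesis by simp
qed

lemma subgroup_wreath_top:
  assumes F: "group F"
  shows "subgroup (wreath_top F n) (wreath F n)"
proof -
  interpret F: group F by fact
  interpret G: group "wreath F n" by (rule wreath_group[OF F])
  have mem: "x \<in> wreath_top F n \<longleftrightarrow> (\<exists>\<sigma>. x = (\<lambda>i\<in>{1..n}. \<one>\<^bsub>F\<^esub>, \<sigma>) \<and> \<sigma> permutes {1..n})" for x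
    by (cases x) (auto simp: wreath_top_def product_group_def sym_group_carrier)
  have inner: "inv' \<sigma> i \<in> {1..n}" if "\<sigma> permutes {1..n}" "i \<in> {1..n}" for \<sigma> :: "nat \<Rightarrow> nat" and i
    using permutes_in_image[OF permutes_inv[OF that(1)]] that(2) by blast
  have car: "(\<lambda>i\<in>{1..n}. \<one>\<^bsub>F\<^esub>, \<sigma>) \<in> carrier (wreath F n)" if "\<sigma> permutes {1..n}" for \<sigma>
    using that by (auto simp: wreath_carrier_iff)
  show ?thesis
  proof (rule G.subgroupI)
    show "wreath_top F n \<subseteq> carrier (wreath F n)" using car by (auto simp: mem)
    show "wreath_top F n \<noteq> {}" using mem permutes_id by blast
  next
    fix x assume "x \<in> wreath_top F n"
    then obtain \<sigma> where x: "x = (\<lambda>i\<in>{1..n}. \<one>\<^bsub>F\<^esub>, \<sigma>)" "\<sigma> permutes {1..n}" by (auto simp: mem)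
    have "inv\<^bsub>wreath F n\<^esub> x = (\<lambda>i\<in>{1..n}. \<one>\<^bsub>F\<^esub>, inv' \<sigma>)"
      unfolding x(1) wreath_inv[OF F car[OF x(2)]]
      using permutes_in_image[OF x(2)] by (intro arg_cong2[of _ _ _ _ Pair] restrict_ext refl) (simp del: atLeastAtMost_iff)
    then show "inv\<^bsub>wreath F n\<^esub> x \<in> wreath_top F n" using permutes_inv[OF x(2)] mem by blast
  next
    fix x y assume "x \<in> wreath_top F n" "y \<in> wreath_top F n"
    then obtain \<sigma> \<tau> where x: "x = (\<lambda>i\<in>{1..n}. \<one>\<^bsub>F\<^esub>, \<sigma>)" "\<sigma> permutes {1..n}"
      and y: "y = (\<lambda>i\<in>{1..n}. \<one>\<^bsub>F\<^esub>, \<tau>)" "\<tau> permutes {1..n}" unfolding mem by blast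
    have "x \<otimes>\<^bsub>wreath F n\<^esub> y = (\<lambda>i\<in>{1..n}. \<one>\<^bsub>F\<^esub>, \<sigma> \<circ> \<tau>)"
      unfolding x(1) y(1) wreath_mult[OF x(2)] using inner[OF x(2)]
      by (intro arg_cong2[of _ _ _ _ Pair] restrict_ext refl) (simp del: atLeastAtMost_iff)
    then show "x \<otimes>\<^bsub>wreath F n\<^esub> y \<in> wreath_top F n" using permutes_compose[OF y(2) x(2)] mem by blast
  qed
qed

section \<open>Symmetric groups and Young subgroups\<close>

lemma sym_group_inv: "\<sigma> permutes {1..n} \<Longrightarrow> inv\<^bsub>sym_group n\<^esub> \<sigma> = inv' \<sigma>"
  using group.inv_equality[OF sym_group_is_group[of n], of "inv' \<sigma>" \<sigma>]
  by (simp add: sym_group_carrier sym_group_mult sym_group_one permutes_inv permutes_inv_o)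

lemma finite_sym_group: "finite (carrier (sym_group n))"
  by (simp add: sym_group_def finite_permutations)

lemma young_subgroup_permutes:
  "\<sigma> \<in> young_subgroup a \<Longrightarrow> \<sigma> permutes {1..sum_list a}"
  by (simp add: young_subgroup_def sym_group_carrier)

lemma young_subgroup_block:
  assumes "\<sigma> \<in> young_subgroup a" "k < length a" "i \<in> young_block a k"
  shows "\<sigma> i \<in> young_block a k"
  using assms by (auto simp: young_subgroup_def)

lemma subgroup_young_subgroup: "subgroup (young_subgroup a) (sym_group (sum_list a))"
proof -
  interpret group "sym_group (sum_list a)" by (rule sym_group_is_group)
  show ?thesis
  proof (rule subgroupI)
    show "young_subgroup a \<subseteq> carrier (sym_group (sum_list a))" by (auto simp: young_subgroup_def)
    have "id \<in> young_subgroup a" by (auto simp: young_subgroup_def sym_group_carrier permutes_id)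
    then show "young_subgroup a \<noteq> {}" by blast
  next
    fix \<sigma> assume \<sigma>: "\<sigma> \<in> young_subgroup a"
    note p = young_subgroup_permutes[OF \<sigma>]
    have "inv' \<sigma> ` young_block a k = young_block a k" if "k < length a" for k
    proof -
      have "inv' \<sigma> ` (\<sigma> ` young_block a k) = young_block a k"
        by (rule image_inv_f_f[OF permutes_inj[OF p]])
      then show ?thesis using \<sigma> that by (simp add: young_subgroup_def)
    qed
    then show "inv\<^bsub>sym_group (sum_list a)\<^esub> \<sigma> \<in> young_subgroup a"
      unfolding sym_group_inv[OF p] using permutes_inv[OF p] by (simp add: young_subgroup_def sym_group_carrier)
  next
    fix \<sigma> \<tau> assume \<sigma>\<tau>: "\<sigma> \<in> young_subgroup a" "\<tau> \<in> young_subgroup a"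
    have "(\<sigma> \<circ> \<tau>) ` young_block a k = young_block a k" if "k < length a" for k
      using \<sigma>\<tau> that unfolding image_comp[symmetric] by (simp add: young_subgroup_def)
    with \<sigma>\<tau> show "\<sigma> \<otimes>\<^bsub>sym_group (sum_list a)\<^esub> \<tau> \<in> young_subgroup a"
      by (simp add: young_subgroup_def sym_group_carrier sym_group_mult permutes_compose)
  qed
qed

text \<open>Since \<open>\<sigma>\<close> preserves the block, its values there exceed the offset,
  so the subtraction of natural numbers in \<open>young_proj\<close> is not truncated.\<close>

lemma young_proj_add:
  assumes "\<sigma> \<in> young_subgroup a" "k < length a" "i \<in> {1..a ! k}"
  shows "young_proj a k \<sigma> i \<in> {1..a ! k}"
    and "block_offset a k + young_proj a k \<sigma> i = \<sigma> (block_offset a k + i)"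
proof -
  have "\<sigma> (block_offset a k + i) \<in> young_block a k"
    by (rule young_subgroup_block[OF assms(1,2)]) (use assms(3) in \<open>auto simp: young_block_def\<close>)
  then show "young_proj a k \<sigma> i \<in> {1..a ! k}"
    "block_offset a k + young_proj a k \<sigma> i = \<sigma> (block_offset a k + i)"
    using assms(3) by (auto simp: young_proj_def young_block_def)
qed

lemma young_proj_comp:
  assumes "\<sigma> \<in> young_subgroup a" "\<tau> \<in> young_subgroup a" "k < length a"
  shows "young_proj a k (\<sigma> \<circ> \<tau>) = young_proj a k \<sigma> \<circ> young_proj a k \<tau>"
proof
  fix i
  show "young_proj a k (\<sigma> \<circ> \<tau>) i = (young_proj a k \<sigma> \<circ> young_proj a k \<tau>) i"
  proof (cases "i \<in> {1..a ! k}")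
    case True
    note y = young_proj_add[OF assms(2,3) True]
    have "young_proj a k \<sigma> (young_proj a k \<tau> i) = \<sigma> (block_offset a k + young_proj a k \<tau> i) - block_offset a k"
      using y(1) by (simp add: young_proj_def[of a k \<sigma>])
    then show ?thesis unfolding y(2) using True by (simp add: young_proj_def[of a k "\<sigma> \<circ> \<tau>"])
  next
    case False
    then show ?thesis by (auto simp: young_proj_def)
  qed
qed

lemma young_proj_id: "young_proj a k id = id"
  by (auto simp: young_proj_def)

text \<open>By multiplicativity of \<open>young_proj\<close>, the projection of the inverse
  permutation inverts the projection.\<close>

lemma young_proj_permutes:
  assumes \<sigma>: "\<sigma> \<in> young_subgroup a" and k: "k < length a"
  shows "young_proj a k \<sigma> permutes {1..a ! k}"
proof (rule bij_imp_permutes)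
  interpret S: subgroup "young_subgroup a" "sym_group (sum_list a)" by (rule subgroup_young_subgroup)
  note p = young_subgroup_permutes[OF \<sigma>]
  have \<sigma>': "inv' \<sigma> \<in> young_subgroup a" using S.m_inv_closed[OF \<sigma>] by (simp add: sym_group_inv[OF p])
  have id: "young_proj a k (inv' \<sigma>) (young_proj a k \<sigma> i) = i" "young_proj a k \<sigma> (young_proj a k (inv' \<sigma>) i) = i" for i
    using young_proj_comp[OF \<sigma>' \<sigma> k] young_proj_comp[OF \<sigma> \<sigma>' k] permutes_inv_o[OF p] young_proj_id[of a k]
    by (metis comp_apply id_apply)+
  show "bij_betw (young_proj a k \<sigma>) {1..a ! k} {1..a ! k}"
    by (rule bij_betwI[where g = "young_proj a k (inv' \<sigma>)"])
      (use young_proj_add(1)[OF \<sigma> k] young_proj_add(1)[OF \<sigma>' k] id in auto)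
  show "young_proj a k \<sigma> i = i" if "i \<notin> {1..a ! k}" for i using that by (auto simp: young_proj_def)
qed

section \<open>Outer tensor products as representations of a Young subgroup\<close>

context
  fixes a :: "nat list" and D'' :: "nat \<Rightarrow> (nat \<Rightarrow> nat) rep"
  assumes D'': "\<And>k. k < length a \<Longrightarrow> representation (sym_group (a ! k)) (D'' k)"
begin

lemma young_factor_carrier:
  assumes "k < length a" "\<sigma> \<in> young_subgroup a"
  shows "D'' k (young_proj a k \<sigma>)
    \<in> carrier_mat (rep_dim (sym_group (a ! k)) (D'' k)) (rep_dim (sym_group (a ! k)) (D'' k))"
  by (rule representation_carrier[OF sym_group_is_group D''[OF assms(1)]])
    (use young_proj_permutes[OF assms(2,1)] in \<open>simp add: sym_group_carrier\<close>)

lemma young_box_carrier: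
  assumes "\<sigma> \<in> young_subgroup a"
  shows "young_box a D'' \<sigma> \<in> carrier_mat
    (\<Prod>k\<leftarrow>[0..<length a]. rep_dim (sym_group (a ! k)) (D'' k)) (\<Prod>k\<leftarrow>[0..<length a]. rep_dim (sym_group (a ! k)) (D'' k))"
  unfolding young_box_def
  by (rule kronecker_list_carrier) (use young_factor_carrier assms in auto)

lemma mat_trace_young_box:
  assumes "\<sigma> \<in> young_subgroup a"
  shows "mat_trace (young_box a D'' \<sigma>) = (\<Prod>k\<leftarrow>[0..<length a]. mat_trace (D'' k (young_proj a k \<sigma>)))"
  unfolding young_box_def
  by (rule mat_trace_kronecker_list) (use young_factor_carrier assms in auto)

lemma young_box_mult:
  assumes "\<sigma> \<in> young_subgroup a" "\<tau> \<in> young_subgroup a"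
  shows "young_box a D'' (\<sigma> \<otimes>\<^bsub>sym_group (sum_list a)\<^esub> \<tau>) = young_box a D'' \<sigma> * young_box a D'' \<tau>"
proof -
  have "young_box a D'' (\<sigma> \<circ> \<tau>)
      = kronecker_list (map (\<lambda>k. D'' k (young_proj a k \<sigma>) * D'' k (young_proj a k \<tau>)) [0..<length a])"
    unfolding young_box_def
  proof (intro arg_cong[of _ _ kronecker_list] map_cong refl)
    fix k assume "k \<in> set [0..<length a]"
    then have k: "k < length a" by simp
    show "D'' k (young_proj a k (\<sigma> \<circ> \<tau>)) = D'' k (young_proj a k \<sigma>) * D'' k (young_proj a k \<tau>)"
      using representation_mult[OF sym_group_is_group D''[OF k], of "young_proj a k \<sigma>" "young_proj a k \<tau>"]
        young_proj_permutes[OF _ k] assms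
      by (simp add: young_proj_comp[OF assms k] sym_group_carrier sym_group_mult)
  qed
  also have "\<dots> = young_box a D'' \<sigma> * young_box a D'' \<tau>"
    unfolding young_box_def
    by (rule kronecker_list_mult) (use young_factor_carrier assms in auto)
  finally show ?thesis by (simp add: sym_group_mult)
qed

lemma young_box_one:
  "young_box a D'' \<one>\<^bsub>sym_group (sum_list a)\<^esub>
    = 1\<^sub>m (\<Prod>k\<leftarrow>[0..<length a]. rep_dim (sym_group (a ! k)) (D'' k))"
proof -
  have "young_box a D'' id = kronecker_list (map (\<lambda>k. 1\<^sub>m (rep_dim (sym_group (a ! k)) (D'' k))) [0..<length a])"
    unfolding young_box_def young_proj_id
  proof (intro arg_cong[of _ _ kronecker_list] map_cong refl)
    fix k assume "k \<in> set [0..<length a]"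
    then show "D'' k id = 1\<^sub>m (rep_dim (sym_group (a ! k)) (D'' k))"
      using representation_one[OF sym_group_is_group D'', of k] by (simp add: sym_group_one)
  qed
  then show ?thesis by (simp add: kronecker_list_one sym_group_one)
qed

end

text \<open>A tensor power of a line has a single basis tensor, all of whose digits are zero.
  Permuting its equal factors does nothing, so \<open>\<pi>\<close> disappears.\<close>

lemma tensor_power_rep_dim_one:
  assumes "rep_dim F D = 1"
  shows "tensor_power_rep F m D (f, \<pi>) = mat 1 1 (\<lambda>_. \<Prod>k = 1..m. D (f k) $$ (0, 0))"
  by (rule eq_matI) (auto simp: tensor_power_rep_def tensor_digit_def assms)

lemma prod_list_distrib:
  fixes f g :: "'a \<Rightarrow> 'b::comm_monoid_mult"
  shows "(\<Prod>k\<leftarrow>ks. f k * g k) = (\<Prod>k\<leftarrow>ks. f k) * (\<Prod>k\<leftarrow>ks. g k)"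
  by (induction ks) (simp_all add: ac_simps)

text \<open>Each tensor power is a \<open>1 \<times> 1\<close> matrix, so its Kronecker product with
  the value of \<open>D'' k\<close> is multiplication by a scalar. The base thus enters the trace
  through a product of linear characters, taken block by block.\<close>

lemma wreath_young_box_factor:
  fixes \<phi> :: "nat \<Rightarrow> 'f"
  assumes D: "\<And>k. k < length a \<Longrightarrow> rep_dim F (D k) = 1"
    and D'': "\<And>k. k < length a \<Longrightarrow> representation (sym_group (a ! k)) (D'' k)"
    and \<sigma>: "\<sigma> \<in> young_subgroup a"
  defines "V \<equiv> wreath_young_box a (\<lambda>k. wreath_rep F (a ! k) (D k) (D'' k))"
  shows "V (\<phi>, \<sigma>) \<in> carrier_mat
      (\<Prod>k\<leftarrow>[0..<length a]. rep_dim (sym_group (a ! k)) (D'' k)) (\<Prod>k\<leftarrow>[0..<length a]. rep_dim (sym_group (a ! k)) (D'' k))"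
    and "mat_trace (V (\<phi>, \<sigma>)) =
      (\<Prod>k\<leftarrow>[0..<length a]. \<Prod>j\<in>young_block a k. D k (\<phi> j) $$ (0, 0)) * mat_trace (young_box a D'' \<sigma>)"
proof -
  let ?d = "\<lambda>k. rep_dim (sym_group (a ! k)) (D'' k)"
  let ?A = "\<lambda>k. wreath_rep F (a ! k) (D k) (D'' k) (wreath_young_proj a k (\<phi>, \<sigma>))"
  have fac: "?A k \<in> carrier_mat (?d k) (?d k) \<and>
      mat_trace (?A k) = (\<Prod>j\<in>young_block a k. D k (\<phi> j) $$ (0, 0)) * mat_trace (D'' k (young_proj a k \<sigma>))"
    if k: "k < length a" for k
  proof -
    let ?T = "tensor_power_rep F (a ! k) (D k) (wreath_young_proj a k (\<phi>, \<sigma>))"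
    have T: "?T = mat 1 1 (\<lambda>_. \<Prod>i = 1..a ! k. D k (\<phi> (block_offset a k + i)) $$ (0, 0))"
      unfolding wreath_young_proj_def prod.case tensor_power_rep_dim_one[OF D[OF k]] by simp
    have Tc: "?T \<in> carrier_mat 1 1" by (simp add: T)
    note C = young_factor_carrier[where D'' = D'', OF D'' k \<sigma>]
    have A: "?A k = kronecker ?T (D'' k (young_proj a k \<sigma>))"
      by (simp add: wreath_rep_def wreath_young_proj_def)
    have "mat_trace ?T = (\<Prod>i = 1..a ! k. D k (\<phi> (block_offset a k + i)) $$ (0, 0))"
      by (simp add: T mat_trace_def)
    also have "\<dots> = (\<Prod>j\<in>young_block a k. D k (\<phi> j) $$ (0, 0))"
      unfolding young_block_def
      by (rule prod.reindex_bij_witness[of _ "\<lambda>j. j - block_offset a k" "\<lambda>i. block_offset a k + i"]) auto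
    finally show ?thesis
      using mat_trace_kronecker[OF Tc C] kronecker_carrier[OF Tc C] unfolding A by simp
  qed
  show "V (\<phi>, \<sigma>) \<in> carrier_mat (\<Prod>k\<leftarrow>[0..<length a]. ?d k) (\<Prod>k\<leftarrow>[0..<length a]. ?d k)"
    unfolding V_def wreath_young_box_def by (rule kronecker_list_carrier) (use fac in auto)
  have "mat_trace (V (\<phi>, \<sigma>)) = (\<Prod>k\<leftarrow>[0..<length a]. mat_trace (?A k))"
    unfolding V_def wreath_young_box_def by (rule mat_trace_kronecker_list) (use fac in auto)
  also have "\<dots> = (\<Prod>k\<leftarrow>[0..<length a].
      (\<Prod>j\<in>young_block a k. D k (\<phi> j) $$ (0, 0)) * mat_trace (D'' k (young_proj a k \<sigma>)))"
    using fac by (intro arg_cong[of _ _ prod_list] map_cong) auto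
  also have "\<dots> = (\<Prod>k\<leftarrow>[0..<length a]. \<Prod>j\<in>young_block a k. D k (\<phi> j) $$ (0, 0))
      * (\<Prod>k\<leftarrow>[0..<length a]. mat_trace (D'' k (young_proj a k \<sigma>)))"
    by (rule prod_list_distrib)
  finally show "mat_trace (V (\<phi>, \<sigma>)) =
      (\<Prod>k\<leftarrow>[0..<length a]. \<Prod>j\<in>young_block a k. D k (\<phi> j) $$ (0, 0)) * mat_trace (young_box a D'' \<sigma>)"
    using mat_trace_young_box[where D'' = D'', OF D'' \<sigma>] by simp
qed

text \<open>A base component of the form \<open>f\<^sup>-\<^sup>1 (\<sigma> \<cdot> f)\<close> is invisible to the linear characters,
  since \<open>\<sigma>\<close> permutes each block.\<close>

lemma prod_linear_char_coboundary:
  assumes F: "group F" and D: "representation F D" "rep_dim F D = 1"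
    and B: "bij_betw \<pi> B B" and \<psi>: "\<And>j. j \<in> B \<Longrightarrow> \<psi> j \<in> carrier F"
  shows "(\<Prod>j\<in>B. D (inv\<^bsub>F\<^esub> \<psi> j \<otimes>\<^bsub>F\<^esub> \<psi> (\<pi> j)) $$ (0, 0)) = 1"
proof -
  interpret F: group F by fact
  define \<xi> where "\<xi> = (\<lambda>x. D x $$ (0, 0))"
  note car = representation_carrier[OF F D(1), unfolded D(2)]
  have mult: "\<xi> (x \<otimes>\<^bsub>F\<^esub> y) = \<xi> x * \<xi> y" if "x \<in> carrier F" "y \<in> carrier F" for x y
    unfolding \<xi>_def representation_mult[OF F D(1) that]
    by (subst mult_mat_entry[OF car[OF that(1)] car[OF that(2)]]) simp_all
  have one: "\<xi> \<one>\<^bsub>F\<^esub> = 1" unfolding \<xi>_def representation_one[OF F D(1)] D(2) by simp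
  have "(\<Prod>j\<in>B. \<xi> (inv\<^bsub>F\<^esub> \<psi> j \<otimes>\<^bsub>F\<^esub> \<psi> (\<pi> j))) = (\<Prod>j\<in>B. \<xi> (inv\<^bsub>F\<^esub> \<psi> j)) * (\<Prod>j\<in>B. \<xi> (\<psi> (\<pi> j)))"
    unfolding prod.distrib[symmetric]
    using \<psi> bij_betwE[OF B] by (intro prod.cong refl mult) auto
  \<comment> \<open>\<open>\<pi>\<close> only reorders the product over \<open>B\<close>; what
    remains cancels factor by factor.\<close>
  also have "(\<Prod>j\<in>B. \<xi> (\<psi> (\<pi> j))) = (\<Prod>j\<in>B. \<xi> (\<psi> j))"
    by (rule prod.reindex_bij_betw[OF B])
  also have "(\<Prod>j\<in>B. \<xi> (inv\<^bsub>F\<^esub> \<psi> j)) * \<dots> = (\<Prod>j\<in>B. \<xi> (inv\<^bsub>F\<^esub> \<psi> j \<otimes>\<^bsub>F\<^esub> \<psi> j))"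
    unfolding prod.distrib[symmetric] using \<psi> by (intro prod.cong refl mult[symmetric]) auto
  also have "\<dots> = 1" using \<psi> one by (intro prod.neutral) auto
  finally show ?thesis by (simp add: \<xi>_def)
qed

section \<open>The character of \<open>U\<close> on the symmetric group\<close>

text \<open>Membership in \<open>wreath_young F a\<close> is decided by the permutation, so its
  coset representatives project to coset representatives of the Young subgroup, and corresponding
  summands of the two induced characters agree. The projected representatives may differ from those
  chosen for the symmetric group; \<open>sum_left_transversal\<close> bridges the gap.\<close>

lemma induced_wreath_char_on_top:
  fixes F :: "('f, 'b) monoid_scheme" and a :: "nat list"
  assumes F: "group F" and fin: "finite (carrier F)"
    and D: "\<And>k. k < length a \<Longrightarrow> representation F (D k)" "\<And>k. k < length a \<Longrightarrow> rep_dim F (D k) = 1"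
    and D'': "\<And>k. k < length a \<Longrightarrow> representation (sym_group (a ! k)) (D'' k)"
    and \<sigma>: "\<sigma> permutes {1..sum_list a}"
  shows "mat_trace (induced_rep (wreath F (sum_list a)) (wreath_young F a)
      (wreath_young_box a (\<lambda>k. wreath_rep F (a ! k) (D k) (D'' k))) (\<lambda>i\<in>{1..sum_list a}. \<one>\<^bsub>F\<^esub>, \<sigma>))
    = mat_trace (induced_rep (sym_group (sum_list a)) (young_subgroup a) (young_box a D'') \<sigma>)"
proof -
  define n where "n = sum_list a"
  define G where "G = wreath F n"
  define S where "S = sym_group n"
  define H where "H = wreath_young F a"
  define Y where "Y = young_subgroup a"
  define V where "V = wreath_young_box a (\<lambda>k. wreath_rep F (a ! k) (D k) (D'' k))"
  define B where "B = young_box a D''"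
  define s where "s = (\<lambda>i\<in>{1..n}. \<one>\<^bsub>F\<^esub>, \<sigma>)"
  interpret F: group F by fact
  interpret G: group G unfolding G_def by (rule wreath_group[OF F])
  interpret S: group S unfolding S_def by (rule sym_group_is_group)
  interpret snd: group_hom G S snd unfolding G_def S_def by (rule snd_wreath_hom[OF F])
  have finG: "finite (carrier G)" and finS: "finite (carrier S)"
    using finite_wreath[OF fin] finite_sym_group by (auto simp: G_def S_def)
  have Y: "subgroup Y S" unfolding Y_def S_def n_def by (rule subgroup_young_subgroup)
  have H_eq: "H = carrier (product_group {1..n} (\<lambda>_. F)) \<times> Y"
    by (simp add: H_def wreath_young_def Y_def n_def)
  have H: "subgroup H G" unfolding H_eq G_def using subgroup_wreath_preimage[OF F] Y by (simp add: S_def)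
  have H_iff: "x \<in> H \<longleftrightarrow> snd x \<in> Y" if "x \<in> carrier G" for x
    using that by (cases x) (auto simp: H_eq G_def wreath_def)
  have s: "s \<in> carrier G" unfolding s_def G_def wreath_carrier_iff using \<sigma> by (auto simp: n_def)
  have \<sigma>S: "\<sigma> \<in> carrier S" using \<sigma> by (simp add: S_def sym_group_carrier n_def)
  note Vfac = wreath_young_box_factor[where F = F and D = D and D'' = D'', OF D(2) D'', folded V_def Y_def B_def]
  have Bcar: "B h \<in> carrier_mat (\<Prod>k\<leftarrow>[0..<length a]. rep_dim (sym_group (a ! k)) (D'' k))
      (\<Prod>k\<leftarrow>[0..<length a]. rep_dim (sym_group (a ! k)) (D'' k))" if "h \<in> Y" for h
    using young_box_carrier[where D'' = D'', OF D''] that by (simp add: B_def Y_def)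
  have Bmult: "B (h \<otimes>\<^bsub>S\<^esub> k) = B h * B k" if "h \<in> Y" "k \<in> Y" for h k
    using young_box_mult[where D'' = D'', OF D''] that by (simp add: B_def Y_def S_def n_def)
  have conj: "zero_ext_char H V (inv\<^bsub>G\<^esub> t \<otimes>\<^bsub>G\<^esub> s \<otimes>\<^bsub>G\<^esub> t)
      = zero_ext_char Y B (inv\<^bsub>S\<^esub> (snd t) \<otimes>\<^bsub>S\<^esub> \<sigma> \<otimes>\<^bsub>S\<^esub> snd t)" if t: "t \<in> carrier G" for t
  proof -
    obtain f \<tau> where t_eq: "t = (f, \<tau>)" by (cases t)
    have f: "f \<in> {1..n} \<rightarrow>\<^sub>E carrier F" and \<tau>: "\<tau> permutes {1..n}"
      using t by (auto simp: t_eq G_def wreath_carrier_iff)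
    let ?h = "inv\<^bsub>G\<^esub> t \<otimes>\<^bsub>G\<^esub> s \<otimes>\<^bsub>G\<^esub> t"
    have hc: "?h \<in> carrier G" using t s by simp
    have snd_h: "snd ?h = inv\<^bsub>S\<^esub> (snd t) \<otimes>\<^bsub>S\<^esub> \<sigma> \<otimes>\<^bsub>S\<^esub> snd t"
      using t s by (simp add: s_def)
    show ?thesis
    proof (cases "snd ?h \<in> Y")
      case False
      then show ?thesis using H_iff[OF hc] snd_h by (simp add: zero_ext_char_def)
    next
      case True
      define \<rho> where "\<rho> = snd ?h"
      have \<rho>Y: "\<rho> \<in> young_subgroup a" using True by (simp add: \<rho>_def Y_def)
      note \<rho>p = young_subgroup_permutes[OF \<rho>Y, folded n_def]
      have \<tau>i: "inv' \<tau> permutes {1..n}" and \<sigma>n: "\<sigma> permutes {1..n}" using permutes_inv[OF \<tau>] \<sigma> by (auto simp: n_def)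
      have \<tau>\<sigma>: "inv' \<tau> \<circ> \<sigma> permutes {1..n}" by (rule permutes_compose[OF \<sigma>n \<tau>i])
      have inv\<tau>: "inv\<^bsub>S\<^esub> \<tau> = inv' \<tau>" unfolding S_def by (rule sym_group_inv[OF \<tau>])
      have \<rho>_eq: "\<rho> = inv' \<tau> \<circ> \<sigma> \<circ> \<tau>"
        unfolding \<rho>_def snd_h using inv\<tau> by (simp add: t_eq S_def sym_group_mult)
      \<comment> \<open>This rewrites the index produced by the wreath product multiplication as
        \<open>\<tau>\<close> applied to a permuted position, which brings the base component into
        coboundary form.\<close>
      have \<rho>_inv: "\<tau> (inv' \<rho> j) = inv' \<sigma> (\<tau> j)" for j
      proof -
        have "\<tau> (\<rho> x) = \<sigma> (\<tau> x)" for x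
          unfolding \<rho>_eq using permutes_inverses(1)[OF \<tau>] by simp
        from this[of "inv' \<rho> j"] have "\<sigma> (\<tau> (inv' \<rho> j)) = \<tau> j"
          using permutes_inverses(1)[OF \<rho>p] by simp
        then show ?thesis using permutes_inverses(2)[OF \<sigma>n] by metis
      qed
      \<comment> \<open>With \<open>\<psi> j = f (\<tau> j)\<close>, the base component at
        \<open>j\<close> is the inverse of \<open>\<psi> j\<close> times
        \<open>\<psi> (inv' \<rho> j)\<close>, as in
        \<open>prod_linear_char_coboundary\<close>.\<close>
      have h_eq: "?h = (\<lambda>j\<in>{1..n}. inv\<^bsub>F\<^esub> f (\<tau> j) \<otimes>\<^bsub>F\<^esub> f (\<tau> (inv' \<rho> j)), \<rho>)"
      proof -
        have in1: "inv' (inv' \<tau>) i = \<tau> i" for i using permutes_inv_inv[OF \<tau>] by simp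
        have \<tau>in: "\<tau> i \<in> {1..n}" if "i \<in> {1..n}" for i using permutes_in_image[OF \<tau>] that by blast
        have oinv: "inv' (inv' \<tau> \<circ> \<sigma>) i = inv' \<sigma> (\<tau> i)" for i
          using o_inv_distrib[OF permutes_bij[OF \<tau>i] permutes_bij[OF \<sigma>n]] in1 by simp
        have fv: "f (\<tau> i) \<in> carrier F" if "i \<in> {1..n}" for i using PiE_mem[OF f \<tau>in[OF that]] .
        have "inv\<^bsub>G\<^esub> t \<otimes>\<^bsub>G\<^esub> s = (\<lambda>i\<in>{1..n}. inv\<^bsub>F\<^esub> f (\<tau> i), inv' \<tau> \<circ> \<sigma>)"
          using t unfolding t_eq s_def G_def
          by (simp only: wreath_inv[OF F] wreath_mult[OF \<tau>i] in1)
            (intro arg_cong2[of _ _ _ _ Pair] restrict_ext refl, use fv \<tau>in in \<open>simp del: atLeastAtMost_iff\<close>)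
        then have "?h = (\<lambda>i\<in>{1..n}. inv\<^bsub>F\<^esub> f (\<tau> i), inv' \<tau> \<circ> \<sigma>) \<otimes>\<^bsub>G\<^esub> (f, \<tau>)"
          by (simp add: t_eq)
        also have "\<dots> = (\<lambda>j\<in>{1..n}. inv\<^bsub>F\<^esub> f (\<tau> j) \<otimes>\<^bsub>F\<^esub> f (\<tau> (inv' \<rho> j)), \<rho>)"
          unfolding G_def wreath_mult[OF \<tau>\<sigma>] \<rho>_eq[symmetric] oinv \<rho>_inv
          by (intro arg_cong2[of _ _ _ _ Pair] restrict_ext refl) simp
        finally show ?thesis .
      qed
      define \<phi> where "\<phi> = (\<lambda>j\<in>{1..n}. inv\<^bsub>F\<^esub> f (\<tau> j) \<otimes>\<^bsub>F\<^esub> f (\<tau> (inv' \<rho> j)))"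
      have block: "(\<Prod>j\<in>young_block a k. D k (\<phi> j) $$ (0, 0)) = 1" if k: "k < length a" for k
      proof -
        have sub: "young_block a k \<subseteq> {1..n}"
        proof -
          \<comment> \<open>The last position of a block is the next offset, which is a partial sum
            of \<open>a\<close>.\<close>
          have "block_offset a k + a ! k = block_offset a (Suc k)"
            using k by (simp add: block_offset_def take_Suc_conv_app_nth)
          also have "\<dots> \<le> n"
          proof -
            have "sum_list a = sum_list (take (Suc k) a) + sum_list (drop (Suc k) a)"
              by (metis append_take_drop_id sum_list_append)
            then show ?thesis by (simp add: block_offset_def n_def)
          qed
          finally show ?thesis by (auto simp: young_block_def)
        qed
        have \<rho>B: "\<rho> ` young_block a k = young_block a k" using \<rho>Y k by (simp add: young_subgroup_def)
        \<comment> \<open>Different blocks carry different characters, so the cancellation has to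
          happen within each block; it does because \<open>\<rho>\<close> lies in the Young
          subgroup.\<close>
        have "inv' \<rho> ` young_block a k = young_block a k"
          using image_inv_f_f[OF permutes_inj[OF \<rho>p], of "young_block a k"] \<rho>B by simp
        then have bij: "bij_betw (inv' \<rho>) (young_block a k) (young_block a k)"
          using permutes_inj_on[OF permutes_inv[OF \<rho>p]] by (simp add: bij_betw_def)
        have "f (\<tau> j) \<in> carrier F" if "j \<in> young_block a k" for j
        proof -
          have "\<tau> j \<in> {1..n}" using permutes_in_image[OF \<tau>] sub that by blast
          then show ?thesis by (rule PiE_mem[OF f])
        qed
        from prod_linear_char_coboundary[OF F D(1)[OF k] D(2)[OF k] bij, of "\<lambda>j. f (\<tau> j)", OF this]
        have "(\<Prod>j\<in>young_block a k. D k (inv\<^bsub>F\<^esub> f (\<tau> j) \<otimes>\<^bsub>F\<^esub> f (\<tau> (inv' \<rho> j))) $$ (0, 0)) = 1" .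
        moreover have "\<phi> j = inv\<^bsub>F\<^esub> f (\<tau> j) \<otimes>\<^bsub>F\<^esub> f (\<tau> (inv' \<rho> j))" if "j \<in> young_block a k" for j
          using sub that by (auto simp: \<phi>_def)
        ultimately show ?thesis by (simp cong: prod.cong)
      qed
      have "(\<Prod>k\<leftarrow>[0..<length a]. \<Prod>j\<in>young_block a k. D k (\<phi> j) $$ (0, 0)) = (\<Prod>k\<leftarrow>[0..<length a]. 1)"
        using block by (intro arg_cong[of _ _ prod_list] map_cong refl) simp
      also have "\<dots> = (1::complex)" by (induction "[0..<length a]") (auto simp: map_replicate_const)
      finally have one: "(\<Prod>k\<leftarrow>[0..<length a]. \<Prod>j\<in>young_block a k. D k (\<phi> j) $$ (0, 0)) = 1" .
      have "?h \<in> H" using H_iff[OF hc] True by simp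
      then have "zero_ext_char H V ?h = mat_trace (V ?h)" by (simp only: zero_ext_char_def if_True)
      also have "\<dots> = mat_trace (V (\<phi>, \<rho>))"
        unfolding \<phi>_def by (rule arg_cong[OF h_eq, of "\<lambda>h. mat_trace (V h)"])
      also have "\<dots> = mat_trace (B \<rho>)"
        using Vfac(2)[of \<rho> \<phi>] \<rho>Y one by (simp add: Y_def)
      also have "\<dots> = zero_ext_char Y B \<rho>"
        using \<rho>Y by (simp only: zero_ext_char_def Y_def if_True)
      finally have "zero_ext_char H V ?h = zero_ext_char Y B \<rho>" .
      then show ?thesis unfolding \<rho>_def snd_h .
    qed
  qed
  define ts where "ts = transversal G H"
  have ts: "left_transversal G H ts" unfolding ts_def by (rule left_transversal_transversal[OF G.is_group finG H])
  have tc: "ts ! i \<in> carrier G" if "i < length ts" for i using ts that by (auto simp: left_transversal_def)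
  \<comment> \<open>A permutation \<open>\<tau>\<close> is lifted to the element with trivial base
    component. By \<open>H_iff\<close>, which coset contains the lift is decided by the permutations
    alone.\<close>
  have ts': "left_transversal S Y (map snd ts)"
    unfolding left_transversal_iff[OF S.is_group Y]
  proof (intro conjI ballI)
    have sub: "set ts \<subseteq> carrier G" using ts by (simp add: left_transversal_def)
    show "set (map snd ts) \<subseteq> carrier S"
      unfolding set_map by (rule image_subsetI, rule snd.hom_closed, rule subsetD[OF sub])
    fix \<tau> assume \<tau>: "\<tau> \<in> carrier S"
    let ?t = "(\<lambda>i\<in>{1..n}. \<one>\<^bsub>F\<^esub>, \<tau>)"
    have t: "?t \<in> carrier G" using \<tau> by (auto simp: G_def wreath_carrier_iff S_def sym_group_carrier)
    have "(i < length (map snd ts) \<and> inv\<^bsub>S\<^esub> (map snd ts ! i) \<otimes>\<^bsub>S\<^esub> \<tau> \<in> Y)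
        \<longleftrightarrow> (i < length ts \<and> inv\<^bsub>G\<^esub> (ts ! i) \<otimes>\<^bsub>G\<^esub> ?t \<in> H)" for i
      using H_iff[of "inv\<^bsub>G\<^esub> (ts ! i) \<otimes>\<^bsub>G\<^esub> ?t"] tc[of i] t by auto
    then show "\<exists>!i. i < length (map snd ts) \<and> inv\<^bsub>S\<^esub> (map snd ts ! i) \<otimes>\<^bsub>S\<^esub> \<tau> \<in> Y"
      using ts t unfolding left_transversal_iff[OF G.is_group H] by simp
  qed
  have cY: "card Y \<noteq> 0"
    using subgroup.one_closed[OF Y] finite_subset[OF subgroup.subset[OF Y] finS] card_gt_0_iff[of Y] by blast
  \<comment> \<open>Used for the projected and for the chosen representatives: the left side is
    common to both, and the nonzero factor \<open>card Y\<close> cancels.\<close>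
  have sums: "(\<Sum>x\<in>carrier S. zero_ext_char Y B (inv\<^bsub>S\<^esub> x \<otimes>\<^bsub>S\<^esub> \<sigma> \<otimes>\<^bsub>S\<^esub> x)) = of_nat (card Y) *
      (\<Sum>i<length us. zero_ext_char Y B (inv\<^bsub>S\<^esub> (us ! i) \<otimes>\<^bsub>S\<^esub> \<sigma> \<otimes>\<^bsub>S\<^esub> us ! i))"
    if "left_transversal S Y us" for us
    by (rule sum_left_transversal[OF S.is_group finS Y that \<sigma>S])
      (rule zero_ext_char_conj[where \<rho> = B, OF S.is_group Y Bcar Bmult])
  have "mat_trace (induced_rep G H V s) = (\<Sum>i<length ts. zero_ext_char H V (inv\<^bsub>G\<^esub> (ts ! i) \<otimes>\<^bsub>G\<^esub> s \<otimes>\<^bsub>G\<^esub> ts ! i))"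
    unfolding ts_def
    by (rule mat_trace_induced_rep[OF G.is_group finG H])
      (use Vfac(1) in \<open>auto simp: H_eq Y_def\<close>)
  also have "\<dots> = (\<Sum>i<length (map snd ts). zero_ext_char Y B (inv\<^bsub>S\<^esub> (map snd ts ! i) \<otimes>\<^bsub>S\<^esub> \<sigma> \<otimes>\<^bsub>S\<^esub> map snd ts ! i))"
    using tc by (auto intro!: sum.cong simp: conj)
  also have "\<dots> = (\<Sum>i<length (transversal S Y).
      zero_ext_char Y B (inv\<^bsub>S\<^esub> (transversal S Y ! i) \<otimes>\<^bsub>S\<^esub> \<sigma> \<otimes>\<^bsub>S\<^esub> transversal S Y ! i))"
    using sums[OF ts'] sums[OF left_transversal_transversal[OF S.is_group finS Y]] cY by simp
  also have "\<dots> = mat_trace (induced_rep S Y B \<sigma>)"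
    by (rule mat_trace_induced_rep[where \<rho> = B, OF S.is_group finS Y Bcar, symmetric])
  finally show ?thesis by (simp add: G_def H_def V_def s_def S_def Y_def B_def n_def)
qed

theorem theorem3p4:
  fixes F :: "('f, 'b) monoid_scheme"
    and n :: nat
    and a :: "nat list"
    and D :: "nat \<Rightarrow> 'f rep"
    and D'' :: "nat \<Rightarrow> (nat \<Rightarrow> nat) rep"
    and U :: "((nat \<Rightarrow> 'f) \<times> (nat \<Rightarrow> nat)) rep"
    and W :: "(nat \<Rightarrow> nat) rep"
  assumes "comm_group F" and "finite (carrier F)"
    and "sum_list a = n"
    and "\<And>k. k < length a \<Longrightarrow> irreducible_rep F (D k)"
    and "\<And>k l. k < length a \<Longrightarrow> l < length a \<Longrightarrow> k \<noteq> l \<Longrightarrow> \<not> equivalent_reps F (D k) (D l)"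
    and "\<And>k. k < length a \<Longrightarrow> irreducible_rep (sym_group (a ! k)) (D'' k)"
    and "U = induced_rep (wreath F n) (wreath_young F a)
               (wreath_young_box a (\<lambda>k. wreath_rep F (a ! k) (D k) (D'' k)))"
    and "irreducible_rep (wreath F n) U"
    and "irreducible_rep (sym_group n) W"
  shows "rep_multiplicity (wreath F n) U
           (induced_rep (wreath F n) (wreath_top F n) (\<lambda>(f, \<sigma>). W \<sigma>))
       = rep_multiplicity (sym_group n) W
           (induced_rep (sym_group n) (young_subgroup a) (young_box a D''))"
proof -
  note n = assms(3)
  interpret F: comm_group F by fact
  let ?G = "wreath F n" and ?S = "sym_group n" and ?T = "wreath_top F n"
  let ?e = "\<lambda>i\<in>{1..n}. \<one>\<^bsub>F\<^esub>"
  let ?W = "\<lambda>(f :: nat \<Rightarrow> 'f, \<sigma>). W \<sigma>"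
  let ?X = "induced_rep ?S (young_subgroup a) (young_box a D'')"
  have G: "group ?G" by (rule wreath_group[OF F.is_group])
  have S: "group ?S" by (rule sym_group_is_group)
  have finG: "finite (carrier ?G)" by (rule finite_wreath[OF assms(2)])
  note finS = finite_sym_group[of n]
  have T: "subgroup ?T ?G" by (rule subgroup_wreath_top[OF F.is_group])
  interpret T: subgroup ?T ?G by fact
  have T_eq: "?T = (\<lambda>\<sigma>. (?e, \<sigma>)) ` carrier ?S"
    by (auto simp: wreath_top_def product_group_def)
  have snd_T: "snd h \<in> carrier ?S" if "h \<in> ?T" for h using that by (auto simp: T_eq)
  have snd_mult: "snd (x \<otimes>\<^bsub>?G\<^esub> y) = snd x \<otimes>\<^bsub>?S\<^esub> snd y" if "x \<in> ?T" "y \<in> ?T" for x y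
    using group_hom.hom_mult[OF snd_wreath_hom[OF F.is_group, of n]] T.mem_carrier that by blast
  have Wrep: "representation ?S W" and Urep: "representation ?G U"
    using assms(8,9) by (auto simp: irreducible_rep_def)
  have Wcar: "?W h \<in> carrier_mat (rep_dim ?S W) (rep_dim ?S W)" if "h \<in> ?T" for h
    using representation_carrier[OF S Wrep snd_T[OF that]] by (simp add: case_prod_beta)
  have Wmult: "?W (h \<otimes>\<^bsub>?G\<^esub> k) = ?W h * ?W k" if "h \<in> ?T" "k \<in> ?T" for h k
    using representation_mult[OF S Wrep snd_T[OF that(1)] snd_T[OF that(2)]] snd_mult[OF that]
    by (simp add: case_prod_beta)
  have Wone: "?W \<one>\<^bsub>?G\<^esub> = 1\<^sub>m (rep_dim ?S W)"
    using representation_one[OF S Wrep] by (simp add: wreath_one sym_group_one)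
  have Drep: "representation F (D k)" "rep_dim F (D k) = 1" if "k < length a" for k
    using assms(4)[OF that] rep_dim_abelian[OF assms(1) assms(4)[OF that]] by (auto simp: irreducible_rep_def)
  have D''rep: "representation (sym_group (a ! k)) (D'' k)" if "k < length a" for k
    using assms(6)[OF that] by (simp add: irreducible_rep_def)
  have Y: "subgroup (young_subgroup a) ?S" using subgroup_young_subgroup[of a] n by simp
  have Xrep: "representation ?S ?X"
    using young_box_carrier[where D'' = D'', OF D''rep] young_box_one[where D'' = D'', OF D''rep]
      young_box_mult[where D'' = D'', OF D''rep] n
    by (intro representation_induced_rep[OF S finS Y]) auto
  have U_top: "mat_trace (U (?e, \<sigma>)) = mat_trace (?X \<sigma>)" if "\<sigma> \<in> carrier ?S" for \<sigma>
    using induced_wreath_char_on_top[where D = D and D'' = D'', OF F.is_group assms(2) Drep D''rep, of \<sigma>] that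
    by (simp add: assms(7) n sym_group_carrier)
  \<comment> \<open>The inverse stays in \<open>wreath_top\<close>, so it is determined by its
    permutation.\<close>
  have inv_top: "inv\<^bsub>?G\<^esub> (?e, \<sigma>) = (?e, inv\<^bsub>?S\<^esub> \<sigma>)" if "\<sigma> \<in> carrier ?S" for \<sigma>
  proof -
    have \<sigma>T: "(?e, \<sigma>) \<in> ?T" using that by (auto simp: T_eq)
    have "inv\<^bsub>?G\<^esub> (?e, \<sigma>) \<in> ?T" using T.m_inv_closed[OF \<sigma>T] .
    moreover have "snd (inv\<^bsub>?G\<^esub> (?e, \<sigma>)) = inv\<^bsub>?S\<^esub> \<sigma>"
      using group_hom.hom_inv[OF snd_wreath_hom[OF F.is_group, of n] T.mem_carrier[OF \<sigma>T]] by simp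
    ultimately show ?thesis by (auto simp: T_eq)
  qed
  have inj: "inj_on (\<lambda>\<sigma>. (?e, \<sigma>)) (carrier ?S)" by (auto intro: inj_onI)
  \<comment> \<open>The multiplicities are compared as complex numbers; injectivity of
    \<open>of_nat\<close> brings the equation back to natural numbers at the end.\<close>
  have "of_nat (rep_multiplicity ?G U (induced_rep ?G ?T ?W))
      = char_pairing ?G U (induced_rep ?G ?T ?W) / of_nat (card (carrier ?G))"
    by (rule rep_multiplicity_eq_char_pairing[OF G finG assms(8)])
      (rule representation_induced_rep[OF G finG T Wcar Wone Wmult])
  also have "\<dots> = (\<Sum>h\<in>?T. mat_trace (U (inv\<^bsub>?G\<^esub> h)) * mat_trace (?W h)) / of_nat (card ?T)"
    by (rule char_pairing_induced_rep[OF G finG T Urep Wcar Wmult])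
  also have "(\<Sum>h\<in>?T. mat_trace (U (inv\<^bsub>?G\<^esub> h)) * mat_trace (?W h))
      = (\<Sum>\<sigma>\<in>carrier ?S. mat_trace (?X (inv\<^bsub>?S\<^esub> \<sigma>)) * mat_trace (W \<sigma>))"
    unfolding T_eq sum.reindex[OF inj] o_def prod.case
    by (intro sum.cong refl) (simp only: inv_top U_top group.inv_closed[OF S])
  \<comment> \<open>The pairing inverts the element in its first argument. Inverting the summation
    variable exchanges the roles of \<open>W\<close> and \<open>?X\<close>.\<close>
  also have "\<dots> = char_pairing ?S W ?X"
    unfolding char_pairing_def
    by (rule sum.reindex_bij_witness[of _ "\<lambda>\<sigma>. inv\<^bsub>?S\<^esub> \<sigma>" "\<lambda>\<sigma>. inv\<^bsub>?S\<^esub> \<sigma>"])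
      (use group.inv_closed[OF S] group.inv_inv[OF S] in \<open>auto simp: mult.commute\<close>)
  also have "card ?T = card (carrier ?S)" unfolding T_eq by (rule card_image[OF inj])
  also have "char_pairing ?S W ?X / of_nat (card (carrier ?S)) = of_nat (rep_multiplicity ?S W ?X)"
    by (rule rep_multiplicity_eq_char_pairing[OF S finS assms(9) Xrep, symmetric])
  finally show ?thesis by simp
qed

end
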